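(* Let $P$ be a $3$-dimensional Gorenstein polytope of degree $2$ and let $P^*$ be its dual Gorenstein polytope. Then $$\sum_{E\subset P,\ \dim E=1}\mathrm{Vol}_{\mathbb{N}}(E)\cdot\mathrm{Vol}_{\mathbb{N}}(E^* )=12,$$ where $E$ runs over all edges of $P$ and $E^*\subset P^*$ denotes the edge of $P^*$ dual to $E$.
   Context: Let $M\cong\mathbb{Z}^n$ be a lattice, $N=\mathrm{Hom}(M,\mathbb{Z})$, $M_{\mathbb{R}}=M\otimes\mathbb{R}$. A lattice polytope is the convex hull of finitely many points of $M$. For a lattice polytope $F$ of dimension $k$, $\mathrm{Vol}_{\mathbb{N}}(F)$ is $k!$ times its volume with respect to the lattice of its affine hull (for an edge this is its lattice length). For an $n$-dimensional lattice polytope $P$, $h^*_P(t):=(1-t)^{n+1}\sum_{k\ge 0}|kP\cap M|t^k$ is a polynomial, and $\deg P:=\deg h^*_P$. An $n$-dimensional lattice polytope $\Delta$ with $0$ in its interior is reflexive if $\{y\in N_{\mathbb{R}}:\langle x,y\rangle\ge -1\ \forall x\in\Delta\}$ is a lattice polytope; it is reflexive with respect to an interior lattice point $m$ if $\Delta-m$ is reflexive. $P$ is Gorenstein of index $r\ge1$ if $rP$ is reflexive with respect to some interior lattice point; then $\deg P=n+1-r$. Dual Gorenstein polytope: let $C_P=\{(\lambda x,\lambda):\lambda\ge 0,\ x\in P\}\subset (M\oplus\mathbb{Z})_{\mathbb{R}}$ and let $C_P^\vee\subset (N\oplus\mathbb{Z})_{\mathbb{R}}$ be the dual cone. For $P$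 Gorenstein of index $r$ there is a unique $m\in M\oplus\mathbb{Z}$ with $\langle m,y\rangle=1$ for all primitive lattice generators $y$ of the rays of $C_P^\vee$; $P^*:=\{y\in C_P^\vee:\langle m,y\rangle=1\}$ is a lattice polytope with respect to the affine lattice $\{y\in N\oplus\mathbb{Z}:\langle m,y\rangle=1\}$, and is again an $n$-dimensional Gorenstein polytope of index $r$. The face of $P^*$ dual to a proper face $F\subset P$ is $F^*=\{y\in P^*:\langle(x,1),y\rangle=0\ \forall x\in F\}$, with $\dim F+\dim F^*=n-1$. *)

theory Defs
  imports "HOL-Analysis.Analysis" "HOL-Computational_Algebra.Polynomial_FPS"
begin

(* M is the standard lattice of a Euclidean space 'a, so that its rank is DIM('a).
   The inner product identifies N with the same set of points. Products carry the
   product basis, so int_lattice at type 'a \<times> real is both M \<oplus> Z and N \<oplus> Z. *)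

definition int_lattice :: "'a::euclidean_space set" where
  "int_lattice = {x. \<forall>b\<in>Basis. x \<bullet> b \<in> \<int>}"

definition lattice_polytope :: "'a::euclidean_space set \<Rightarrow> bool" where
  "lattice_polytope P \<longleftrightarrow> (\<exists>V. finite V \<and> V \<subseteq> int_lattice \<and> P = convex hull V)"

(* b 0, ..., b (k - 1), where k = dim F, is a basis of the lattice of the affine hull of F,
   translated by the lattice point p to the origin. *)
definition affine_lattice_frame :: "'a::euclidean_space set \<Rightarrow> 'a \<Rightarrow> (nat \<Rightarrow> 'a) \<Rightarrow> bool" where
  "affine_lattice_frame F p b \<longleftrightarrow>
     inj_on b {..<nat (aff_dim F)} \<and> independent (b ` {..<nat (aff_dim F)}) \<and>
     p \<in> int_lattice \<inter> affine hull F \<and>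
     int_lattice \<inter> affine hull F =
       {p + (\<Sum>i<nat (aff_dim F). real_of_int (c i) *\<^sub>R b i) | c. True}"

(* The volume is the Lebesgue measure of F in the coordinates of a frame; it does not
   depend on the frame, since two frames differ by an integral unimodular affine map. *)
definition normalized_volume :: "'a::euclidean_space set \<Rightarrow> real" where
  "normalized_volume F =
     (SOME v. \<exists>p b. affine_lattice_frame F p b \<and>
        v = fact (nat (aff_dim F)) *
          measure (Pi\<^sub>M {..<nat (aff_dim F)} (\<lambda>_. lborel))
            {t \<in> {..<nat (aff_dim F)} \<rightarrow>\<^sub>E UNIV.
               p + (\<Sum>i<nat (aff_dim F). t i *\<^sub>R b i) \<in> F})"

definition dilate :: "nat \<Rightarrow> 'a::euclidean_space set \<Rightarrow> 'a set" where
  "dilate k P = (\<lambda>x. real k *\<^sub>R x) ` P"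

definition h_star :: "'a::euclidean_space set \<Rightarrow> int fps" where
  "h_star P = (1 - fps_X) ^ (DIM('a) + 1) *
     Abs_fps (\<lambda>k. int (card (dilate k P \<inter> int_lattice)))"

(* h_star P is a polynomial for every full-dimensional lattice polytope P. The relational
   form avoids choosing a value for the degree of other sets. *)
definition has_lattice_degree :: "'a::euclidean_space set \<Rightarrow> nat \<Rightarrow> bool" where
  "has_lattice_degree P d \<longleftrightarrow> (\<exists>p. h_star P = fps_of_poly p \<and> degree p = d)"

definition reflexive :: "'a::euclidean_space set \<Rightarrow> bool" where
  "reflexive D \<longleftrightarrow> lattice_polytope D \<and> 0 \<in> interior D \<and>
     lattice_polytope {y. \<forall>x\<in>D. x \<bullet> y \<ge> -1}"

definition gorenstein_of_index :: "nat \<Rightarrow> 'a::euclidean_space set \<Rightarrow> bool" where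
  "gorenstein_of_index r P \<longleftrightarrow>
     lattice_polytope P \<and> aff_dim P = int DIM('a) \<and> r \<ge> 1 \<and>
     (\<exists>m \<in> interior (dilate r P) \<inter> int_lattice. reflexive ((\<lambda>x. x - m) ` dilate r P))"

definition gorenstein :: "'a::euclidean_space set \<Rightarrow> bool" where
  "gorenstein P \<longleftrightarrow> (\<exists>r. gorenstein_of_index r P)"

definition cone_over :: "'a::euclidean_space set \<Rightarrow> ('a \<times> real) set" where
  "cone_over P = {(l *\<^sub>R x, l) | l x. l \<ge> 0 \<and> x \<in> P}"

definition dual_cone :: "'a::euclidean_space set \<Rightarrow> 'a set" where
  "dual_cone C = {y. \<forall>z\<in>C. z \<bullet> y \<ge> 0}"

definition primitive :: "'a::euclidean_space \<Rightarrow> bool" where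
  "primitive y \<longleftrightarrow> y \<in> int_lattice \<and> y \<noteq> 0 \<and>
     (\<forall>k::nat. \<forall>z\<in>int_lattice. y = real k *\<^sub>R z \<longrightarrow> k = 1)"

definition primitive_ray_generators :: "'a::euclidean_space set \<Rightarrow> 'a set" where
  "primitive_ray_generators C = {y. primitive y \<and> {t *\<^sub>R y | t. t \<ge> 0} face_of C}"

definition gorenstein_point :: "'a::euclidean_space set \<Rightarrow> 'a \<times> real" where
  "gorenstein_point P = (THE m. m \<in> int_lattice \<and>
     (\<forall>y \<in> primitive_ray_generators (dual_cone (cone_over P)). m \<bullet> y = 1))"

definition dual_gorenstein :: "'a::euclidean_space set \<Rightarrow> ('a \<times> real) set" where
  "dual_gorenstein P = {y \<in> dual_cone (cone_over P). gorenstein_point P \<bullet> y = 1}"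

(* A face G of dual_gorenstein P is measured by normalized_volume with respect to the points
   of N \<oplus> Z in its affine hull. That hull lies in the hyperplane gorenstein_point P \<bullet> y = 1,
   so these are the points of the affine lattice of that hyperplane. *)
definition dual_face :: "'a::euclidean_space set \<Rightarrow> 'a set \<Rightarrow> ('a \<times> real) set" where
  "dual_face P F = {y \<in> dual_gorenstein P. \<forall>x\<in>F. (x, 1) \<bullet> y = 0}"

end

theory Submission
  imports Defs
begin

text \<open>Comparing Ehrhart polynomials shows that \<open>P\<close> has index two, so \<open>Q = 2 P - m\<close> is
  reflexive. Its edges are twice as long as those of \<open>P\<close>, while \<open>y \<mapsto> (y, (1 - m \<bullet> y) / 2)\<close> maps the
  polar of \<open>Q\<close> onto the dual of \<open>P\<close> and preserves the lattice lengths of dual edges. It remains to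
  prove that the sum is 24 for a reflexive polytope \<open>Q\<close> of dimension three.

  Fix a generic lattice vector \<open>\<eta>\<close>. To an edge of lattice length \<open>c\<close> that starts at \<open>a\<close> in
  the primitive direction \<open>w\<close>, and to a facet \<open>x \<bullet> n = -1\<close> containing it, attach
  \<open>- (n \<bullet> \<eta>) * c / det (a, w, \<eta>)\<close>. The other facet at this edge has a normal of the form
  \<open>n + d * (a \<times> w)\<close> and traverses the edge backwards, so the two terms add up to \<open>c * d\<close>, the product of
  the two lattice lengths. Now correct the terms by differences of Dedekind sums, one for each
  endpoint of the edge; these corrections cancel between the two facets. By the reciprocity law the
  corrected terms of a unimodular triangle in a facet add up to 12 if \<open>\<eta>\<close> or \<open>- \<eta>\<close> lies in the cone
  over the triangle, and to 0 otherwise. Both sides are additive under subdivision, so this holds for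
  all lattice triangles. Coning the edges of each facet from a vertex covers \<open>\<eta>\<close> once and \<open>- \<eta>\<close>
  once, which gives 12 + 12.

  The same cones, made half-open by a shift along \<open>\<eta>\<close>, count the lattice points of the multiples
  of \<open>Q\<close>; comparing \<open>\<eta>\<close> with \<open>- \<eta>\<close> shows that the h*-polynomial of \<open>Q\<close> is palindromic, which is what the
  computation of the index needs.\<close>

subsection \<open>Dedekind sums\<close>

text \<open>The constant 12 comes from one computation. For a unimodular triangle of a facet put
  \<open>A = det3 i j \<eta>\<close>, \<open>B = det3 j k \<eta>\<close>,
  \<open>C = det3 k i \<eta>\<close>. Then \<open>- (n \<bullet> \<eta>) = A + B + C\<close>, and
  the uncorrected terms add up to \<open>(A + B + C) * (1 / A + 1 / B + 1 / C)\<close>, that is, 3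
  plus three sums like \<open>A / B + B / A\<close>. Reciprocity at a corner trades such a sum for 3
  times a product of two signs, so the total is 3 + 9 or 3 - 3. The obstacle is that a correction
  must not depend on the facet, or it would survive at the edge: only an endpoint and the line of
  the edge may enter. A residue modulo \<open>det3 x w \<eta>\<close> satisfies this, but the gcd
  term of the reciprocity law mixes both edges at a corner and has to be split with an auxiliary
  vector. No facet is triangulated: single triangles are subdivided, degenerate pieces included, and
  the closed boundary of a facet enters through two bijections from its edges to its
  vertices.\<close>

text \<open>Up to normalisation this is the Dedekind sum; only its reciprocity law is needed, so it is
  defined by the Euclidean algorithm that the law dictates.\<close>

function dedekind_nat :: "nat \<Rightarrow> nat \<Rightarrow> real" where
  "dedekind_nat h k = (let m = h mod k in
     if k = 0 \<or> m = 0 then 0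
     else m / k + k / m + (real (gcd m k))\<^sup>2 / (real m * real k) - 3 - dedekind_nat k m)"
  by auto
termination
  by (relation "Wellfounded.measure snd") auto

declare dedekind_nat.simps [simp del]

lemma dedekind_nat_mod: "dedekind_nat (h mod k) k = dedekind_nat h k"
  by (simp add: dedekind_nat.simps [of "h mod k" k] dedekind_nat.simps [of h k] Let_def)

lemma dedekind_nat_reciprocity_less:
  assumes "0 < h" "h < k"
  shows "dedekind_nat h k + dedekind_nat k h = h / k + k / h + (real (gcd h k))\<^sup>2 / (real h * real k) - 3"
  using assms by (simp add: dedekind_nat.simps [of h k] Let_def)

lemma dedekind_nat_reciprocity:
  assumes "0 < h" "0 < k"
  shows "dedekind_nat h k + dedekind_nat k h = h / k + k / h + (real (gcd h k))\<^sup>2 / (real h * real k) - 3"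
proof -
  consider "h < k" | "k < h" | "h = k" by linarith
  then show ?thesis
  proof cases
    case 1
    then show ?thesis using dedekind_nat_reciprocity_less assms by blast
  next
    case 2
    then show ?thesis using dedekind_nat_reciprocity_less [of k h] assms
      by (simp add: gcd.commute mult.commute add.commute)
  next
    case 3
    then show ?thesis using assms by (simp add: dedekind_nat.simps power2_eq_square)
  qed
qed

text \<open>Oddness has to come out of the recursion. With \<open>l = k - h\<close> one has
  \<open>k mod l = h mod l\<close> and \<open>k mod h = l mod h\<close>, so the reciprocity laws of
  the pairs \<open>(l, k)\<close>, \<open>(h, k)\<close> and \<open>(h, l)\<close> share their
  values; the three gcds agree, and the right-hand sides combine to zero.\<close>

lemma dedekind_nat_complement:
  assumes "0 < h" "h < k"
  shows "dedekind_nat (k - h) k = - dedekind_nat h k"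
proof -
  define l where "l = k - h"
  have k: "k = h + l" and l: "0 < l" "l < k" using assms by (auto simp: l_def)
  have g: "gcd l k = gcd h k" "gcd h l = gcd h k"
    unfolding k by (simp_all add: gcd.commute [of l])
  have "dedekind_nat k l = dedekind_nat h l" "dedekind_nat k h = dedekind_nat l h"
    using dedekind_nat_mod [of k l] dedekind_nat_mod [of h l] dedekind_nat_mod [of k h]
      dedekind_nat_mod [of l h] by (simp_all add: k)
  with dedekind_nat_reciprocity_less [OF l] dedekind_nat_reciprocity_less [OF assms]
    dedekind_nat_reciprocity [OF assms(1) l(1)]
  have "dedekind_nat l k + dedekind_nat h k =
      (l / k + k / l + (real (gcd h k))\<^sup>2 / (real l * real k) - 3) + (h / k + k / h + (real (gcd h k))\<^sup>2 / (real h * real k) - 3)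
      - (h / l + l / h + (real (gcd h k))\<^sup>2 / (real h * real l) - 3)"
    unfolding g by linarith
  also have "\<dots> = 0"
  proof -
    have "real h \<noteq> 0" "real l \<noteq> 0" "real h + real l \<noteq> 0" using assms(1) l(1) by auto
    then show ?thesis unfolding k of_nat_add by (simp add: divide_simps) algebra
  qed
  finally show ?thesis by (simp add: l_def)
qed

text \<open>Made odd in both arguments, as determinants with \<open>\<eta>\<close> occur with either
  sign; in the reciprocity law only the constant 3 then acquires signs.\<close>

definition dedekind :: "int \<Rightarrow> int \<Rightarrow> real" where
  "dedekind h k = sgn k * dedekind_nat (nat (h mod \<bar>k\<bar>)) (nat \<bar>k\<bar>)"

lemma dedekind_cong:
  assumes "h mod k = h' mod k"
  shows "dedekind h k = dedekind h' k"
proof -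
  have "h mod \<bar>k\<bar> = h' mod \<bar>k\<bar>"
    using assms by (simp add: mod_eq_dvd_iff)
  then show ?thesis by (simp add: dedekind_def)
qed

lemma dedekind_minus_right: "dedekind h (- k) = - dedekind h k"
  by (simp add: dedekind_def)

lemma dedekind_minus_left: "dedekind (- h) k = - dedekind h k"
proof (cases "h mod \<bar>k\<bar> = 0 \<or> k = 0")
  case True
  then have "k = 0 \<or> (- h) mod \<bar>k\<bar> = 0"
    by (metis abs_dvd_iff dvd_eq_mod_eq_0 dvd_minus_iff)
  with True show ?thesis
    by (auto simp: dedekind_def dedekind_nat.simps [of 0])
next
  case False
  define m where "m = h mod \<bar>k\<bar>"
  have m: "0 < m" "m < \<bar>k\<bar>" using False
    by (auto simp: m_def) (metis abs_dvd_iff dvd_eq_mod_eq_0 mod_int_pos_iff order_less_le zero_less_abs_iff)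
  have "(- h) mod \<bar>k\<bar> = \<bar>k\<bar> - m"
    using False by (simp add: m_def zmod_zminus1_eq_if)
  moreover have "dedekind_nat (nat \<bar>k\<bar> - nat m) (nat \<bar>k\<bar>) = - dedekind_nat (nat m) (nat \<bar>k\<bar>)"
    using m by (intro dedekind_nat_complement) auto
  ultimately show ?thesis
    using m by (simp add: dedekind_def m_def nat_diff_distrib)
qed

lemma dedekind_minus_minus: "dedekind (- h) (- k) = dedekind h k"
  by (simp add: dedekind_minus_left dedekind_minus_right)

lemma dedekind_reciprocity_pos:
  assumes "0 < h" "0 < k"
  shows "dedekind h k + dedekind k h = h / k + k / h + (real_of_int (gcd h k))\<^sup>2 / (real_of_int h * real_of_int k) - 3"
proof -
  obtain a b where ab: "h = int a" "k = int b" "0 < a" "0 < b"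
    using assms by (metis pos_int_cases)
  have "dedekind h k = dedekind_nat a b" "dedekind k h = dedekind_nat b a"
    using ab dedekind_nat_mod by (simp_all add: dedekind_def flip: zmod_int)
  then show ?thesis
    using dedekind_nat_reciprocity [OF ab(3,4)] ab by simp
qed

lemma dedekind_reciprocity:
  assumes "h \<noteq> 0" "k \<noteq> 0"
  shows "dedekind h k + dedekind k h =
    h / k + k / h + (real_of_int (gcd h k))\<^sup>2 / (real_of_int h * real_of_int k) - 3 * sgn h * sgn k"
proof -
  consider "0 < h" "0 < k" | "0 < h" "k < 0" | "h < 0" "0 < k" | "h < 0" "k < 0"
    using assms by linarith
  then show ?thesis
  proof cases
    case 1
    then show ?thesis using dedekind_reciprocity_pos by simp
  next
    case 2
    then show ?thesis using dedekind_reciprocity_pos [of h "- k"]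
      by (simp add: dedekind_minus_left dedekind_minus_right)
  next
    case 3
    then show ?thesis using dedekind_reciprocity_pos [of "- h" k]
      by (simp add: dedekind_minus_left dedekind_minus_right)
  next
    case 4
    then show ?thesis using dedekind_reciprocity_pos [of "- h" "- k"]
      by (simp add: dedekind_minus_left dedekind_minus_right)
  qed
qed

subsection \<open>Triple products\<close>

definition det3 :: "real ^ 3 \<Rightarrow> real ^ 3 \<Rightarrow> real ^ 3 \<Rightarrow> real" where
  "det3 x y z = x \<bullet> cross3 y z"

lemma det3_inner_cross3: "det3 x y z = cross3 x y \<bullet> z"
  by (simp add: det3_def cross3_def inner_vec_def sum_3 algebra_simps)

lemma det3_coords:
  "det3 x y z = x$1 * (y$2 * z$3 - y$3 * z$2) + x$2 * (y$3 * z$1 - y$1 * z$3)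
    + x$3 * (y$1 * z$2 - y$2 * z$1)"
  by (simp add: det3_def cross3_def inner_vec_def sum_3)

lemma det3_rotate: "det3 x y z = det3 y z x"
  by (simp add: det3_coords algebra_simps)

lemma det3_swap: "det3 y x z = - det3 x y z"
  by (simp add: det3_coords algebra_simps)

lemma det3_swap_right: "det3 x z y = - det3 x y z"
  by (simp add: det3_coords algebra_simps)

lemma det3_same [simp]: "det3 x x y = 0" "det3 y x x = 0" "det3 x y x = 0"
  by (simp_all add: det3_coords algebra_simps)

lemma det3_add: "det3 (x + x') y z = det3 x y z + det3 x' y z"
  "det3 x (y + y') z = det3 x y z + det3 x y' z"
  "det3 x y (z + z') = det3 x y z + det3 x y z'"
  by (simp_all add: det3_coords algebra_simps)

lemma det3_diff: "det3 (x - x') y z = det3 x y z - det3 x' y z"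
  "det3 x (y - y') z = det3 x y z - det3 x y' z"
  "det3 x y (z - z') = det3 x y z - det3 x y z'"
  by (simp_all add: det3_coords algebra_simps)

lemma det3_scaleR: "det3 (c *\<^sub>R x) y z = c * det3 x y z"
  "det3 x (c *\<^sub>R y) z = c * det3 x y z" "det3 x y (c *\<^sub>R z) = c * det3 x y z"
  by (simp_all add: det3_coords algebra_simps)

lemma det3_minus: "det3 (- x) y z = - det3 x y z"
  "det3 x (- y) z = - det3 x y z" "det3 x y (- z) = - det3 x y z"
  by (simp_all add: det3_coords algebra_simps)

lemma det3_zero [simp]: "det3 x y 0 = 0"
  by (simp add: det3_coords)

lemmas det3_simps = det3_add det3_diff det3_scaleR det3_minus

lemma cramer3:
  "det3 i j k *\<^sub>R y = det3 y j k *\<^sub>R i + det3 i y k *\<^sub>R j + det3 i j y *\<^sub>R k"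
  by (simp add: vec_eq_iff forall_3 det3_coords algebra_simps)

text \<open>The Pluecker relation between two-by-two minors in the quotient by the line of
  \<open>i\<close>. It evaluates the difference of the slopes of two edges at a common
  vertex.\<close>

lemma det3_pluecker:
  "det3 i j x * det3 i k y - det3 i k x * det3 i j y = det3 i j k * det3 i x y"
  by (simp add: det3_coords) algebra

text \<open>Cramer's rule in dual form: a covector is recovered from its values on \<open>i\<close>,
  \<open>u\<close>, \<open>v\<close>, the cross products being the dual basis up to the
  determinant.\<close>

lemma det3_scaleR_normal:
  "det3 i u v *\<^sub>R n = (i \<bullet> n) *\<^sub>R cross3 u v + (u \<bullet> n) *\<^sub>R cross3 v i + (v \<bullet> n) *\<^sub>R cross3 i u"
  by (simp add: vec_eq_iff forall_3 det3_coords cross3_def inner_vec_def sum_3 algebra_simps)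

subsection \<open>Lattice points and primitive vectors\<close>

lemma int_lattice_add: "x \<in> int_lattice \<Longrightarrow> y \<in> int_lattice \<Longrightarrow> x + y \<in> int_lattice"
  and int_lattice_diff: "x \<in> int_lattice \<Longrightarrow> y \<in> int_lattice \<Longrightarrow> x - y \<in> int_lattice"
  and int_lattice_minus: "x \<in> int_lattice \<Longrightarrow> - x \<in> int_lattice"
  and int_lattice_scaleR: "c \<in> \<int> \<Longrightarrow> x \<in> int_lattice \<Longrightarrow> c *\<^sub>R x \<in> int_lattice"
  by (auto simp: int_lattice_def inner_add_left inner_diff_left)

lemma int_lattice_inner: "x \<in> int_lattice \<Longrightarrow> y \<in> int_lattice \<Longrightarrow> x \<bullet> y \<in> \<int>"
  by (subst euclidean_inner) (auto simp: int_lattice_def intro!: Ints_sum Ints_mult)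

lemma int_lattice_vec: "x \<in> int_lattice \<longleftrightarrow> (\<forall>m. x $ m \<in> \<int>)" for x :: "real ^ 'n"
  by (auto simp: int_lattice_def Basis_vec_def inner_axis)

lemma int_lattice_cross3: "x \<in> int_lattice \<Longrightarrow> y \<in> int_lattice \<Longrightarrow> cross3 x y \<in> int_lattice"
  by (auto simp: int_lattice_vec cross3_def forall_3)

lemma int_lattice_det3:
  "x \<in> int_lattice \<Longrightarrow> y \<in> int_lattice \<Longrightarrow> z \<in> int_lattice \<Longrightarrow> det3 x y z \<in> \<int>"
  unfolding det3_def by (intro int_lattice_inner int_lattice_cross3)

lemma finite_bounded_int_lattice:
  fixes S :: "(real ^ 'n) set"
  assumes "bounded S"
  shows "finite (S \<inter> int_lattice)"
proof -
  obtain B where B: "\<And>x. x \<in> S \<Longrightarrow> norm x \<le> B" using assms bounded_iff by blast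
  define f :: "real ^ 'n \<Rightarrow> 'n \<Rightarrow> int" where "f = (\<lambda>x m. \<lfloor>x $ m\<rfloor>)"
  have "inj_on f (S \<inter> int_lattice)"
  proof (rule inj_onI)
    fix x y assume x: "x \<in> S \<inter> int_lattice" and y: "y \<in> S \<inter> int_lattice" and e: "f x = f y"
    show "x = y"
    proof (rule vec_eq_iff [THEN iffD2], rule allI)
      fix m
      have "\<lfloor>x $ m\<rfloor> = \<lfloor>y $ m\<rfloor>" using e unfolding f_def by meson
      moreover have "x $ m \<in> \<int>" "y $ m \<in> \<int>" using x y by (auto simp: int_lattice_vec)
      ultimately show "x $ m = y $ m" by (metis Ints_cases of_int_floor_cancel)
    qed
  qed
  moreover have "f ` (S \<inter> int_lattice) \<subseteq> Pi\<^sub>E UNIV (\<lambda>_. {\<lfloor>-B\<rfloor>..\<lceil>B\<rceil>})"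
  proof -
    have "\<lfloor>-B\<rfloor> \<le> \<lfloor>x $ m\<rfloor> \<and> \<lfloor>x $ m\<rfloor> \<le> \<lceil>B\<rceil>" if "x \<in> S" for x m
    proof -
      have "\<bar>x $ m\<bar> \<le> B" using B [OF that] component_le_norm_cart order_trans by blast
      then show ?thesis by linarith
    qed
    then show ?thesis by (auto simp: f_def)
  qed
  ultimately show ?thesis
    by (meson finite_PiE finite_atLeastAtMost_int finite_imageD finite_subset finite)
qed

text \<open>Some coordinate of \<open>w\<close> is nonzero, so \<open>t\<close> is rational; its
  reduced denominator divides every coordinate of \<open>w\<close> and is 1 by primitivity.\<close>

lemma primitive_scaleR_int_lattice:
  assumes w: "primitive w" and t: "t *\<^sub>R w \<in> int_lattice"
  shows "t \<in> \<int>"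
proof -
  have wl: "\<And>b. b \<in> Basis \<Longrightarrow> w \<bullet> b \<in> \<int>" using w by (auto simp: primitive_def int_lattice_def)
  have tl: "\<And>b. b \<in> Basis \<Longrightarrow> t * (w \<bullet> b) \<in> \<int>" using t by (auto simp: int_lattice_def)
  obtain b where b: "b \<in> Basis" "w \<bullet> b \<noteq> 0"
    using w by (metis euclidean_all_zero_iff primitive_def)
  obtain p q where pq: "t * (w \<bullet> b) = of_int p" "w \<bullet> b = of_int q"
    using wl tl b(1) by (metis Ints_cases)
  have "t = of_int p / of_int q" using pq b by (simp add: field_simps)
  then have "t \<in> \<rat>" by auto
  then obtain m n where mn: "n > 0" "t = of_int m / of_int n" "coprime m n"
    using Rats_cases' by metis
  have "w /\<^sub>R of_int n \<in> int_lattice"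
    unfolding int_lattice_def mem_Collect_eq
  proof
    fix c :: 'a assume c: "c \<in> Basis"
    obtain x where x: "w \<bullet> c = of_int x" using wl c by (metis Ints_cases)
    obtain y where y: "t * (w \<bullet> c) = of_int y" using tl c by (metis Ints_cases)
    have "of_int (m * x) = (of_int (n * y) :: real)" using x y mn by (simp add: field_simps)
    then have "n dvd m * x" by (metis dvd_triv_left of_int_eq_iff)
    then have "n dvd x" using mn(3) coprime_commute coprime_dvd_mult_right_iff by blast
    then show "(w /\<^sub>R of_int n) \<bullet> c \<in> \<int>" using x mn(1) by (auto simp: dvd_def field_simps)
  qed
  moreover have "w = real (nat n) *\<^sub>R (w /\<^sub>R of_int n)" using mn(1) by simp
  ultimately have "nat n = 1" using w unfolding primitive_def by blast
  then have "n = 1" by linarith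
  then show ?thesis using mn(2) by simp
qed

lemma primitive_of_inner:
  assumes "u \<in> int_lattice" "k \<in> int_lattice" "u \<bullet> k = 1"
  shows "primitive u"
  unfolding primitive_def
proof (intro conjI ballI allI impI)
  show "u \<noteq> 0" using assms by auto
  fix c :: nat and z assume z: "z \<in> int_lattice" "u = real c *\<^sub>R z"
  obtain m where "z \<bullet> k = of_int m" using int_lattice_inner z assms by (metis Ints_cases)
  then have "of_int (int c * m) = (1::real)" using z assms by simp
  then have "int c * m = 1" by linarith
  then show "c = 1" using zmult_eq_1_iff [of "int c" m] by auto
qed (use assms in auto)

lemma primitive_minus: "primitive w \<Longrightarrow> primitive (- w)"
  unfolding primitive_def
  by (metis int_lattice_minus minus_equation_iff neg_equal_0_iff_equal scaleR_minus_right)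

lemma exists_primitive:
  assumes v: "v \<in> int_lattice" "v \<noteq> 0"
  obtains w c where "primitive w" "c > 0" "v = real c *\<^sub>R w"
proof -
  \<comment> \<open>The divisors of \<open>v\<close>. A nonzero coordinate bounds them, and the
    largest one leaves a primitive quotient.\<close>
  define K where "K = {k::nat. \<exists>z\<in>int_lattice. v = real k *\<^sub>R z}"
  obtain b where b: "b \<in> Basis" "v \<bullet> b \<noteq> 0" using v(2) euclidean_all_zero_iff by blast
  have bound: "real k \<le> \<bar>v \<bullet> b\<bar>" if k: "k \<in> K" for k
  proof -
    obtain z where z: "z \<in> int_lattice" "v = real k *\<^sub>R z"
      using k unfolding K_def mem_Collect_eq ..
    have "z \<bullet> b \<in> \<int>" using z b by (auto simp: int_lattice_def)
    moreover have "z \<bullet> b \<noteq> 0" using z(2) b(2) by (intro notI) simp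
    ultimately have "1 \<le> \<bar>z \<bullet> b\<bar>" using Ints_nonzero_abs_ge1 by blast
    then have "real k * 1 \<le> real k * \<bar>z \<bullet> b\<bar>" by (intro mult_left_mono) auto
    then show ?thesis using z(2) by (simp add: abs_mult)
  qed
  have fin: "finite K"
  proof (rule finite_subset)
    show "K \<subseteq> {..nat \<lceil>\<bar>v \<bullet> b\<bar>\<rceil>}"
    proof
      fix k assume "k \<in> K"
      then have "real k \<le> \<bar>v \<bullet> b\<bar>" by (rule bound)
      then have "k \<le> nat \<lceil>\<bar>v \<bullet> b\<bar>\<rceil>" by linarith
      then show "k \<in> {..nat \<lceil>\<bar>v \<bullet> b\<bar>\<rceil>}" by simp
    qed
  qed simp
  have "1 \<in> K" unfolding K_def mem_Collect_eq using v(1) by (intro bexI [of _ v]) simp_all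
  define c where "c = Max K"
  have "c \<in> K" using fin \<open>1 \<in> K\<close> Max_in c_def by blast
  then obtain w where w: "w \<in> int_lattice" "v = real c *\<^sub>R w"
    unfolding K_def by blast
  have c: "c > 0" using w(2) v(2) by (intro gr0I) simp
  have "k = 1" if "z \<in> int_lattice" "w = real k *\<^sub>R z" for k z
  proof -
    have "v = real (c * k) *\<^sub>R z" using w(2) unfolding that(2) by simp
    then have "c * k \<in> K" using that(1) unfolding K_def by blast
    then have "c * k \<le> c" using fin c_def by simp
    moreover have "k \<noteq> 0" using that(2) w(2) v(2) by (intro notI) simp
    ultimately show ?thesis using c by simp
  qed
  moreover have "w \<noteq> 0" using w(2) v(2) by (intro notI) simp
  ultimately have "primitive w" using w(1) unfolding primitive_def by (intro conjI ballI allI impI)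
  then show ?thesis by (rule that [OF _ c w(2)])
qed

lemma primitive_imp_int_lattice: "primitive w \<Longrightarrow> w \<in> int_lattice"
  by (simp add: primitive_def)

lemma primitive_imp_nonzero: "primitive w \<Longrightarrow> w \<noteq> 0"
  by (simp add: primitive_def)

lemma primitive_scale_unique:
  assumes w: "primitive w" "primitive w'" and c: "c > 0" "c' > 0"
    and eq: "real c *\<^sub>R w = real c' *\<^sub>R w'"
  shows "w = w'" "c = c'"
proof -
  have *: "\<exists>m. m > 0 \<and> real b = real m * real a"
    if uv: "primitive u" "primitive v" and ab: "a > 0" "b > 0"
      and uv_eq: "real a *\<^sub>R u = real b *\<^sub>R v" for u v :: 'a and a b :: nat
  proof -
    have "u = (1 / real a) *\<^sub>R (real a *\<^sub>R u)" using ab(1) by simp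
    also have "\<dots> = (real b / real a) *\<^sub>R v" unfolding uv_eq by simp
    finally have "(real b / real a) *\<^sub>R v \<in> int_lattice"
      using primitive_imp_int_lattice [OF uv(1)] by metis
    then have "real b / real a \<in> \<int>" by (rule primitive_scaleR_int_lattice [OF uv(2)])
    then obtain m where m: "real b / real a = of_int m" by (rule Ints_cases)
    moreover have "0 < real b / real a" using ab by simp
    ultimately have "m > 0" by simp
    then have "real b = real (nat m) * real a" "nat m > 0" using m ab by (simp_all add: field_simps)
    then show ?thesis by blast
  qed
  obtain m n where "m > 0" "real c' = real m * real c" "n > 0" "real c = real n * real c'"
    using * [OF w c eq] * [OF w(2,1) c(2,1) eq [symmetric]] by blast
  then have "c \<le> c'" "c' \<le> c"
    by (metis One_nat_def Suc_leI mult_le_mono1 nat_mult_1 of_nat_eq_iff of_nat_mult)+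
  then show "c = c'" by simp
  then show "w = w'" using eq c by simp
qed

lemma primitive_bezout:
  fixes u :: "real ^ 3"
  assumes "primitive u"
  obtains k where "k \<in> int_lattice" "u \<bullet> k = 1"
proof -
  have "\<exists>a. u $ m = of_int a" for m
    using primitive_imp_int_lattice [OF assms] unfolding int_lattice_vec by (meson Ints_cases)
  then obtain a b c where u: "u $ 1 = of_int a" "u $ 2 = of_int b" "u $ 3 = of_int c"
    by blast
  define g where "g = gcd a (gcd b c)"
  define z :: "real ^ 3" where "z = vector [of_int (a div g), of_int (b div g), of_int (c div g)]"
  have dvd: "g dvd a" "g dvd b" "g dvd c" unfolding g_def by (auto intro: dvd_trans)
  have uz: "u = real (nat g) *\<^sub>R z"
  proof -
    have "real (nat g) = of_int g" unfolding g_def by simp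
    then show ?thesis using u dvd
      by (simp add: vec_eq_iff forall_3 z_def flip: of_int_mult)
  qed
  moreover have "z \<in> int_lattice" by (simp add: z_def int_lattice_vec forall_3)
  ultimately have "nat g = 1" using assms unfolding primitive_def by blast
  then have g1: "g = 1" by linarith
  obtain p q where pq: "p * a + q * gcd b c = 1" using bezout_int g_def g1 by metis
  obtain r s where rs: "r * b + s * c = gcd b c" using bezout_int by metis
  define k :: "real ^ 3" where "k = vector [of_int p, of_int (q * r), of_int (q * s)]"
  have "u \<bullet> k = of_int (p * a + q * (r * b + s * c))"
    by (simp add: k_def inner_vec_def sum_3 u algebra_simps)
  then have "u \<bullet> k = 1" using pq rs by simp
  moreover have "k \<in> int_lattice" by (simp add: k_def int_lattice_vec forall_3)
  ultimately show ?thesis using that by blast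
qed

text \<open>The double product \<open>cross3 n (cross3 a w)\<close> returns \<open>w\<close>, so a
  divisor of \<open>cross3 a w\<close> divides \<open>w\<close>. Here it matters that the facet has
  lattice distance one from the origin.\<close>

lemma cross3_primitive:
  fixes n :: "real ^ 3"
  assumes "a \<in> int_lattice" "n \<in> int_lattice" "a \<bullet> n = -1" "primitive w" "w \<bullet> n = 0"
  shows "primitive (cross3 a w)"
proof -
  have w: "w \<in> int_lattice" using assms by (auto simp: primitive_def)
  have *: "cross3 n (cross3 a w) = w"
    using assms(3,5) by (simp add: vec_eq_iff forall_3 cross3_def inner_vec_def sum_3) algebra
  show ?thesis unfolding primitive_def
  proof (intro conjI ballI allI impI)
    show "cross3 a w \<in> int_lattice" using assms w int_lattice_cross3 by blast
    show "cross3 a w \<noteq> 0"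
      using * assms(4) by (metis cross_zero_right primitive_def)
    fix k :: nat and z assume z: "z \<in> int_lattice" "cross3 a w = real k *\<^sub>R z"
    then have "w = real k *\<^sub>R cross3 n z" using * by (simp add: cross_mult_right)
    then show "k = 1" using assms z int_lattice_cross3 unfolding primitive_def by blast
  qed
qed

lemma primitive_complement:
  fixes n :: "real ^ 3"
  assumes "a \<in> int_lattice" "n \<in> int_lattice" "a \<bullet> n = -1" "primitive w" "w \<bullet> n = 0"
  obtains k where "k \<in> int_lattice" "det3 a w k = 1"
  using primitive_bezout [OF cross3_primitive [OF assms]] that
  by (metis det3_def det3_rotate inner_commute)

text \<open>A plane through the origin meets the moment curve \<open>(1, t, t^2)\<close> in at most
  two points, so some natural number \<open>t\<close> avoids finitely many planes.\<close>

lemma exists_lattice_vector_off_planes: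
  fixes S :: "(real ^ 3) set"
  assumes "finite S" "0 \<notin> S"
  obtains y where "y \<in> int_lattice" "\<And>v. v \<in> S \<Longrightarrow> v \<bullet> y \<noteq> 0"
proof -
  define p where "p v = [: v$1, v$2, v$3 :]" for v :: "real ^ 3"
  have "p v \<noteq> 0" if "v \<in> S" for v
  proof -
    have "v \<noteq> 0" using that assms(2) by metis
    then show ?thesis by (simp add: p_def vec_eq_iff forall_3)
  qed
  then have "finite (\<Union>v\<in>S. {t. poly (p v) t = 0})"
    using assms(1) poly_roots_finite by blast
  then have "finite (real -` (\<Union>v\<in>S. {t. poly (p v) t = 0}))"
    by (intro finite_vimageI inj_of_nat)
  then obtain t where "t \<notin> real -` (\<Union>v\<in>S. {t. poly (p v) t = 0})"
    using ex_new_if_finite [OF infinite_UNIV_nat] by blast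
  then have t: "real t \<notin> (\<Union>v\<in>S. {t. poly (p v) t = 0})" by blast
  define y :: "real ^ 3" where "y = vector [1, real t, real t ^ 2]"
  have "y \<in> int_lattice" by (simp add: y_def int_lattice_vec forall_3)
  moreover have "v \<bullet> y = poly (p v) (real t)" for v
    by (simp add: y_def p_def inner_vec_def sum_3 power2_eq_square algebra_simps)
  ultimately show ?thesis using t that by auto
qed

subsection \<open>Simplicial cones\<close>

text \<open>For positive \<open>det3 i j k\<close> this is the open cone spanned by the triangle, by
  Cramer's rule. The form with determinants also makes sense for degenerate triangles and turns into
  a sign condition for \<open>- \<eta>\<close>.\<close>

definition in_cone :: "real ^ 3 \<Rightarrow> real ^ 3 \<Rightarrow> real ^ 3 \<Rightarrow> real ^ 3 \<Rightarrow> bool" where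
  "in_cone i j k y \<longleftrightarrow> 0 < det3 i j y \<and> 0 < det3 j k y \<and> 0 < det3 k i y"

text \<open>The numbers \<open>a\<close>, \<open>b\<close>, \<open>c\<close> tell the side of
  \<open>y\<close> with respect to the planes through \<open>z\<close> and a vertex. Inside the big
  cone, \<open>\<alpha> * a + \<beta> * b + \<gamma> * c = 0\<close> forbids a constant sign, and a
  nonconstant cyclic word of three signs has exactly one change from minus to plus: this marks the
  subcone that contains \<open>y\<close>.\<close>

lemma in_cone_split:
  assumes hull: "z \<in> convex hull {i, j, k}"
    and ne: "det3 i z y \<noteq> 0" "det3 j z y \<noteq> 0" "det3 k z y \<noteq> 0"
  shows "(of_bool (in_cone i j k y) :: 'a :: semiring_1) =
    of_bool (in_cone i j z y) + of_bool (in_cone j k z y) + of_bool (in_cone k i z y)"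
proof -
  obtain \<alpha> \<beta> \<gamma> where nn: "0 \<le> \<alpha>" "0 \<le> \<beta>" "0 \<le> \<gamma>" "\<alpha> + \<beta> + \<gamma> = 1"
    and z: "z = \<alpha> *\<^sub>R i + \<beta> *\<^sub>R j + \<gamma> *\<^sub>R k" using hull unfolding convex_hull_3 by blast
  define A B C where "A = det3 i j y" and "B = det3 j k y" and "C = det3 k i y"
  have "det3 z i y = - det3 i z y" "det3 z j y = - det3 j z y" "det3 z k y = - det3 k z y"
    by (rule det3_swap)+
  moreover define a b c where "a = det3 i z y" and "b = det3 j z y" and "c = det3 k z y"
  ultimately have cones: "in_cone i j k y \<longleftrightarrow> 0 < A \<and> 0 < B \<and> 0 < C"
    "in_cone i j z y \<longleftrightarrow> 0 < A \<and> 0 < b \<and> a < 0"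
    "in_cone j k z y \<longleftrightarrow> 0 < B \<and> 0 < c \<and> b < 0"
    "in_cone k i z y \<longleftrightarrow> 0 < C \<and> 0 < a \<and> c < 0"
    by (auto simp: in_cone_def A_def B_def C_def)
  have a: "a = \<beta> * A - \<gamma> * C" and b: "b = \<gamma> * B - \<alpha> * A" and c: "c = \<alpha> * C - \<beta> * B"
    by (simp_all add: a_def b_def c_def A_def B_def C_def z det3_simps
        det3_swap [of i j] det3_swap [of j k] det3_swap [of k i])
  have abc: "a \<noteq> 0" "b \<noteq> 0" "c \<noteq> 0" using ne by (simp_all add: a_def b_def c_def)
  have pos: "0 < v" if "0 \<le> q" "0 < u" "0 \<le> p" "p * u < q * v" for p q u v :: real
    using that by (metis mult_nonneg_nonneg mult_nonneg_nonpos less_imp_le not_le order_less_le_trans)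
  show ?thesis
  proof (cases "0 < A \<and> 0 < B \<and> 0 < C")
    case True
    have s: "\<alpha> * a + \<beta> * b + \<gamma> * c = 0" by (simp add: a b c algebra_simps)
    have "\<not> (0 < a \<and> 0 < b \<and> 0 < c)"
    proof
      assume *: "0 < a \<and> 0 < b \<and> 0 < c"
      then have "0 \<le> \<alpha> * a" "0 \<le> \<beta> * b" "0 \<le> \<gamma> * c" using nn by auto
      with s have "\<alpha> * a = 0" "\<beta> * b = 0" "\<gamma> * c = 0" by linarith+
      with * nn show False by auto
    qed
    moreover have "\<not> (a < 0 \<and> b < 0 \<and> c < 0)"
    proof
      assume *: "a < 0 \<and> b < 0 \<and> c < 0"
      then have "\<alpha> * a \<le> 0" "\<beta> * b \<le> 0" "\<gamma> * c \<le> 0" using nn by (auto simp: mult_nonneg_nonpos)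
      with s have "\<alpha> * a = 0" "\<beta> * b = 0" "\<gamma> * c = 0" by linarith+
      with * nn show False by auto
    qed
    ultimately show ?thesis using True abc unfolding cones by (auto simp: not_less order_less_le)
  next
    case False
    \<comment> \<open>Each subcone lies in the big cone: its two inner inequalities compare products
      of the outer determinants, and one positive determinant forces the other two to be
      positive.\<close>
    have "\<not> (0 < A \<and> 0 < b \<and> a < 0)"
      using pos [of \<gamma> A \<alpha> B] pos [of \<gamma> A \<beta> C] False nn unfolding a b by auto
    moreover have "\<not> (0 < B \<and> 0 < c \<and> b < 0)"
      using pos [of \<alpha> B \<beta> C] pos [of \<alpha> B \<gamma> A] False nn unfolding b c by auto
    moreover have "\<not> (0 < C \<and> 0 < a \<and> c < 0)"
      using pos [of \<beta> C \<gamma> A] pos [of \<beta> C \<alpha> B] False nn unfolding a c by auto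
    ultimately show ?thesis using False unfolding cones by auto
  qed
qed

text \<open>Points of height -1 with vanishing determinant are collinear, so
  \<open>cross3 (j - i) (k - i)\<close> is zero. Its product with \<open>y\<close> is the sum of the
  three determinants, which therefore cannot all be positive.\<close>

lemma in_cone_degenerate:
  assumes "i \<bullet> n = -1" "j \<bullet> n = -1" "k \<bullet> n = -1" "det3 i j k = 0"
  shows "\<not> in_cone i j k y"
proof -
  have "cross3 (j - i) (k - i) = - (det3 i (j - i) (k - i) *\<^sub>R n)"
    using det3_scaleR_normal [of i "j - i" "k - i" n] assms by (simp add: inner_diff_left)
  also have "\<dots> = 0" using assms by (simp add: det3_simps)
  finally have "det3 y (j - i) (k - i) = 0" by (simp add: det3_def)
  then have "det3 i j y + det3 j k y + det3 k i y = 0"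
    by (simp add: det3_coords algebra_simps)
  then show ?thesis by (auto simp: in_cone_def)
qed

subsection \<open>Subdividing lattice triangles\<close>

text \<open>A determinant above 1 leaves a lattice point outside the span of the vertices. The
  fractional parts of its coordinates give a nonzero lattice point \<open>z\<close>; as the vertices
  have height -1, \<open>a + b + c\<close> is an integer, so 1 or 2, and \<open>z\<close> or
  \<open>i + j + k - z\<close> lies in the triangle.\<close>

lemma lattice_triangle_split:
  assumes F: "convex F" "n \<in> int_lattice" "\<And>x. x \<in> F \<Longrightarrow> x \<bullet> n = -1"
    and ijk: "i \<in> F \<inter> int_lattice" "j \<in> F \<inter> int_lattice" "k \<in> F \<inter> int_lattice"
    and det: "1 < det3 i j k"
  obtains z \<alpha> \<beta> \<gamma> where "z \<in> F \<inter> int_lattice" "z = \<alpha> *\<^sub>R i + \<beta> *\<^sub>R j + \<gamma> *\<^sub>R k"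
    "0 \<le> \<alpha>" "\<alpha> < 1" "0 \<le> \<beta>" "\<beta> < 1" "0 \<le> \<gamma>" "\<gamma> < 1" "\<alpha> + \<beta> + \<gamma> = 1"
proof -
  define N where "N = det3 i j k"
  have N: "N > 1" using det by (simp add: N_def)
  have lat: "i \<in> int_lattice" "j \<in> int_lattice" "k \<in> int_lattice" using ijk by auto
  have "\<exists>y\<in>int_lattice. \<not> (det3 y j k / N \<in> \<int> \<and> det3 i y k / N \<in> \<int> \<and> det3 i j y / N \<in> \<int>)"
  proof (rule ccontr)
    assume "\<not> ?thesis"
    then have *: "det3 y j k / N \<in> \<int>" "det3 i y k / N \<in> \<int>" "det3 i j y / N \<in> \<int>" if "y \<in> int_lattice" for y
      using that by blast+
    have ax: "(axis m 1 :: real ^ 3) \<in> int_lattice" for m :: 3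
      unfolding int_lattice_vec by (simp add: axis_def)
    \<comment> \<open>The dual basis. Were it integral, its determinant \<open>1 / N\<close> would
      be an integer.\<close>
    define u v w where "u = (1 / N) *\<^sub>R cross3 j k" and "v = (1 / N) *\<^sub>R cross3 k i"
      and "w = (1 / N) *\<^sub>R cross3 i j"
    have "u $ m = det3 (axis m 1) j k / N" "v $ m = det3 i (axis m 1) k / N"
      "w $ m = det3 i j (axis m 1) / N" for m
      using exhaust_3 [of m] by (auto simp: u_def v_def w_def det3_coords cross3_def axis_def algebra_simps)
    then have "u \<in> int_lattice" "v \<in> int_lattice" "w \<in> int_lattice"
      using * [OF ax] by (auto simp: int_lattice_vec)
    then have uvw: "det3 u v w \<in> \<int>" by (rule int_lattice_det3)
    have "det3 (cross3 j k) (cross3 k i) (cross3 i j) = N ^ 2"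
      unfolding N_def by (simp add: det3_coords cross3_def power2_eq_square) algebra
    then have "N ^ 3 * det3 u v w = N ^ 2"
      using N by (simp add: u_def v_def w_def det3_scaleR power3_eq_cube)
    then have "det3 u v w = 1 / N" using N by (simp add: power3_eq_cube power2_eq_square field_simps)
    with uvw N show False using Ints_nonzero_abs_less1 [of "1 / N"] by simp
  qed
  then obtain y where y: "y \<in> int_lattice"
    "\<not> (det3 y j k / N \<in> \<int> \<and> det3 i y k / N \<in> \<int> \<and> det3 i j y / N \<in> \<int>)" by blast
  define a b c where "a = frac (det3 y j k / N)" and "b = frac (det3 i y k / N)" and "c = frac (det3 i j y / N)"
  define z where "z = a *\<^sub>R i + b *\<^sub>R j + c *\<^sub>R k"
  have bounds: "0 \<le> a" "a < 1" "0 \<le> b" "b < 1" "0 \<le> c" "c < 1"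
    by (auto simp: a_def b_def c_def frac_lt_1)
  have "a + b + c \<noteq> 0"
    using y(2) bounds unfolding a_def b_def c_def by (metis add_nonneg_eq_0_iff add_nonneg_nonneg frac_eq_0_iff)
  then have pos: "0 < a + b + c" using bounds by linarith
  have "y = (1 / N) *\<^sub>R (N *\<^sub>R y)" using N by simp
  also have "\<dots> = (det3 y j k / N) *\<^sub>R i + (det3 i y k / N) *\<^sub>R j + (det3 i j y / N) *\<^sub>R k"
    unfolding N_def cramer3 [of i j k y] by (simp add: scaleR_add_right)
  finally have "z = y - (of_int \<lfloor>det3 y j k / N\<rfloor> *\<^sub>R i + of_int \<lfloor>det3 i y k / N\<rfloor> *\<^sub>R j
      + of_int \<lfloor>det3 i j y / N\<rfloor> *\<^sub>R k)"
    by (simp add: z_def a_def b_def c_def frac_def algebra_simps)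
  then have z: "z \<in> int_lattice"
    using y(1) lat by (simp add: int_lattice_diff int_lattice_add int_lattice_scaleR)
  have "z \<bullet> n = - (a + b + c)"
    using F(3) ijk by (simp add: z_def inner_add_left)
  then have "a + b + c \<in> \<int>" using int_lattice_inner [OF z F(2)] by (metis Ints_minus minus_minus)
  then obtain m where m: "a + b + c = of_int m" by (rule Ints_cases)
  then have "m = 1 \<or> m = 2" using pos bounds by linarith
  moreover have comb: "\<alpha> *\<^sub>R i + \<beta> *\<^sub>R j + \<gamma> *\<^sub>R k \<in> F"
    if "0 \<le> \<alpha>" "0 \<le> \<beta>" "0 \<le> \<gamma>" "\<alpha> + \<beta> + \<gamma> = 1" for \<alpha> \<beta> \<gamma>
    using that ijk F(1) convex_hull_3 [of i j k] hull_minimal [of "{i, j, k}" F convex] by blast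
  \<comment> \<open>If the sum is 2, no coordinate vanishes, so \<open>1 - a\<close>,
    \<open>1 - b\<close>, \<open>1 - c\<close> are again below 1.\<close>
  ultimately consider "a + b + c = 1" | "(1 - a) + (1 - b) + (1 - c) = 1" "0 < a" "0 < b" "0 < c"
    using m bounds by (cases "m = 1") auto
  then show ?thesis
  proof cases
    case 1
    then show ?thesis using that [of z a b c] z z_def bounds comb by auto
  next
    case 2
    let ?z = "(1 - a) *\<^sub>R i + (1 - b) *\<^sub>R j + (1 - c) *\<^sub>R k"
    have "?z = i + j + k - z" by (simp add: z_def algebra_simps)
    then have "?z \<in> int_lattice" using z lat by (simp add: int_lattice_add int_lattice_diff)
    then show ?thesis using that [of ?z "1 - a" "1 - b" "1 - c"] 2 bounds comb by auto
  qed
qed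

text \<open>Takes the place of a triangulation of the facet. A lattice point with barycentric
  coordinates below 1 makes all three determinants smaller; if it lies on an edge, one piece is
  degenerate, hence the case \<open>deg\<close>.\<close>

lemma lattice_triangle_induct:
  fixes P :: "real ^ 3 \<Rightarrow> real ^ 3 \<Rightarrow> real ^ 3 \<Rightarrow> bool"
  assumes F: "convex F" "n \<in> int_lattice" "\<And>x. x \<in> F \<Longrightarrow> x \<bullet> n = -1"
    and ijk: "i \<in> F \<inter> int_lattice" "j \<in> F \<inter> int_lattice" "k \<in> F \<inter> int_lattice" "0 \<le> det3 i j k"
    and deg: "\<And>i j k. {i, j, k} \<subseteq> F \<inter> int_lattice \<Longrightarrow> det3 i j k = 0 \<Longrightarrow> P i j k"
    and uni: "\<And>i j k. {i, j, k} \<subseteq> F \<inter> int_lattice \<Longrightarrow> det3 i j k = 1 \<Longrightarrow> P i j k"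
    and split: "\<And>i j k z. {i, j, k, z} \<subseteq> F \<inter> int_lattice \<Longrightarrow> 0 < det3 i j k \<Longrightarrow> z \<in> convex hull {i, j, k} \<Longrightarrow>
      z \<noteq> i \<Longrightarrow> z \<noteq> j \<Longrightarrow> z \<noteq> k \<Longrightarrow> P i j z \<Longrightarrow> P j k z \<Longrightarrow> P k i z \<Longrightarrow> P i j k"
  shows "P i j k"
  using ijk
proof (induction "nat \<lfloor>det3 i j k\<rfloor>" arbitrary: i j k rule: less_induct)
  case (less i j k)
  have "det3 i j k \<in> \<int>" using less.prems int_lattice_det3 by blast
  then obtain m where m: "det3 i j k = of_int m" by (rule Ints_cases)
  then have "m = 0 \<or> m = 1 \<or> 1 < m" using less.prems(4) by auto
  then show ?case
  proof (elim disjE)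
    assume "m = 0" then show ?thesis using deg less.prems m by simp
  next
    assume "m = 1" then show ?thesis using uni less.prems m by simp
  next
    assume m1: "1 < m"
    then have "1 < det3 i j k" by (simp add: m)
    then obtain z \<alpha> \<beta> \<gamma> where z: "z \<in> F \<inter> int_lattice" "z = \<alpha> *\<^sub>R i + \<beta> *\<^sub>R j + \<gamma> *\<^sub>R k"
      "0 \<le> \<alpha>" "\<alpha> < 1" "0 \<le> \<beta>" "\<beta> < 1" "0 \<le> \<gamma>" "\<gamma> < 1" "\<alpha> + \<beta> + \<gamma> = 1"
      using lattice_triangle_split [OF F less.prems(1-3)] by blast
    have dets: "det3 i j z = \<gamma> * m" "det3 j k z = \<alpha> * m" "det3 k i z = \<beta> * m"
      unfolding z(2) m [symmetric] by (simp_all add: det3_simps det3_rotate [of i j k] det3_rotate [of j k i])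
    have small: "nat \<lfloor>t * m\<rfloor> < nat \<lfloor>det3 i j k\<rfloor>" "0 \<le> t * m" if "0 \<le> t" "t < 1" for t :: real
    proof -
      have "t * of_int m < 1 * of_int m" using that m1 by (intro mult_strict_right_mono) auto
      then have "\<lfloor>t * m\<rfloor> < m" by (simp add: floor_less_iff)
      then show "nat \<lfloor>t * m\<rfloor> < nat \<lfloor>det3 i j k\<rfloor>" using m1 unfolding m by simp
      show "0 \<le> t * m" using that m1 by simp
    qed
    have ne: "z \<noteq> i" "z \<noteq> j" "z \<noteq> k"
    proof -
      have "det3 i j k \<noteq> 0" "det3 z j k = \<alpha> * m" "det3 i z k = \<beta> * m"
        using m m1 dets det3_rotate [of z j k] det3_rotate [of i z k] det3_rotate [of z k i] by auto
      then show "z \<noteq> i" "z \<noteq> j" "z \<noteq> k" using m m1 z dets by auto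
    qed
    show ?thesis
    proof (rule split [of i j k z])
      show "z \<in> convex hull {i, j, k}" unfolding convex_hull_3 using z by blast
      show "P i j z" "P j k z" "P k i z"
        using less.prems z small dets by (intro less.hyps; simp)+
    qed (use less.prems z ne m1 m in auto)
  qed
qed

subsection \<open>Edge terms\<close>

text \<open>The content of \<open>cross3 \<eta> x\<close>. Being defined without a triangle, it is
  the same number for all triangles at \<open>x\<close>.\<close>

definition corner_gcd :: "real ^ 3 \<Rightarrow> real ^ 3 \<Rightarrow> int" where
  "corner_gcd \<eta> x = Gcd {m. \<exists>y\<in>int_lattice. of_int m = det3 x y \<eta>}"

text \<open>Expanding \<open>y\<close> in the basis \<open>i\<close>, \<open>j\<close>,
  \<open>k\<close> makes \<open>det3 j y \<eta>\<close> an integral combination of \<open>a\<close>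
  and \<open>b\<close>; the choices \<open>y = i\<close> and \<open>y = k\<close> give these two up
  to sign.\<close>

lemma corner_gcd_eq:
  assumes lat: "i \<in> int_lattice" "j \<in> int_lattice" "k \<in> int_lattice" "\<eta> \<in> int_lattice"
    and det: "det3 i j k = 1" and ab: "of_int a = det3 i j \<eta>" "of_int b = det3 j k \<eta>"
  shows "corner_gcd \<eta> j = gcd b a"
proof -
  let ?S = "{m. \<exists>y\<in>int_lattice. of_int m = det3 j y \<eta>}"
  have "b \<in> ?S" using ab lat by auto
  moreover have "- a \<in> ?S"
    using ab lat by (intro CollectI bexI [of _ i]) (simp_all add: det3_swap [of j i])
  ultimately have "Gcd ?S dvd b" "Gcd ?S dvd - a" by (simp_all only: Gcd_dvd)
  then have "Gcd ?S dvd gcd b a" by simp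
  moreover have "gcd b a dvd Gcd ?S"
  proof (rule Gcd_greatest)
    fix m assume "m \<in> ?S"
    then obtain y where y: "y \<in> int_lattice" "of_int m = det3 j y \<eta>" by blast
    obtain p where p: "det3 y j k = of_int p" by (metis Ints_cases int_lattice_det3 lat y)
    obtain q where q: "det3 i j y = of_int q" by (metis Ints_cases int_lattice_det3 lat y)
    have yc: "y = of_int p *\<^sub>R i + det3 i y k *\<^sub>R j + of_int q *\<^sub>R k"
      using cramer3 [of i j k y] det p q by simp
    have "det3 j y \<eta> = of_int p * det3 j i \<eta> + of_int q * det3 j k \<eta>"
      using arg_cong [OF yc, of "\<lambda>v. det3 j v \<eta>"] by (simp add: det3_simps)
    then have "of_int m = (of_int (- (p * a) + q * b) :: real)"
      using y ab by (simp add: det3_swap [of j i])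
    then have "m = - (p * a) + q * b" by linarith
    then show "gcd b a dvd m" by simp
  qed
  ultimately show ?thesis unfolding corner_gcd_def
    by (rule zdvd_antisym_nonneg [rotated 2]) simp_all
qed

text \<open>The second summand cancels the term \<open>gcd\<^sup>2 / (h * k)\<close> of the reciprocity law;
  the auxiliary vector \<open>\<zeta>\<close> makes it a difference of two terms, one for each
  edge at the corner.\<close>

definition corner :: "real ^ 3 \<Rightarrow> real ^ 3 \<Rightarrow> real ^ 3 \<Rightarrow> real ^ 3 \<Rightarrow> real" where
  "corner \<eta> \<zeta> x w =
     dedekind \<lfloor>det3 x (SOME k. k \<in> int_lattice \<and> det3 x w k = 1) \<eta>\<rfloor> \<lfloor>det3 x w \<eta>\<rfloor>
     + (of_int (corner_gcd \<eta> x))\<^sup>2 / det3 x \<eta> \<zeta> * (det3 x w \<zeta> / det3 x w \<eta>)"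

text \<open>Two completions \<open>k\<close> differ by an integral multiple of \<open>w\<close>
  modulo \<open>x\<close>. This changes \<open>det3 x k \<eta>\<close> by a multiple of
  \<open>det3 x w \<eta>\<close>, which the Dedekind sum does not see.\<close>

lemma corner_eq:
  assumes lat: "x \<in> int_lattice" "w \<in> int_lattice" "k \<in> int_lattice" "\<eta> \<in> int_lattice"
    and det: "det3 x w k = 1"
  shows "corner \<eta> \<zeta> x w = dedekind \<lfloor>det3 x k \<eta>\<rfloor> \<lfloor>det3 x w \<eta>\<rfloor>
     + (of_int (corner_gcd \<eta> x))\<^sup>2 / det3 x \<eta> \<zeta> * (det3 x w \<zeta> / det3 x w \<eta>)"
proof -
  define k' where "k' = (SOME k. k \<in> int_lattice \<and> det3 x w k = 1)"
  have k': "k' \<in> int_lattice" "det3 x w k' = 1"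
    unfolding k'_def using someI [of "\<lambda>k. k \<in> int_lattice \<and> det3 x w k = 1" k] lat det by auto
  define d where "d = k' - k"
  have "det3 x w d = 0" using k' det by (simp add: d_def det3_diff)
  then have d: "d = det3 d w k *\<^sub>R x + det3 x d k *\<^sub>R w" using cramer3 [of x w k d] det by simp
  have "det3 x d k \<in> \<int>" using lat k' by (simp add: d_def int_lattice_det3 int_lattice_diff)
  then obtain m where m: "det3 x d k = of_int m" by (rule Ints_cases)
  obtain p where p: "det3 x k \<eta> = of_int p" by (metis Ints_cases int_lattice_det3 lat)
  obtain q where q: "det3 x w \<eta> = of_int q" by (metis Ints_cases int_lattice_det3 lat)
  have "det3 x d \<eta> = of_int m * det3 x w \<eta>"
    unfolding m [symmetric] by (subst d) (simp add: det3_simps)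
  moreover have "det3 x k' \<eta> = det3 x k \<eta> + det3 x d \<eta>" by (simp add: d_def det3_diff)
  ultimately have "det3 x k' \<eta> = of_int (p + m * q)" using p q by simp
  then have "dedekind \<lfloor>det3 x k' \<eta>\<rfloor> \<lfloor>det3 x w \<eta>\<rfloor> = dedekind \<lfloor>det3 x k \<eta>\<rfloor> \<lfloor>det3 x w \<eta>\<rfloor>"
    unfolding p q by (simp only: floor_of_int) (rule dedekind_cong, simp)
  then show ?thesis by (simp add: corner_def k'_def)
qed

text \<open>Passing to \<open>- w\<close> and \<open>- k\<close> keeps the determinant and the
  values. Hence the correction depends on the line of an edge, not on the direction in which a facet
  traverses it.\<close>

lemma corner_minus:
  assumes lat: "x \<in> int_lattice" "w \<in> int_lattice" "k \<in> int_lattice" "\<eta> \<in> int_lattice"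
    and det: "det3 x w k = 1"
  shows "corner \<eta> \<zeta> x (- w) = corner \<eta> \<zeta> x w"
proof -
  obtain p where p: "det3 x k \<eta> = of_int p" by (metis Ints_cases int_lattice_det3 lat)
  obtain q where q: "det3 x w \<eta> = of_int q" by (metis Ints_cases int_lattice_det3 lat)
  have "corner \<eta> \<zeta> x (- w) = dedekind \<lfloor>det3 x (- k) \<eta>\<rfloor> \<lfloor>det3 x (- w) \<eta>\<rfloor>
     + (of_int (corner_gcd \<eta> x))\<^sup>2 / det3 x \<eta> \<zeta> * (det3 x (- w) \<zeta> / det3 x (- w) \<eta>)"
    by (rule corner_eq) (use lat det in \<open>auto simp: int_lattice_minus det3_minus\<close>)
  then show ?thesis
    using p q by (simp add: det3_minus corner_eq [OF lat det] dedekind_minus_minus flip: of_int_minus)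
qed

text \<open>At \<open>j\<close> the edge from \<open>i\<close> is completed to a basis by
  \<open>k\<close>, and the edge to \<open>k\<close> by \<open>i\<close>. The two Dedekind sums are
  then \<open>dedekind b a\<close> and \<open>- dedekind a b\<close>, and their difference is one
  side of the reciprocity law.\<close>

lemma corner_diff:
  assumes lat: "i \<in> int_lattice" "j \<in> int_lattice" "k \<in> int_lattice" "\<eta> \<in> int_lattice"
    and det: "det3 i j k = 1" and ne: "det3 i j \<eta> \<noteq> 0" "det3 j k \<eta> \<noteq> 0" "det3 j \<eta> \<zeta> \<noteq> 0"
  shows "corner \<eta> \<zeta> j (j - i) - corner \<eta> \<zeta> j (k - j) =
    det3 i j \<eta> / det3 j k \<eta> + det3 j k \<eta> / det3 i j \<eta> - 3 * sgn (det3 i j \<eta>) * sgn (det3 j k \<eta>)"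
proof -
  obtain a where a: "det3 i j \<eta> = of_int a" by (metis Ints_cases int_lattice_det3 lat)
  obtain b where b: "det3 j k \<eta> = of_int b" by (metis Ints_cases int_lattice_det3 lat)
  have ab: "a \<noteq> 0" "b \<noteq> 0" using ne a b by auto
  let ?g = "(of_int (corner_gcd \<eta> j))\<^sup>2 :: real"
  have "corner \<eta> \<zeta> j (j - i) = dedekind \<lfloor>det3 j k \<eta>\<rfloor> \<lfloor>det3 j (j - i) \<eta>\<rfloor>
     + ?g / det3 j \<eta> \<zeta> * (det3 j (j - i) \<zeta> / det3 j (j - i) \<eta>)"
    by (rule corner_eq) (use lat det in \<open>auto simp: int_lattice_diff det3_diff det3_swap [of j i]\<close>)
  then have 1: "corner \<eta> \<zeta> j (j - i) = dedekind b a + ?g / det3 j \<eta> \<zeta> * (det3 i j \<zeta> / a)"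
    using a b by (simp add: det3_diff det3_swap [of j i])
  have "corner \<eta> \<zeta> j (k - j) = dedekind \<lfloor>det3 j i \<eta>\<rfloor> \<lfloor>det3 j (k - j) \<eta>\<rfloor>
     + ?g / det3 j \<eta> \<zeta> * (det3 j (k - j) \<zeta> / det3 j (k - j) \<eta>)"
    by (rule corner_eq) (use lat det in \<open>auto simp: int_lattice_diff det3_diff det3_rotate [of i j k]\<close>)
  then have 2: "corner \<eta> \<zeta> j (k - j) = - dedekind a b + ?g / det3 j \<eta> \<zeta> * (det3 j k \<zeta> / b)"
    using a b by (simp add: det3_diff det3_swap [of j i] dedekind_minus_left flip: of_int_minus)
  \<comment> \<open>Turns the difference of the two slopes into a multiple of
    \<open>det3 j \<eta> \<zeta>\<close>. Thus \<open>\<zeta>\<close> cancels, and what remains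
    removes the gcd term of the reciprocity law.\<close>
  have "det3 j i \<zeta> * det3 j k \<eta> - det3 j k \<zeta> * det3 j i \<eta> = det3 j i k * det3 j \<zeta> \<eta>"
    by (rule det3_pluecker)
  then have "det3 j k \<zeta> * a - det3 i j \<zeta> * b = det3 j \<eta> \<zeta>"
    using a b det by (simp add: det3_swap [of j i] det3_swap_right [of j \<zeta> \<eta>])
  then have "det3 i j \<zeta> / a - det3 j k \<zeta> / b = - det3 j \<eta> \<zeta> / (b * a)"
    using ab by (simp add: divide_simps)
  then have "?g / det3 j \<eta> \<zeta> * (det3 i j \<zeta> / a) - ?g / det3 j \<eta> \<zeta> * (det3 j k \<zeta> / b)
      = ?g / det3 j \<eta> \<zeta> * (- det3 j \<eta> \<zeta> / (b * a))"
    by (simp only: right_diff_distrib [symmetric])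
  also have "\<dots> = - ?g / (b * a)" using ne(3) by simp
  finally have "?g / det3 j \<eta> \<zeta> * (det3 i j \<zeta> / a) - ?g / det3 j \<eta> \<zeta> * (det3 j k \<zeta> / b)
      = - ?g / (b * a)" .
  moreover have "corner_gcd \<eta> j = gcd b a" using corner_gcd_eq [OF lat det] a b by metis
  ultimately show ?thesis
    using dedekind_reciprocity [OF ab(2,1)] unfolding 1 2 a b
    by (simp add: algebra_simps)
qed

definition lattice_direction :: "'a :: euclidean_space \<Rightarrow> 'a" where
  "lattice_direction v = (SOME w. primitive w \<and> (\<exists>c::nat. 0 < c \<and> v = real c *\<^sub>R w))"

definition lattice_length :: "'a :: euclidean_space \<Rightarrow> nat" where
  "lattice_length v = (THE c. v = real c *\<^sub>R lattice_direction v)"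

lemma lattice_direction_eq:
  assumes "primitive w" "0 < c"
  shows "lattice_direction (real c *\<^sub>R w) = w" "lattice_length (real c *\<^sub>R w) = c"
proof -
  let ?P = "\<lambda>u. primitive u \<and> (\<exists>b::nat. 0 < b \<and> real c *\<^sub>R w = real b *\<^sub>R u)"
  have "?P (lattice_direction (real c *\<^sub>R w))"
    unfolding lattice_direction_def using assms by (intro someI [of ?P w]) blast
  then show *: "lattice_direction (real c *\<^sub>R w) = w"
    using primitive_scale_unique(1) assms by metis
  show "lattice_length (real c *\<^sub>R w) = c"
    unfolding lattice_length_def * using primitive_imp_nonzero [OF assms(1)] by auto
qed

text \<open>At \<open>i = j\<close> there is no direction; the value 0 is what additivity on
  degenerate triangles requires.\<close>

definition edge_term :: "real ^ 3 \<Rightarrow> real ^ 3 \<Rightarrow> real ^ 3 \<Rightarrow> real ^ 3 \<Rightarrow> real ^ 3 \<Rightarrow> real" where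
  "edge_term \<eta> \<zeta> n i j = (if i = j then 0 else
     let w = lattice_direction (j - i) in
       - (n \<bullet> \<eta>) * lattice_length (j - i) / det3 i w \<eta> - (corner \<eta> \<zeta> j w - corner \<eta> \<zeta> i w))"

text \<open>The integer \<open>c\<close> may be negative or zero, so one direction \<open>w\<close>
  serves for all segments on a line. Reversal is harmless because \<open>corner\<close> ignores the
  sign of \<open>w\<close>.\<close>

lemma edge_term_eq:
  assumes lat: "i \<in> int_lattice" "n \<in> int_lattice" "\<eta> \<in> int_lattice" and n: "i \<bullet> n = -1"
    and w: "primitive w" "w \<bullet> n = 0" and j: "j = i + of_int c *\<^sub>R w"
  shows "edge_term \<eta> \<zeta> n i j =
    - (n \<bullet> \<eta>) * c / det3 i w \<eta> - (corner \<eta> \<zeta> j w - corner \<eta> \<zeta> i w)"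
proof -
  have wl: "w \<in> int_lattice" by (rule primitive_imp_int_lattice [OF w(1)])
  obtain k where k: "k \<in> int_lattice" "det3 i w k = 1"
    using primitive_complement [OF lat(1,2) n w] .
  have jl: "j \<in> int_lattice" using j lat wl by (simp add: int_lattice_add int_lattice_scaleR)
  have kj: "det3 j w k = 1" using k by (simp add: j det3_simps)
  have w0: "w \<noteq> 0" by (rule primitive_imp_nonzero [OF w(1)])
  consider "c = 0" | "c > 0" | "c < 0" by linarith
  then show ?thesis
  proof cases
    case 1
    then show ?thesis using j by (simp add: edge_term_def)
  next
    case 2
    then have "j - i = real (nat c) *\<^sub>R w" using j by simp
    moreover have "i \<noteq> j" using j w0 2 by simp
    ultimately show ?thesis
      using lattice_direction_eq [OF w(1), of "nat c"] 2 by (simp add: edge_term_def)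
  next
    case 3
    then have "j - i = real (nat (- c)) *\<^sub>R (- w)" using j by simp
    moreover have "i \<noteq> j" using j w0 3 by simp
    moreover have "corner \<eta> \<zeta> i (- w) = corner \<eta> \<zeta> i w" "corner \<eta> \<zeta> j (- w) = corner \<eta> \<zeta> j w"
      using corner_minus lat wl k jl kj by blast+
    ultimately show ?thesis
      using lattice_direction_eq [OF primitive_minus [OF w(1)], of "nat (- c)"] 3
      by (simp add: edge_term_def det3_minus)
  qed
qed

text \<open>On one line the signed lengths \<open>c\<close>, \<open>d - c\<close>,
  \<open>- d\<close> add up to zero, and the corner terms telescope.\<close>

lemma edge_term_collinear:
  assumes lat: "n \<in> int_lattice" "\<eta> \<in> int_lattice"
    and ijk: "i \<in> int_lattice" "j \<in> int_lattice" "k \<in> int_lattice"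
    and n: "i \<bullet> n = -1" "j \<bullet> n = -1" "k \<bullet> n = -1" and det: "det3 i j k = 0"
  shows "edge_term \<eta> \<zeta> n i j + edge_term \<eta> \<zeta> n j k + edge_term \<eta> \<zeta> n k i = 0"
proof -
  have "\<exists>w c d. primitive w \<and> w \<bullet> n = 0 \<and> j = i + of_int c *\<^sub>R w \<and> k = i + of_int d *\<^sub>R w
    \<or> i = j \<and> i = k"
  proof -
    have dir: "\<exists>w c. primitive w \<and> w \<bullet> n = 0 \<and> y = x + of_int c *\<^sub>R w"
      if xy: "x \<noteq> y" "x \<in> int_lattice" "y \<in> int_lattice" "x \<bullet> n = -1" "y \<bullet> n = -1" for x y
    proof -
      obtain w c where "primitive w" "0 < (c::nat)" "y - x = real c *\<^sub>R w"
        using exists_primitive [of "y - x"] xy(1) int_lattice_diff [OF xy(3,2)] by auto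
      moreover from this have "real c * (w \<bullet> n) = 0"
        using xy(4,5) by (metis inner_diff_left inner_scaleR_left right_minus_eq)
      ultimately show ?thesis
        by (intro exI [of _ w] exI [of _ "int c"]) (auto simp: algebra_simps)
    qed
    show ?thesis
    proof (cases "i = j")
      case True
      then show ?thesis using dir [of i k] ijk n
        by (cases "i = k") (simp, metis add.right_neutral of_int_0 scaleR_zero_left)
    next
      case False
      then obtain w c where w: "primitive w" "w \<bullet> n = 0" "j = i + of_int c *\<^sub>R w"
        using dir [of i j] ijk n by blast
      then have c: "c \<noteq> 0" using False by auto
      obtain m where m: "m \<in> int_lattice" "det3 i w m = 1"
        using primitive_complement [OF ijk(1) lat(1) n(1) w(1,2)] .
      have "det3 i w k = 0" using det c w(3) by (simp add: det3_simps)
      then have k: "k = det3 k w m *\<^sub>R i + det3 i k m *\<^sub>R w" using cramer3 [of i w m k] m(2) by simp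
      have "k \<bullet> n = - det3 k w m"
        using arg_cong [OF k, of "\<lambda>x. x \<bullet> n"] n(1) w(2) by (simp add: inner_add_left)
      then have "det3 k w m = 1" using n(3) by simp
      moreover obtain d where "det3 i k m = of_int d" by (metis Ints_cases int_lattice_det3 ijk m(1))
      ultimately show ?thesis using w k by (intro exI [of _ w] exI [of _ c] exI [of _ d]) simp
    qed
  qed
  then consider w c d where "primitive w" "w \<bullet> n = 0" "j = i + of_int c *\<^sub>R w" "k = i + of_int d *\<^sub>R w"
    | "i = j" "i = k" by blast
  then show ?thesis
  proof cases
    case 1
    have k: "k = j + of_int (d - c) *\<^sub>R w" and i: "i = k + of_int (- d) *\<^sub>R w"
      using 1 by (simp_all add: algebra_simps)
    note edge_term_eq [OF ijk(2) lat n(2) 1(1,2) k, of \<zeta>]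
      edge_term_eq [OF ijk(3) lat n(3) 1(1,2) i, of \<zeta>]
    moreover have "det3 j w \<eta> = det3 i w \<eta>" "det3 k w \<eta> = det3 i w \<eta>"
      using 1 by (simp_all add: det3_simps)
    ultimately show ?thesis
      using edge_term_eq [OF ijk(1) lat n(1) 1(1,2,3), of \<zeta>] by (simp add: diff_divide_distrib algebra_simps)
  next
    case 2
    then show ?thesis by (simp add: edge_term_def)
  qed
qed

text \<open>In the lattice basis \<open>i\<close>, \<open>j\<close>, \<open>k\<close> the vector
  \<open>\<eta>\<close> has the coordinates \<open>B\<close>, \<open>C\<close>, \<open>A\<close>,
  whence \<open>- (n \<bullet> \<eta>) = A + B + C\<close>. At each vertex the corrections of the
  two edges meeting there form one instance of \<open>corner_diff\<close>.\<close>

lemma edge_term_unimodular: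
  assumes lat: "n \<in> int_lattice" "\<eta> \<in> int_lattice"
    and ijk: "i \<in> int_lattice" "j \<in> int_lattice" "k \<in> int_lattice"
    and n: "i \<bullet> n = -1" "j \<bullet> n = -1" "k \<bullet> n = -1" and det: "det3 i j k = 1"
    and ne: "det3 i j \<eta> \<noteq> 0" "det3 j k \<eta> \<noteq> 0" "det3 k i \<eta> \<noteq> 0"
    and \<zeta>: "det3 i \<eta> \<zeta> \<noteq> 0" "det3 j \<eta> \<zeta> \<noteq> 0" "det3 k \<eta> \<zeta> \<noteq> 0"
  shows "edge_term \<eta> \<zeta> n i j + edge_term \<eta> \<zeta> n j k + edge_term \<eta> \<zeta> n k i =
    12 * (of_bool (in_cone i j k \<eta>) + of_bool (in_cone i j k (- \<eta>)))"
proof -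
  define A B C where "A = det3 i j \<eta>" and "B = det3 j k \<eta>" and "C = det3 k i \<eta>"
  have dets: "det3 j k i = 1" "det3 k i j = 1" using det det3_rotate by metis+
  have edge: "edge_term \<eta> \<zeta> n x y = - (n \<bullet> \<eta>) / det3 x y \<eta> - (corner \<eta> \<zeta> y (y - x) - corner \<eta> \<zeta> x (y - x))"
    if "x \<in> int_lattice" "y \<in> int_lattice" "z \<in> int_lattice" "x \<bullet> n = -1" "y \<bullet> n = -1" "det3 x y z = 1"
    for x y z
  proof -
    have "(y - x) \<bullet> cross3 z x = det3 (y - x) z x" by (simp add: det3_def)
    also have "\<dots> = 1" using that(6) by (simp add: det3_diff det3_rotate [of x y z] )
    finally have "primitive (y - x)"
      using that by (intro primitive_of_inner [of _ "cross3 z x"] int_lattice_diff int_lattice_cross3) auto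
    then show ?thesis
      using edge_term_eq [of x n \<eta> "y - x" y 1 \<zeta>] that lat by (simp add: inner_diff_left det3_diff)
  qed
  have "\<eta> = det3 \<eta> j k *\<^sub>R i + det3 i \<eta> k *\<^sub>R j + det3 i j \<eta> *\<^sub>R k"
    using cramer3 [of i j k \<eta>] det by simp
  also have "\<dots> = B *\<^sub>R i + C *\<^sub>R j + A *\<^sub>R k"
    by (simp add: A_def B_def C_def det3_rotate [of \<eta> j k] det3_rotate [of k i \<eta>])
  finally have "n \<bullet> \<eta> = n \<bullet> (B *\<^sub>R i + C *\<^sub>R j + A *\<^sub>R k)" by simp
  then have height: "- (n \<bullet> \<eta>) = A + B + C"
    using n by (simp add: inner_add_right inner_commute)
  have ABC: "A \<noteq> 0" "B \<noteq> 0" "C \<noteq> 0" using ne by (auto simp: A_def B_def C_def)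
  have corners: "corner \<eta> \<zeta> j (j - i) - corner \<eta> \<zeta> j (k - j) = A / B + B / A - 3 * sgn A * sgn B"
    "corner \<eta> \<zeta> k (k - j) - corner \<eta> \<zeta> k (i - k) = B / C + C / B - 3 * sgn B * sgn C"
    "corner \<eta> \<zeta> i (i - k) - corner \<eta> \<zeta> i (j - i) = C / A + A / C - 3 * sgn C * sgn A"
    unfolding A_def B_def C_def using ijk lat det dets ne \<zeta> by (intro corner_diff; simp)+
  have "edge_term \<eta> \<zeta> n i j + edge_term \<eta> \<zeta> n j k + edge_term \<eta> \<zeta> n k i =
      (A + B + C) * (1 / A + 1 / B + 1 / C)
      - (A / B + B / A - 3 * sgn A * sgn B) - (B / C + C / B - 3 * sgn B * sgn C)
      - (C / A + A / C - 3 * sgn C * sgn A)"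
    using edge [OF ijk n(1,2) det] edge [OF ijk(2,3,1) n(2,3) dets(1)] edge [OF ijk(3,1,2) n(3,1) dets(2)]
    unfolding height corners [symmetric] A_def [symmetric] B_def [symmetric] C_def [symmetric]
    by (simp add: algebra_simps add_divide_distrib)
  also have "(A + B + C) * (1 / A + 1 / B + 1 / C) =
      3 + (A / B + B / A) + (B / C + C / B) + (C / A + A / C)"
    using ABC by (simp add: field_simps)
  finally have "edge_term \<eta> \<zeta> n i j + edge_term \<eta> \<zeta> n j k + edge_term \<eta> \<zeta> n k i =
      3 + 3 * (sgn A * sgn B + sgn B * sgn C + sgn C * sgn A)" by simp
  \<comment> \<open>If the three signs agree, the three products are all 1; otherwise they add up to
    -1.\<close>
  also have "\<dots> = 12 * (of_bool (0 < A \<and> 0 < B \<and> 0 < C) + of_bool (A < 0 \<and> B < 0 \<and> C < 0))"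
    using ABC by (cases "0 < A"; cases "0 < B"; cases "0 < C") (auto simp: not_less order_less_le)
  finally show ?thesis by (simp add: in_cone_def A_def B_def C_def det3_minus)
qed

lemma cross3_nonzero_of_height:
  assumes "x \<bullet> n = -1" "y \<bullet> n = -1" "x \<noteq> y"
  shows "cross3 x y \<noteq> 0"
proof
  assume 0: "cross3 x y = 0"
  have "cross3 n (cross3 x y) = (n \<bullet> y) *\<^sub>R x - (n \<bullet> x) *\<^sub>R y"
    by (simp add: vec_eq_iff forall_3 cross3_def inner_vec_def sum_3 algebra_simps)
  then have "(n \<bullet> y) *\<^sub>R x = (n \<bullet> x) *\<^sub>R y" using 0 by simp
  then show False using assms by (simp add: inner_commute)
qed

lemma edge_term_cocycle:
  assumes F: "convex F" "n \<in> int_lattice" "\<And>x. x \<in> F \<Longrightarrow> x \<bullet> n = -1" and \<eta>: "\<eta> \<in> int_lattice"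
    and gen: "\<And>x y. x \<in> F \<inter> int_lattice \<Longrightarrow> y \<in> F \<inter> int_lattice \<Longrightarrow> x \<noteq> y \<Longrightarrow> det3 x y \<eta> \<noteq> 0"
    and \<zeta>: "\<And>x. x \<in> F \<inter> int_lattice \<Longrightarrow> det3 x \<eta> \<zeta> \<noteq> 0"
    and ijk: "i \<in> F \<inter> int_lattice" "j \<in> F \<inter> int_lattice" "k \<in> F \<inter> int_lattice" "0 \<le> det3 i j k"
  shows "edge_term \<eta> \<zeta> n i j + edge_term \<eta> \<zeta> n j k + edge_term \<eta> \<zeta> n k i =
    12 * (of_bool (in_cone i j k \<eta>) + of_bool (in_cone i j k (- \<eta>)))" (is "?P i j k")
  using F ijk
proof (rule lattice_triangle_induct)
  fix i j k assume ijk: "{i, j, k} \<subseteq> F \<inter> int_lattice" and det: "det3 i j k = 0"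
  have "\<not> in_cone i j k y" for y
    by (rule in_cone_degenerate [of _ n]) (use ijk F(3) det in auto)
  moreover have "edge_term \<eta> \<zeta> n i j + edge_term \<eta> \<zeta> n j k + edge_term \<eta> \<zeta> n k i = 0"
    by (rule edge_term_collinear) (use ijk F \<eta> det in auto)
  ultimately show "?P i j k" by simp
next
  fix i j k assume ijk: "{i, j, k} \<subseteq> F \<inter> int_lattice" and det: "det3 i j k = 1"
  have "i \<noteq> j" "j \<noteq> k" "k \<noteq> i" using det by auto
  then show "?P i j k"
    by (intro edge_term_unimodular) (use ijk F \<eta> gen \<zeta> det in auto)
next
  fix i j k z
  assume lat: "{i, j, k, z} \<subseteq> F \<inter> int_lattice"
    and z: "z \<in> convex hull {i, j, k}"
    and ne: "z \<noteq> i" "z \<noteq> j" "z \<noteq> k"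
    and IH: "?P i j z" "?P j k z" "?P k i z"
  \<comment> \<open>The degenerate triangle \<open>x\<close>, \<open>z\<close>, \<open>x\<close>
    yields antisymmetry, by which the inner edges of the subdivision cancel.\<close>
  have anti: "edge_term \<eta> \<zeta> n z x = - edge_term \<eta> \<zeta> n x z" if "x \<in> F \<inter> int_lattice" for x
  proof -
    have "edge_term \<eta> \<zeta> n x z + edge_term \<eta> \<zeta> n z x + edge_term \<eta> \<zeta> n x x = 0"
      by (rule edge_term_collinear) (use that lat F \<eta> in auto)
    then show ?thesis by (simp add: edge_term_def)
  qed
  have nz: "det3 i z \<eta> \<noteq> 0" "det3 j z \<eta> \<noteq> 0" "det3 k z \<eta> \<noteq> 0" using gen lat ne by auto
  have split: "(of_bool (in_cone i j k \<eta>) :: real) =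
      of_bool (in_cone i j z \<eta>) + of_bool (in_cone j k z \<eta>) + of_bool (in_cone k i z \<eta>)"
    "(of_bool (in_cone i j k (- \<eta>)) :: real) =
      of_bool (in_cone i j z (- \<eta>)) + of_bool (in_cone j k z (- \<eta>)) + of_bool (in_cone k i z (- \<eta>))"
    by (rule in_cone_split [OF z]; use nz in \<open>simp add: det3_minus\<close>)+
  show "?P i j k"
    using IH anti [of i] anti [of j] anti [of k] lat unfolding split by simp
qed

subsection \<open>Lattice points in half-open cones\<close>

text \<open>The test for positivity of \<open>a + \<epsilon> * b\<close> with an infinitesimal
  positive \<open>\<epsilon>\<close>.\<close>

definition lex_pos :: "real \<Rightarrow> real \<Rightarrow> bool" where
  "lex_pos a b \<longleftrightarrow> 0 < a \<or> a = 0 \<and> 0 < b"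

text \<open>The open cone, tested at \<open>z\<close> after an infinitesimal shift along
  \<open>\<eta>\<close>. Eliminating the shift from the definition allows lattice points to be
  counted by their integral coordinates.\<close>

definition half_open :: "real ^ 3 \<Rightarrow> real ^ 3 \<Rightarrow> real ^ 3 \<Rightarrow> real ^ 3 \<Rightarrow> real ^ 3 \<Rightarrow> bool" where
  "half_open \<eta> i j k z \<longleftrightarrow> lex_pos (det3 i j z) (det3 i j \<eta>) \<and> lex_pos (det3 j k z) (det3 j k \<eta>)
     \<and> lex_pos (det3 k i z) (det3 k i \<eta>)"

text \<open>The nonvanishing is recorded along with the sign because \<open>in_cone_split\<close>
  demands it at the shifted point.\<close>

lemma eventually_lex_pos:
  assumes "b \<noteq> 0"
  shows "\<forall>\<^sub>F \<epsilon> in at_right (0 :: real). (0 < a + \<epsilon> * b) = lex_pos a b \<and> a + \<epsilon> * b \<noteq> 0"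
proof (cases "a = 0")
  case True
  then show ?thesis using assms
    by (auto simp: lex_pos_def zero_less_mult_iff intro!: eventually_mono [OF eventually_at_right_less [of 0]])
next
  case False
  have lim: "((\<lambda>\<epsilon>. a + \<epsilon> * b) \<longlongrightarrow> a + 0 * b) (at_right 0)" by (intro tendsto_intros)
  show ?thesis
  proof (cases "0 < a")
    case True
    then show ?thesis using order_tendstoD(1) [OF lim, of 0]
      by (auto simp: lex_pos_def elim!: eventually_mono)
  next
    case neg: False
    then show ?thesis using False order_tendstoD(2) [OF lim, of 0]
      by (auto simp: lex_pos_def elim!: eventually_mono)
  qed
qed

text \<open>The bridge that carries statements on open cones over to half-open ones, boundary points
  included.\<close>

lemma eventually_half_open:
  assumes "det3 i j \<eta> \<noteq> 0" "det3 j k \<eta> \<noteq> 0" "det3 k i \<eta> \<noteq> 0"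
  shows "\<forall>\<^sub>F \<epsilon> in at_right 0. in_cone i j k (z + \<epsilon> *\<^sub>R \<eta>) = half_open \<eta> i j k z"
  using eventually_lex_pos [OF assms(1), of "det3 i j z"] eventually_lex_pos [OF assms(2), of "det3 j k z"]
    eventually_lex_pos [OF assms(3), of "det3 k i z"]
  by eventually_elim (simp add: in_cone_def half_open_def det3_simps)

lemma half_open_degenerate:
  assumes n: "i \<bullet> n = -1" "j \<bullet> n = -1" "k \<bullet> n = -1" and det: "det3 i j k = 0"
    and ne: "i \<noteq> j \<Longrightarrow> det3 i j \<eta> \<noteq> 0" "j \<noteq> k \<Longrightarrow> det3 j k \<eta> \<noteq> 0" "k \<noteq> i \<Longrightarrow> det3 k i \<eta> \<noteq> 0"
  shows "\<not> half_open \<eta> i j k z"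
proof (cases "i = j \<or> j = k \<or> k = i")
  case True
  then show ?thesis by (auto simp: half_open_def lex_pos_def)
next
  case False
  then have "\<forall>\<^sub>F \<epsilon> in at_right 0. in_cone i j k (z + \<epsilon> *\<^sub>R \<eta>) = half_open \<eta> i j k z"
    using ne by (intro eventually_half_open) auto
  then show ?thesis
    using in_cone_degenerate [OF n det] eventually_happens' [OF trivial_limit_at_right_real] by blast
qed

lemma half_open_split:
  assumes z: "z \<in> convex hull {i, j, k}"
    and ne: "det3 i j \<eta> \<noteq> 0" "det3 j k \<eta> \<noteq> 0" "det3 k i \<eta> \<noteq> 0"
      "det3 i z \<eta> \<noteq> 0" "det3 j z \<eta> \<noteq> 0" "det3 k z \<eta> \<noteq> 0"
  shows "(of_bool (half_open \<eta> i j k x) :: nat) =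
    of_bool (half_open \<eta> i j z x) + of_bool (half_open \<eta> j k z x) + of_bool (half_open \<eta> k i z x)"
proof -
  have ne': "det3 z i \<eta> \<noteq> 0" "det3 z j \<eta> \<noteq> 0" "det3 z k \<eta> \<noteq> 0"
    using ne det3_swap by (metis neg_equal_0_iff_equal)+
  \<comment> \<open>The claim does not mention \<open>\<epsilon>\<close>, so one sufficiently small
    \<open>\<epsilon>\<close> is enough, and there the open cones split.\<close>
  have "\<forall>\<^sub>F \<epsilon> in at_right (0 :: real). ?thesis"
    using eventually_half_open [OF ne(1,2,3), of x] eventually_half_open [OF ne(1,5) ne'(1), of x]
      eventually_half_open [OF ne(2,6) ne'(2), of x] eventually_half_open [OF ne(3,4) ne'(3), of x]
      eventually_lex_pos [OF ne(4), of "det3 i z x"] eventually_lex_pos [OF ne(5), of "det3 j z x"]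
      eventually_lex_pos [OF ne(6), of "det3 k z x"]
  proof eventually_elim
    case (elim \<epsilon>)
    have "(of_bool (in_cone i j k (x + \<epsilon> *\<^sub>R \<eta>)) :: nat) = of_bool (in_cone i j z (x + \<epsilon> *\<^sub>R \<eta>))
        + of_bool (in_cone j k z (x + \<epsilon> *\<^sub>R \<eta>)) + of_bool (in_cone k i z (x + \<epsilon> *\<^sub>R \<eta>))"
      by (rule in_cone_split [OF z]) (use elim in \<open>simp_all add: det3_simps\<close>)
    then show ?case using elim by simp
  qed
  then show ?thesis using eventually_happens' [OF trivial_limit_at_right_real] by blast
qed

lemma card_nat_triples: "card {(a, b, c :: nat). a + b + c \<le> N} = (N + 3) choose 3"
proof -
  let ?L = "{l :: nat list. length l = 4 \<and> sum_list l = N}"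
  have "bij_betw (\<lambda>(a, b, c). [a, b, c, N - (a + b + c)]) {(a, b, c). a + b + c \<le> N} ?L"
  proof (rule bij_betw_byWitness [where f' = "\<lambda>l. (l ! 0, l ! 1, l ! 2)"])
    show "\<forall>l\<in>?L. (\<lambda>(a, b, c). [a, b, c, N - (a + b + c)]) (l ! 0, l ! 1, l ! 2) = l"
      by (auto simp: numeral_eq_Suc length_Suc_conv)
    show "(\<lambda>l. (l ! 0, l ! 1, l ! 2)) ` ?L \<subseteq> {(a, b, c). a + b + c \<le> N}"
      by (auto simp: numeral_eq_Suc length_Suc_conv)
  qed auto
  then have "card {(a, b, c :: nat). a + b + c \<le> N} = card ?L" by (rule bij_betw_same_card)
  also have "\<dots> = (N + 4 - 1) choose N" by (rule card_length_sum_list)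
  also have "\<dots> = (N + 3) choose 3" using binomial_symmetric [of N "N + 3"] by (simp add: add.commute)
  finally show ?thesis .
qed

lemma finite_nat_triples: "finite {(a, b, c :: nat). a + b + c \<le> N}"
  by (rule finite_subset [of _ "{..N} \<times> {..N} \<times> {..N}"]) auto

definition cone_points :: "real ^ 3 \<Rightarrow> real ^ 3 \<Rightarrow> nat \<Rightarrow> real ^ 3 \<Rightarrow> real ^ 3 \<Rightarrow> real ^ 3 \<Rightarrow> (real ^ 3) set" where
  "cone_points \<eta> n m i j k = {z \<in> int_lattice. - (z \<bullet> n) \<le> real m \<and> half_open \<eta> i j k z}"

text \<open>In coordinates with respect to \<open>i\<close>, \<open>j\<close>, \<open>k\<close> the
  lattice points of the half-open cone form a shifted orthant: a coordinate starts at 1 if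
  \<open>\<eta>\<close> lies on the negative side of its facet, and at 0 otherwise. The height bound
  leaves a standard simplex of size \<open>m - (p + q + r)\<close>; as \<open>p + q + r\<close> is
  at most 3, the subtraction from \<open>m + 3\<close> never truncates.\<close>

lemma cone_points_unimodular:
  fixes i j k \<eta> :: "real ^ 3"
  defines "p \<equiv> of_bool (det3 j k \<eta> < 0)" and "q \<equiv> of_bool (det3 k i \<eta> < 0)"
    and "r \<equiv> of_bool (det3 i j \<eta> < 0)"
  assumes lat: "i \<in> int_lattice" "j \<in> int_lattice" "k \<in> int_lattice"
    and n: "i \<bullet> n = -1" "j \<bullet> n = -1" "k \<bullet> n = -1" and det: "det3 i j k = 1"
    and ne: "det3 i j \<eta> \<noteq> 0" "det3 j k \<eta> \<noteq> 0" "det3 k i \<eta> \<noteq> 0"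
  shows "finite (cone_points \<eta> n m i j k)"
    and "card (cone_points \<eta> n m i j k) = (m + 3 - (p + q + r)) choose 3"
proof -
  define s where "s = p + q + r"
  define f where "f = (\<lambda>(a, b, c). real (a + p) *\<^sub>R i + real (b + q) *\<^sub>R j + real (c + r) *\<^sub>R k)"
  have dets: "det3 j k i = 1" "det3 k i j = 1" using det det3_rotate by metis+
  have coords: "det3 j k (\<alpha> *\<^sub>R i + \<beta> *\<^sub>R j + \<gamma> *\<^sub>R k) = \<alpha>" "det3 k i (\<alpha> *\<^sub>R i + \<beta> *\<^sub>R j + \<gamma> *\<^sub>R k) = \<beta>"
    "det3 i j (\<alpha> *\<^sub>R i + \<beta> *\<^sub>R j + \<gamma> *\<^sub>R k) = \<gamma>" for \<alpha> \<beta> \<gamma>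
    using det dets by (simp_all add: det3_simps)
  have inj: "inj f"
    by (rule inj_on_inverseI [where g = "\<lambda>z. (nat \<lfloor>det3 j k z\<rfloor> - p, nat \<lfloor>det3 k i z\<rfloor> - q, nat \<lfloor>det3 i j z\<rfloor> - r)"])
      (clarsimp simp only: f_def prod.case coords floor_of_nat nat_int diff_add_inverse2, simp)
  have lex: "lex_pos (of_int a) b \<longleftrightarrow> of_bool (b < 0) \<le> a" if "b \<noteq> 0" for a :: int and b :: real
    using that by (auto simp: lex_pos_def)
  have mem: "z \<in> cone_points \<eta> n m i j k \<longleftrightarrow> (\<exists>a b c. z = f (a, b, c) \<and> a + b + c + s \<le> m)" for z
  proof
    assume z: "z \<in> cone_points \<eta> n m i j k"
    then have zl: "z \<in> int_lattice" by (simp add: cone_points_def)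
    obtain a where a: "det3 j k z = of_int a" by (metis Ints_cases int_lattice_det3 lat zl)
    obtain b where b: "det3 k i z = of_int b" by (metis Ints_cases int_lattice_det3 lat zl)
    obtain c where c: "det3 i j z = of_int c" by (metis Ints_cases int_lattice_det3 lat zl)
    have "int p \<le> a" "int q \<le> b" "int r \<le> c"
      using z ne lex unfolding cone_points_def half_open_def p_def q_def r_def by (auto simp: a b c)
    then obtain a' b' c' where abc: "a = int (a' + p)" "b = int (b' + q)" "c = int (c' + r)"
      by (metis add.commute nonneg_int_cases of_nat_add zle_iff_zadd)
    have "z = of_int a *\<^sub>R i + of_int b *\<^sub>R j + of_int c *\<^sub>R k"
      using cramer3 [of i j k z] det a b c by (simp add: det3_rotate [of z j k] det3_rotate [of k i z])
    then have zf: "z = f (a', b', c')" by (simp add: f_def abc)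
    have "real (a' + b' + c' + s) \<le> real m"
      using z n by (simp add: cone_points_def zf f_def inner_add_left s_def)
    then have "a' + b' + c' + s \<le> m" by linarith
    with zf show "\<exists>a b c. z = f (a, b, c) \<and> a + b + c + s \<le> m" by blast
  next
    assume "\<exists>a b c. z = f (a, b, c) \<and> a + b + c + s \<le> m"
    then obtain a b c where z: "z = f (a, b, c)" "a + b + c + s \<le> m" by blast
    have "z \<in> int_lattice" using lat by (simp add: z f_def int_lattice_add int_lattice_scaleR)
    moreover have "- (z \<bullet> n) = real (a + b + c + s)" using n by (simp add: z f_def inner_add_left s_def)
    moreover have dz: "det3 j k z = of_int (int (a + p))" "det3 k i z = of_int (int (b + q))"
      "det3 i j z = of_int (int (c + r))" using coords by (simp_all add: z f_def)
    have "half_open \<eta> i j k z"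
      unfolding half_open_def dz lex [OF ne(1)] lex [OF ne(2)] lex [OF ne(3)]
      by (simp add: p_def q_def r_def)
    ultimately show "z \<in> cone_points \<eta> n m i j k" using z(2) unfolding cone_points_def by simp
  qed
  have "finite (cone_points \<eta> n m i j k) \<and> card (cone_points \<eta> n m i j k) = (m + 3 - s) choose 3"
  proof (cases "s \<le> m")
    case True
    have "cone_points \<eta> n m i j k = f ` {(a, b, c). a + b + c \<le> m - s}"
    proof (intro set_eqI iffI)
      fix z assume "z \<in> cone_points \<eta> n m i j k"
      then obtain a b c where "z = f (a, b, c)" "a + b + c + s \<le> m" using mem by blast
      then show "z \<in> f ` {(a, b, c). a + b + c \<le> m - s}" by (intro image_eqI [of _ _ "(a, b, c)"]) auto
    next
      fix z assume "z \<in> f ` {(a, b, c). a + b + c \<le> m - s}"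
      then obtain a b c where "z = f (a, b, c)" "a + b + c \<le> m - s" by blast
      then show "z \<in> cone_points \<eta> n m i j k"
        using mem True by (intro mem [THEN iffD2] exI [of _ a] exI [of _ b] exI [of _ c]) auto
    qed
    moreover have "m - s + 3 = m + 3 - s" using True by simp
    ultimately show ?thesis
      using card_image [OF inj_on_subset [OF inj subset_UNIV], of "{(a, b, c). a + b + c \<le> m - s}"]
        card_nat_triples [of "m - s"] finite_nat_triples [of "m - s"] by simp
  next
    case False
    then have "cone_points \<eta> n m i j k = {}" using mem by auto
    then show ?thesis using False by simp
  qed
  then show "finite (cone_points \<eta> n m i j k)"
    "card (cone_points \<eta> n m i j k) = (m + 3 - (p + q + r)) choose 3" by (simp_all add: s_def)
qed

text \<open>The four coefficients form the h*-vector of a half-open triangle. The outer two are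
  fixed by the position of \<open>\<eta>\<close>, the inner two are left as \<open>f\<close> and
  \<open>g\<close>.\<close>

definition cone_count :: "real ^ 3 \<Rightarrow> real ^ 3 \<Rightarrow> real ^ 3 \<Rightarrow> real ^ 3 \<Rightarrow> real ^ 3 \<Rightarrow> nat \<Rightarrow> nat \<Rightarrow> bool" where
  "cone_count \<eta> n i j k f g \<longleftrightarrow> (\<forall>m. finite (cone_points \<eta> n m i j k) \<and>
     card (cone_points \<eta> n m i j k) = of_bool (in_cone i j k \<eta>) * ((m + 3) choose 3)
       + f * ((m + 2) choose 3) + g * ((m + 1) choose 3) + of_bool (in_cone i j k (- \<eta>)) * (m choose 3))"

text \<open>An identity of indicators in \<open>nat\<close> encodes covering and disjointness at
  once.\<close>

lemma card_disjoint3: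
  assumes "finite A" "finite B" "finite C"
    and S: "\<And>x. (of_bool (x \<in> S) :: nat) = of_bool (x \<in> A) + of_bool (x \<in> B) + of_bool (x \<in> C)"
  shows "finite S \<and> card S = card A + card B + card C"
proof -
  have "(x \<in> S \<longleftrightarrow> x \<in> A \<or> x \<in> B \<or> x \<in> C) \<and> \<not> (x \<in> A \<and> x \<in> B) \<and> \<not> ((x \<in> A \<or> x \<in> B) \<and> x \<in> C)" for x
    using S [of x] by (cases "x \<in> A"; cases "x \<in> B"; cases "x \<in> C"; cases "x \<in> S"; simp)
  then have "S = A \<union> B \<union> C" "A \<inter> B = {}" "(A \<union> B) \<inter> C = {}" by blast+
  then show ?thesis using assms(1-3) by (simp add: card_Un_disjoint)
qed

lemma cone_count_split:
  assumes z: "z \<in> convex hull {i, j, k}"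
    and ne: "det3 i j \<eta> \<noteq> 0" "det3 j k \<eta> \<noteq> 0" "det3 k i \<eta> \<noteq> 0"
      "det3 i z \<eta> \<noteq> 0" "det3 j z \<eta> \<noteq> 0" "det3 k z \<eta> \<noteq> 0"
    and parts: "cone_count \<eta> n i j z f1 g1" "cone_count \<eta> n j k z f2 g2" "cone_count \<eta> n k i z f3 g3"
  shows "cone_count \<eta> n i j k (f1 + f2 + f3) (g1 + g2 + g3)"
  unfolding cone_count_def
proof
  fix m
  have "(of_bool (x \<in> cone_points \<eta> n m i j k) :: nat) = of_bool (x \<in> cone_points \<eta> n m i j z)
      + of_bool (x \<in> cone_points \<eta> n m j k z) + of_bool (x \<in> cone_points \<eta> n m k i z)" for x
    using half_open_split [OF z ne, of x] by (auto simp: cone_points_def)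
  then have "finite (cone_points \<eta> n m i j k) \<and> card (cone_points \<eta> n m i j k) =
      card (cone_points \<eta> n m i j z) + card (cone_points \<eta> n m j k z) + card (cone_points \<eta> n m k i z)"
    using parts by (intro card_disjoint3) (auto simp: cone_count_def)
  moreover have "(of_bool (in_cone i j k \<theta>) :: nat) =
      of_bool (in_cone i j z \<theta>) + of_bool (in_cone j k z \<theta>) + of_bool (in_cone k i z \<theta>)"
    if "\<theta> = \<eta> \<or> \<theta> = - \<eta>" for \<theta>
    by (rule in_cone_split [OF z]) (use ne that in \<open>auto simp: det3_minus\<close>)
  ultimately show "finite (cone_points \<eta> n m i j k) \<and>
     card (cone_points \<eta> n m i j k) = of_bool (in_cone i j k \<eta>) * ((m + 3) choose 3)
       + (f1 + f2 + f3) * ((m + 2) choose 3) + (g1 + g2 + g3) * ((m + 1) choose 3)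
       + of_bool (in_cone i j k (- \<eta>)) * (m choose 3)"
    using parts by (simp add: cone_count_def algebra_simps)
qed

text \<open>Replacing \<open>\<eta>\<close> by its negative exchanges the open and the closed facets of a simplicial
  cone: this is the symmetry that Ehrhart reciprocity expresses.\<close>

lemma cone_count_exists:
  assumes F: "convex F" "n \<in> int_lattice" "\<And>x. x \<in> F \<Longrightarrow> x \<bullet> n = -1"
    and gen: "\<And>x y. x \<in> F \<inter> int_lattice \<Longrightarrow> y \<in> F \<inter> int_lattice \<Longrightarrow> x \<noteq> y \<Longrightarrow> det3 x y \<eta> \<noteq> 0"
    and ijk: "i \<in> F \<inter> int_lattice" "j \<in> F \<inter> int_lattice" "k \<in> F \<inter> int_lattice" "0 \<le> det3 i j k"
  shows "\<exists>f g. cone_count \<eta> n i j k f g \<and> cone_count (- \<eta>) n i j k g f" (is "?P i j k")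
  using F ijk
proof (rule lattice_triangle_induct)
  fix i j k assume ijk: "{i, j, k} \<subseteq> F \<inter> int_lattice" and det: "det3 i j k = 0"
  have "\<not> in_cone i j k y" for y
    by (rule in_cone_degenerate [of _ n]) (use ijk F(3) det in auto)
  moreover have "\<not> half_open \<eta> i j k z" "\<not> half_open (- \<eta>) i j k z" for z
    by (rule half_open_degenerate [of _ n]; use ijk F(3) gen det in \<open>auto simp: det3_minus\<close>)+
  ultimately show "?P i j k"
    by (intro exI [of _ 0]) (simp add: cone_count_def cone_points_def)
next
  fix i j k assume ijk: "{i, j, k} \<subseteq> F \<inter> int_lattice" and det: "det3 i j k = 1"
  have "i \<noteq> j" "j \<noteq> k" "k \<noteq> i" using det by auto
  then have ne: "det3 i j \<eta> \<noteq> 0" "det3 j k \<eta> \<noteq> 0" "det3 k i \<eta> \<noteq> 0" using gen ijk by auto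
  \<comment> \<open>The number of open facets. It is 0 if \<open>\<theta>\<close> lies in the cone
    and 3 if \<open>- \<theta>\<close> does, so its four values select the four summands of
    \<open>cone_count\<close>; changing the sign of \<open>\<theta>\<close> replaces it by its
    complement to 3.\<close>
  define s :: "real ^ 3 \<Rightarrow> nat" where "s = (\<lambda>\<theta>.
    of_bool (det3 j k \<theta> < 0) + of_bool (det3 k i \<theta> < 0) + of_bool (det3 i j \<theta> < 0))"
  have count: "cone_count \<theta> n i j k (of_bool (s \<theta> = 1)) (of_bool (s \<theta> = 2))"
    if \<theta>: "det3 i j \<theta> \<noteq> 0" "det3 j k \<theta> \<noteq> 0" "det3 k i \<theta> \<noteq> 0" for \<theta>
    unfolding cone_count_def
  proof (intro allI conjI)
    fix m
    have pts: "finite (cone_points \<theta> n m i j k)" "card (cone_points \<theta> n m i j k) = (m + 3 - s \<theta>) choose 3"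
      using cone_points_unimodular [of i j k n \<theta> m] ijk F(3) det \<theta> by (simp_all add: s_def)
    then show "finite (cone_points \<theta> n m i j k)" by simp
    have sgn: "det3 j k \<theta> < 0 \<longleftrightarrow> \<not> 0 < det3 j k \<theta>" "det3 k i \<theta> < 0 \<longleftrightarrow> \<not> 0 < det3 k i \<theta>"
      "det3 i j \<theta> < 0 \<longleftrightarrow> \<not> 0 < det3 i j \<theta>" using \<theta> by linarith+
    show "card (cone_points \<theta> n m i j k) = of_bool (in_cone i j k \<theta>) * ((m + 3) choose 3)
       + of_bool (s \<theta> = 1) * ((m + 2) choose 3) + of_bool (s \<theta> = 2) * ((m + 1) choose 3)
       + of_bool (in_cone i j k (- \<theta>)) * (m choose 3)"
      unfolding pts(2) s_def in_cone_def det3_minus neg_0_less_iff_less sgn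
      by (cases "0 < det3 j k \<theta>"; cases "0 < det3 k i \<theta>"; cases "0 < det3 i j \<theta>"; simp)
  qed
  have "s (- \<eta>) = 1 \<longleftrightarrow> s \<eta> = 2" "s (- \<eta>) = 2 \<longleftrightarrow> s \<eta> = 1"
    using ne by (auto simp: s_def det3_minus of_bool_def)
  then show "?P i j k" using count [of \<eta>] count [of "- \<eta>"] ne by (auto simp: det3_minus)
next
  fix i j k z
  assume lat: "{i, j, k, z} \<subseteq> F \<inter> int_lattice" and det: "0 < det3 i j k"
    and z: "z \<in> convex hull {i, j, k}"
    and zne: "z \<noteq> i" "z \<noteq> j" "z \<noteq> k"
    and P: "?P i j z" "?P j k z" "?P k i z"
  have "i \<noteq> j" "j \<noteq> k" "k \<noteq> i" using det by auto
  then have ne: "det3 i j \<eta> \<noteq> 0" "det3 j k \<eta> \<noteq> 0" "det3 k i \<eta> \<noteq> 0"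
    "det3 i z \<eta> \<noteq> 0" "det3 j z \<eta> \<noteq> 0" "det3 k z \<eta> \<noteq> 0" using gen lat zne by auto
  then have ne': "det3 i j (- \<eta>) \<noteq> 0" "det3 j k (- \<eta>) \<noteq> 0" "det3 k i (- \<eta>) \<noteq> 0"
    "det3 i z (- \<eta>) \<noteq> 0" "det3 j z (- \<eta>) \<noteq> 0" "det3 k z (- \<eta>) \<noteq> 0"
    by (auto simp: det3_minus)
  show "?P i j k" using P cone_count_split [OF z ne] cone_count_split [OF z ne'] by blast
qed

subsection \<open>Facets and edges of a reflexive polytope\<close>

lemma orthogonal_to_two:
  fixes d :: "real ^ 3"
  assumes "d \<bullet> a = 0" "d \<bullet> b = 0" "cross3 a b \<noteq> 0"
  obtains t where "d = t *\<^sub>R cross3 a b"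
proof -
  define c where "c = cross3 a b"
  have "c \<bullet> c \<noteq> 0" using assms(3) by (simp add: c_def)
  moreover have "(c \<bullet> c) *\<^sub>R d = (d \<bullet> c) *\<^sub>R c"
    using assms(1,2) unfolding c_def
    by (simp add: vec_eq_iff forall_3 cross3_def inner_vec_def sum_3) algebra
  ultimately have "d = ((d \<bullet> c) / (c \<bullet> c)) *\<^sub>R c"
    by (metis divide_inverse_commute left_inverse scaleR_one scaleR_scaleR)
  then show ?thesis using that c_def by blast
qed

text \<open>Expand \<open>z\<close> in \<open>x\<close>, \<open>y\<close> and
  \<open>cross3 x y\<close>: the determinant is the last coefficient, and the heights make the other
  two add up to 1.\<close>

lemma collinear_of_det3_zero:
  assumes "x \<bullet> n = -1" "y \<bullet> n = -1" "z \<bullet> n = -1" "x \<noteq> y" "det3 x y z = 0"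
  shows "z \<in> affine hull {x, y}"
proof -
  have ne: "cross3 x y \<noteq> 0" by (rule cross3_nonzero_of_height [OF assms(1,2,4)])
  then have "(cross3 x y \<bullet> cross3 x y) \<noteq> 0" by simp
  moreover have "(cross3 x y \<bullet> cross3 x y) *\<^sub>R z =
      det3 x y z *\<^sub>R cross3 x y + det3 z y (cross3 x y) *\<^sub>R x + det3 x z (cross3 x y) *\<^sub>R y"
    by (simp add: vec_eq_iff forall_3 det3_coords cross3_def inner_vec_def sum_3) algebra
  ultimately obtain s t where z: "z = s *\<^sub>R x + t *\<^sub>R y"
  proof -
    let ?c = "cross3 x y \<bullet> cross3 x y"
    have "z = inverse ?c *\<^sub>R (?c *\<^sub>R z)" using \<open>?c \<noteq> 0\<close> by simp
    also have "\<dots> = (inverse ?c * det3 z y (cross3 x y)) *\<^sub>R x + (inverse ?c * det3 x z (cross3 x y)) *\<^sub>R y"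
      unfolding \<open>?c *\<^sub>R z = _\<close> assms(5) by (simp add: scaleR_add_right)
    finally show thesis by (rule that)
  qed
  then have "s + t = 1" using assms(1-3) by (simp add: inner_add_left)
  then show ?thesis using z by (auto simp: affine_hull_2)
qed

lemma lattice_polytope_edge:
  assumes P: "lattice_polytope P" and E: "E edge_of P"
  obtains a b where "E = closed_segment a b" "a \<noteq> b" "a \<in> P \<inter> int_lattice" "b \<in> P \<inter> int_lattice"
    "a extreme_point_of P" "b extreme_point_of P"
proof -
  obtain V where V: "finite V" "V \<subseteq> int_lattice" "P = convex hull V"
    using P unfolding lattice_polytope_def by blast
  have Ef: "E face_of P" "aff_dim E = 1" using E by (auto simp: edge_of_def)
  have "polytope E" using Ef(1) face_of_polytope_polytope polytope_convex_hull V(1,3) by blast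
  moreover have "E \<noteq> {}" using Ef by auto
  moreover have "collinear E" using Ef by (simp add: collinear_aff_dim)
  ultimately obtain a b where ab: "E = closed_segment a b"
    using compact_convex_collinear_segment polytope_imp_compact polytope_imp_convex by metis
  have "a \<noteq> b" using Ef(2) ab by auto
  moreover have ext: "a extreme_point_of P" "b extreme_point_of P"
    using extreme_point_of_face [OF Ef(1)] ab extreme_point_of_segment by metis+
  moreover have "a \<in> V" "b \<in> V" using ext extreme_point_of_convex_hull unfolding V(3) by blast+
  ultimately show ?thesis
    using that [OF ab] V(2) by (auto simp: extreme_point_of_def)
qed

locale reflexive_polytope =
  fixes Q :: "(real ^ 3) set"
  assumes reflexive: "reflexive Q"
begin

definition polar :: "(real ^ 3) set" where
  "polar = {y. \<forall>x\<in>Q. x \<bullet> y \<ge> -1}"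

definition facet :: "real ^ 3 \<Rightarrow> (real ^ 3) set" where
  "facet n = Q \<inter> {x. x \<bullet> n = -1}"

definition facet_normals :: "(real ^ 3) set" where
  "facet_normals = {n \<in> polar. aff_dim (facet n) = 2}"

definition facet_edges :: "real ^ 3 \<Rightarrow> (real ^ 3) set set" where
  "facet_edges n = {E. E edge_of Q \<and> E \<subseteq> facet n}"

lemma obtain_vertices:
  obtains V where "finite V" "V \<subseteq> int_lattice" "Q = convex hull V"
  using reflexive unfolding reflexive_def lattice_polytope_def by blast

lemma polytope_Q: "polytope Q"
  using obtain_vertices polytope_convex_hull by metis

lemma convex_Q: "convex Q" by (rule polytope_imp_convex [OF polytope_Q])

lemma bounded_Q: "bounded Q" by (rule polytope_imp_bounded [OF polytope_Q])

lemma polyhedron_Q: "polyhedron Q" by (rule polytope_imp_polyhedron [OF polytope_Q])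

lemma zero_interior: "0 \<in> interior Q"
  using reflexive by (simp add: reflexive_def)

lemma zero_mem: "0 \<in> Q" using zero_interior interior_subset by blast

lemma aff_dim_Q: "aff_dim Q = 3"
  using aff_dim_nonempty_interior [of Q] zero_interior by auto

lemma polarD: "y \<in> polar \<Longrightarrow> x \<in> Q \<Longrightarrow> x \<bullet> y \<ge> -1"
  by (simp add: polar_def)

lemma facetD: "x \<in> facet n \<Longrightarrow> x \<in> Q" "x \<in> facet n \<Longrightarrow> x \<bullet> n = -1"
  by (auto simp: facet_def)

lemma facet_face: "n \<in> polar \<Longrightarrow> facet n face_of Q"
  using face_of_Int_supporting_hyperplane_ge [OF convex_Q, of "-1" n] polarD
  by (simp add: facet_def inner_commute)

lemma convex_facet: "n \<in> polar \<Longrightarrow> convex (facet n)"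
  using facet_face face_of_imp_convex by blast

lemma polytope_facet: "n \<in> polar \<Longrightarrow> polytope (facet n)"
  using facet_face face_of_polytope_polytope polytope_Q by blast

lemma normal_polar: "n \<in> facet_normals \<Longrightarrow> n \<in> polar"
  by (simp add: facet_normals_def)

text \<open>The hyperplane of the facet misses the origin, so the facet and 0 together have
  dimension 3. They cannot lie in the plane orthogonal to a nonzero \<open>y - n\<close>.\<close>

lemma normal_unique:
  assumes n: "n \<in> facet_normals" and y: "\<And>x. x \<in> facet n \<Longrightarrow> x \<bullet> y = -1"
  shows "y = n"
proof (rule ccontr)
  assume "y \<noteq> n"
  have "affine hull facet n \<subseteq> {x. n \<bullet> x = -1}"
  proof (rule hull_minimal)
    show "facet n \<subseteq> {x. n \<bullet> x = -1}" by (auto simp: facet_def inner_commute)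
  qed (rule affine_hyperplane)
  then have "0 \<notin> affine hull facet n" by auto
  then have "aff_dim (insert 0 (facet n)) = 3"
    using n by (simp add: aff_dim_insert facet_normals_def)
  moreover have "insert 0 (facet n) \<subseteq> {x. (y - n) \<bullet> x = 0}"
    using y by (auto simp: inner_commute inner_diff_right facet_def)
  then have "aff_dim (insert 0 (facet n)) \<le> aff_dim {x. (y - n) \<bullet> x = 0}" by (rule aff_dim_subset)
  moreover have "aff_dim {x. (y - n) \<bullet> x = 0} = 2"
    using aff_dim_hyperplane [of "y - n" 0] \<open>y \<noteq> n\<close> by simp
  ultimately show False by simp
qed

text \<open>The gateway to reflexivity: facet normals are vertices of the polar, and these are
  lattice points by assumption.\<close>

lemma normal_extreme:
  assumes n: "n \<in> facet_normals"
  shows "n extreme_point_of polar"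
  unfolding extreme_point_of_def
proof (intro conjI ballI notI)
  show "n \<in> polar" by (rule normal_polar [OF n])
  fix a b assume ab: "a \<in> polar" "b \<in> polar" and seg: "n \<in> open_segment a b"
  then obtain u where u: "a \<noteq> b" "0 < u" "u < 1" "n = (1 - u) *\<^sub>R a + u *\<^sub>R b"
    by (auto simp: in_segment)
  have "x \<bullet> a = -1 \<and> x \<bullet> b = -1" if x: "x \<in> facet n" for x
  proof -
    have "x \<bullet> a \<ge> -1" "x \<bullet> b \<ge> -1" using ab x polarD facetD by blast+
    then have "(1 - u) * (x \<bullet> a + 1) \<ge> 0" "u * (x \<bullet> b + 1) \<ge> 0" using u by auto
    moreover have "(1 - u) * (x \<bullet> a + 1) + u * (x \<bullet> b + 1) = 0"
      using facetD(2) [OF x] unfolding u(4) by (simp add: inner_add_right algebra_simps)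
    ultimately have "(1 - u) * (x \<bullet> a + 1) = 0" "u * (x \<bullet> b + 1) = 0" by linarith+
    then show ?thesis using u by simp
  qed
  then have "a = n" "b = n" using normal_unique [OF n] by blast+
  then show False using u(1) by simp
qed

lemma obtain_polar_vertices:
  obtains W where "finite W" "W \<subseteq> int_lattice" "polar = convex hull W"
  using reflexive unfolding reflexive_def lattice_polytope_def polar_def by blast

lemma polar_extreme_lattice: "n extreme_point_of polar \<Longrightarrow> n \<in> int_lattice"
  using obtain_polar_vertices extreme_point_of_convex_hull by (metis subsetD)

lemma normal_lattice: "n \<in> facet_normals \<Longrightarrow> n \<in> int_lattice"
  using normal_extreme polar_extreme_lattice by blast

lemma finite_facet_normals: "finite facet_normals"
proof -
  obtain W where W: "finite W" "polar = convex hull W" using obtain_polar_vertices by metis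
  have "facet_normals \<subseteq> W"
    using normal_extreme extreme_point_of_convex_hull unfolding W(2) by blast
  then show ?thesis using W(1) finite_subset by blast
qed

text \<open>As 0 is an interior point, the right-hand side of a facet inequality is positive and can
  be scaled to the standard form.\<close>

lemma obtain_normal:
  assumes "F facet_of Q"
  obtains n where "n \<in> facet_normals" "F = facet n"
proof -
  obtain a b where ab: "Q \<subseteq> {x. a \<bullet> x \<le> b}" "F = Q \<inter> {x. a \<bullet> x = b}"
    using facet_of_polyhedron [OF polyhedron_Q assms] by metis
  have "0 \<le> b" using ab(1) zero_mem by auto
  moreover have "b \<noteq> 0"
  proof
    assume "b = 0"
    then have "0 \<in> F" using ab zero_mem by simp
    then show False
      using face_of_disjoint_interior [OF facet_of_imp_face_of [OF assms]] zero_interior assms facet_of_irrefl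
      by blast
  qed
  ultimately have b: "b > 0" by simp
  define n where "n = (- 1 / b) *\<^sub>R a"
  have nx: "x \<bullet> n = - (a \<bullet> x) / b" for x by (simp add: n_def inner_commute)
  have "n \<in> polar" using ab(1) b by (auto simp: polar_def nx field_simps)
  moreover have F: "F = facet n" using ab(2) b by (auto simp: facet_def nx field_simps)
  moreover have "aff_dim F = 2" using assms aff_dim_Q by (simp add: facet_of_def)
  ultimately show ?thesis using that by (simp add: facet_normals_def)
qed

lemma frontier_facet:
  assumes "y \<in> frontier Q"
  obtains n where "n \<in> facet_normals" "y \<in> facet n"
proof -
  have "y \<in> rel_frontier Q"
    using assms zero_interior rel_frontier_nonempty_interior by (metis empty_iff)
  then obtain F where "F facet_of Q" "y \<in> F" using rel_frontier_of_polyhedron [OF polyhedron_Q] by auto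
  then show ?thesis using obtain_normal that by metis
qed

lemma facet_edges_iff:
  assumes "n \<in> facet_normals"
  shows "E \<in> facet_edges n \<longleftrightarrow> E facet_of facet n"
proof -
  have "aff_dim (facet n) = 2" using assms by (simp add: facet_normals_def)
  then show ?thesis
    using face_of_face [OF facet_face [OF normal_polar [OF assms]], of E]
    by (auto simp: facet_edges_def edge_of_def facet_of_def)
qed

lemma facet_edgesD: "E \<in> facet_edges n \<Longrightarrow> E edge_of Q" "E \<in> facet_edges n \<Longrightarrow> E \<subseteq> facet n"
  by (simp_all add: facet_edges_def)

lemma finite_edges: "finite {E. E edge_of Q}"
  using finite_polytope_faces [OF polytope_Q] by (simp add: edge_of_def)

lemma finite_facet_edges: "finite (facet_edges n)"
  using finite_edges by (rule rev_finite_subset) (auto simp: facet_edges_def)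

lemma extreme_lattice: "v extreme_point_of Q \<Longrightarrow> v \<in> int_lattice"
  using obtain_vertices extreme_point_of_convex_hull by (metis subsetD)

lemma lattice_Q: "lattice_polytope Q"
  using reflexive by (simp add: reflexive_def)

text \<open>The boundary orientation: the facet lies on one fixed side of the edge. The last clause,
  by which the plane through 0, \<open>a\<close> and \<open>b\<close> meets the facet in
  \<open>E\<close> only, drives the injectivity arguments.\<close>

definition oriented :: "real ^ 3 \<Rightarrow> (real ^ 3) set \<Rightarrow> real ^ 3 \<Rightarrow> real ^ 3 \<Rightarrow> bool" where
  "oriented n E a b \<longleftrightarrow> E = closed_segment a b \<and> a \<noteq> b \<and> a \<in> facet n \<inter> int_lattice \<and>
     b \<in> facet n \<inter> int_lattice \<and> a extreme_point_of facet n \<and> b extreme_point_of facet n \<and>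
     (\<forall>c\<in>facet n. 0 \<le> det3 a b c \<and> (det3 a b c = 0 \<longrightarrow> c \<in> E))"

lemma oriented_exists:
  assumes n: "n \<in> facet_normals" and E: "E \<in> facet_edges n"
  shows "\<exists>a b. oriented n E a b"
proof -
  note np = normal_polar [OF n]
  have EQ: "E edge_of Q" "E face_of facet n"
    using facet_edgesD [OF E] facet_edges_iff [OF n] E facet_of_imp_face_of by auto
  obtain a b where ab: "E = closed_segment a b" "a \<noteq> b" "a \<in> Q \<inter> int_lattice" "b \<in> Q \<inter> int_lattice"
    "a extreme_point_of Q" "b extreme_point_of Q" by (rule lattice_polytope_edge [OF lattice_Q EQ(1)])
  have abF: "a \<in> facet n" "b \<in> facet n" using ab(1) facet_edgesD(2) [OF E] by auto
  have zero: "c \<in> E" if "c \<in> facet n" "det3 a b c = 0" for c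
  proof -
    have "c \<in> affine hull {a, b}"
      using collinear_of_det3_zero abF that ab(2) facetD(2) by blast
    then have "c \<in> affine hull E"
      using ab(1) hull_mono [of "{a, b}" E affine] by auto
    then show ?thesis
      using face_of_imp_eq_affine_Int [OF convex_facet [OF np] EQ(2)] that(1) by blast
  qed
  \<comment> \<open>A segment of the facet from one side to the other meets \<open>E\<close> in an
    inner point, and a face containing such a point contains both ends.\<close>
  have no_cross: False
    if c: "c \<in> facet n" "det3 a b c < 0" and d: "d \<in> facet n" "0 < det3 a b d" for c d
  proof -
    define t where "t = det3 a b d / (det3 a b d - det3 a b c)"
    define x where "x = (1 - t) *\<^sub>R d + t *\<^sub>R c"
    have t: "0 < t" "t < 1" using c d by (auto simp: t_def field_simps)
    have cd: "c \<noteq> d" using c d by auto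
    have "x \<in> facet n"
      using convexD_alt [OF convex_facet [OF np] d(1) c(1), of t] t by (simp add: x_def)
    moreover have "det3 a b x = (1 - t) * det3 a b d + t * det3 a b c"
      by (simp add: x_def det3_simps)
    then have "det3 a b x = 0" using c d by (simp add: t_def field_simps)
    ultimately have "x \<in> E" by (rule zero)
    moreover have "x \<in> open_segment d c" using t cd by (auto simp: in_segment x_def)
    ultimately have "c \<in> E" using face_ofD [OF EQ(2)] c d by blast
    then have "c \<in> closed_segment a b" using ab(1) by simp
    then have "det3 a b c = 0" by (auto simp: in_segment det3_simps)
    then show False using c by simp
  qed
  have ext: "a extreme_point_of facet n" "b extreme_point_of facet n"
    using extreme_point_of_face [OF facet_face [OF np]] ab abF by auto
  show ?thesis
  proof (cases "\<exists>d\<in>facet n. 0 < det3 a b d")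
    case True
    then have "\<forall>c\<in>facet n. 0 \<le> det3 a b c" using no_cross by (meson not_le)
    then have "oriented n E a b"
      using ab abF ext zero unfolding oriented_def by auto
    then show ?thesis by blast
  next
    case False
    then have "\<forall>c\<in>facet n. 0 \<le> det3 b a c" by (metis det3_swap neg_0_le_iff_le not_le)
    moreover have "\<forall>c\<in>facet n. det3 b a c = 0 \<longrightarrow> c \<in> E" using zero det3_swap [of b a] by auto
    ultimately have "oriented n E b a"
      using ab abF ext unfolding oriented_def by (auto simp: closed_segment_commute)
    then show ?thesis by blast
  qed
qed

lemma edge_ne_facet:
  assumes "n \<in> facet_normals" "E \<in> facet_edges n"
  obtains c where "c \<in> facet n" "c \<notin> E"
proof -
  have "E \<noteq> facet n" using assms by (auto simp: facet_normals_def facet_edges_def edge_of_def)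
  then show ?thesis using that facet_edgesD(2) [OF assms(2)] by blast
qed

lemma oriented_unique:
  assumes n: "n \<in> facet_normals" and E: "E \<in> facet_edges n"
    and ab: "oriented n E a b" "oriented n E a' b'"
  shows "a' = a \<and> b' = b"
proof -
  obtain c where c: "c \<in> facet n" "c \<notin> E" using edge_ne_facet [OF n E] .
  have pos: "0 < det3 a b c" "0 < det3 a' b' c" using ab c by (auto simp: oriented_def order_less_le)
  have "closed_segment a b = closed_segment a' b'" using ab by (simp add: oriented_def)
  then have "{a, b} = {a', b'}" by simp
  then consider "a' = a" "b' = b" | "a' = b" "b' = a" by (metis doubleton_eq_iff)
  then show ?thesis using pos det3_swap [of b a c] by cases auto
qed

lemma facet_edge_eqI:
  assumes "E \<in> facet_edges n" "E' \<in> facet_edges n" "E = closed_segment a b" "E' = closed_segment c d"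
    "a \<in> E'" "b \<in> E'" "c \<in> E" "d \<in> E"
  shows "E = E'"
  using assms by (metis convex_closed_segment closed_segment_subset subset_antisym)

text \<open>Both edges have the facet on the same side, so \<open>det3 v b b'\<close> and its
  negative are nonnegative. Being zero, they place the far end of each edge on the other
  edge.\<close>

lemma source_inj:
  assumes n: "n \<in> facet_normals" and E: "E \<in> facet_edges n" "E' \<in> facet_edges n"
    and v: "oriented n E v b" "oriented n E' v b'"
  shows "E = E'"
proof -
  have "0 \<le> det3 v b b'" "0 \<le> det3 v b' b" using v by (auto simp: oriented_def)
  then have "det3 v b b' = 0" "det3 v b' b = 0" using det3_swap_right [of v b b'] by linarith+
  then have "b' \<in> E" "b \<in> E'" using v by (auto simp: oriented_def)
  then show ?thesis using facet_edge_eqI [OF E, of v b v b'] v by (simp add: oriented_def)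
qed

lemma target_inj:
  assumes n: "n \<in> facet_normals" and E: "E \<in> facet_edges n" "E' \<in> facet_edges n"
    and v: "oriented n E a v" "oriented n E' a' v"
  shows "E = E'"
proof -
  have "0 \<le> det3 a v a'" "0 \<le> det3 a' v a" using v by (auto simp: oriented_def)
  moreover have "det3 a' v a = - det3 a v a'" by (simp add: det3_coords algebra_simps)
  ultimately have "det3 a v a' = 0" "det3 a' v a = 0" by linarith+
  then have "a' \<in> E" "a \<in> E'" using v by (auto simp: oriented_def)
  then show ?thesis using facet_edge_eqI [OF E, of a v a' v] v by (simp add: oriented_def)
qed

text \<open>A vertex is the intersection of the edges through it, so there are at least two of them.
  It can start only one and end only one, hence it does both.\<close>

lemma source_and_target_exist:
  assumes n: "n \<in> facet_normals" and v: "v extreme_point_of facet n"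
  shows "(\<exists>E\<in>facet_edges n. \<exists>b. oriented n E v b) \<and> (\<exists>E\<in>facet_edges n. \<exists>a. oriented n E a v)"
proof -
  note np = normal_polar [OF n]
  have face: "{v} face_of facet n" using v face_of_singleton by blast
  have dim: "aff_dim (facet n) = 2" using n by (simp add: facet_normals_def)
  then have "{v} \<noteq> facet n" by (metis aff_dim_sing zero_neq_numeral)
  then have eq: "{v} = \<Inter>{F. F facet_of facet n \<and> {v} \<subseteq> F}"
    using face_of_polyhedron [OF polytope_imp_polyhedron [OF polytope_facet [OF np]] face] by blast
  have "\<exists>E E'. E \<in> facet_edges n \<and> E' \<in> facet_edges n \<and> v \<in> E \<and> v \<in> E' \<and> E \<noteq> E'"
  proof (rule ccontr)
    assume *: "\<not> ?thesis"
    have sub: "F = F'" if "F facet_of facet n" "v \<in> F" "F' facet_of facet n" "v \<in> F'" for F F'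
      using * that facet_edges_iff [OF n] by blast
    \<comment> \<open>With at most one edge at \<open>v\<close> the intersection is either
      empty-indexed, hence \<open>UNIV\<close>, or contains a whole edge.\<close>
    have "\<Inter>{F. F facet_of facet n \<and> {v} \<subseteq> F} = UNIV
      \<or> (\<exists>E. E facet_of facet n \<and> E \<subseteq> \<Inter>{F. F facet_of facet n \<and> {v} \<subseteq> F})"
    proof (cases "\<exists>E. E facet_of facet n \<and> v \<in> E")
      case True
      then obtain E where E: "E facet_of facet n" "v \<in> E" by blast
      then have "{F. F facet_of facet n \<and> {v} \<subseteq> F} \<subseteq> {E}" using sub by blast
      then show ?thesis using E by blast
    next
      case False
      then have "{F. F facet_of facet n \<and> {v} \<subseteq> F} = {}" by blast
      then show ?thesis by (metis Inf_empty)
    qed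
    then show False
    proof
      assume "\<Inter>{F. F facet_of facet n \<and> {v} \<subseteq> F} = UNIV"
      then have "(UNIV :: (real ^ 3) set) = {v}" using eq by simp
      then show False by (metis UNIV_I aff_dim_UNIV aff_dim_sing DIM_positive of_nat_0_less_iff less_irrefl)
    next
      assume "\<exists>E. E facet_of facet n \<and> E \<subseteq> \<Inter>{F. F facet_of facet n \<and> {v} \<subseteq> F}"
      then obtain E where E: "E facet_of facet n" "E \<subseteq> {v}" using eq by auto
      then have "aff_dim E \<le> aff_dim {v}" using aff_dim_subset by blast
      then show False using E(1) dim by (simp add: facet_of_def)
    qed
  qed
  then obtain E E' where E: "E \<in> facet_edges n" "v \<in> E" and E': "E' \<in> facet_edges n" "v \<in> E'" and ne: "E \<noteq> E'"
    by blast
  obtain a b where ab: "oriented n E a b" using oriented_exists [OF n E(1)] by blast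
  obtain a' b' where ab': "oriented n E' a' b'" using oriented_exists [OF n E'(1)] by blast
  have "E face_of facet n" "E' face_of facet n"
    using E E' facet_edges_iff [OF n] facet_of_imp_face_of by blast+
  then have "v extreme_point_of E" "v extreme_point_of E'"
    using v E E' extreme_point_of_face by blast+
  then have "v = a \<or> v = b" "v = a' \<or> v = b'"
    using ab ab' extreme_point_of_segment by (metis oriented_def)+
  moreover have "\<not> (v = a \<and> v = a')" using source_inj [OF n E(1) E'(1)] ab ab' ne by blast
  moreover have "\<not> (v = b \<and> v = b')" using target_inj [OF n E(1) E'(1)] ab ab' ne by blast
  ultimately show ?thesis using ab ab' E E' by blast
qed

definition source :: "real ^ 3 \<Rightarrow> (real ^ 3) set \<Rightarrow> real ^ 3" where
  "source n E = (SOME a. \<exists>b. oriented n E a b)"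

definition target :: "real ^ 3 \<Rightarrow> (real ^ 3) set \<Rightarrow> real ^ 3" where
  "target n E = (SOME b. oriented n E (source n E) b)"

lemma oriented_source_target:
  assumes "n \<in> facet_normals" "E \<in> facet_edges n"
  shows "oriented n E (source n E) (target n E)"
proof -
  have "\<exists>b. oriented n E (source n E) b"
    unfolding source_def using oriented_exists [OF assms] by (rule someI_ex)
  then show ?thesis unfolding target_def by (rule someI_ex)
qed

lemma source_target_eq:
  assumes "n \<in> facet_normals" "E \<in> facet_edges n" "oriented n E a b"
  shows "source n E = a" "target n E = b"
  using oriented_unique [OF assms(1,2,3) oriented_source_target [OF assms(1,2)]] by auto

text \<open>Together with the same fact for \<open>target\<close> this replaces a cyclic order of
  the vertices: a function summed over sources and over targets gives the same value.\<close>

lemma bij_betw_source: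
  assumes n: "n \<in> facet_normals"
  shows "bij_betw (source n) (facet_edges n) {v. v extreme_point_of facet n}"
proof (rule bij_betw_imageI)
  show "inj_on (source n) (facet_edges n)"
    using source_inj [OF n] oriented_source_target [OF n] by (metis inj_onI)
  show "source n ` facet_edges n = {v. v extreme_point_of facet n}"
  proof (intro set_eqI iffI)
    fix v assume "v \<in> source n ` facet_edges n"
    then show "v \<in> {v. v extreme_point_of facet n}"
      using oriented_source_target [OF n] by (auto simp: oriented_def)
  next
    fix v assume "v \<in> {v. v extreme_point_of facet n}"
    then show "v \<in> source n ` facet_edges n"
      using source_and_target_exist [OF n] source_target_eq(1) [OF n] by (metis imageI mem_Collect_eq)
  qed
qed

lemma bij_betw_target:
  assumes n: "n \<in> facet_normals"
  shows "bij_betw (target n) (facet_edges n) {v. v extreme_point_of facet n}"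
proof (rule bij_betw_imageI)
  show "inj_on (target n) (facet_edges n)"
    using target_inj [OF n] oriented_source_target [OF n] by (metis inj_onI)
  show "target n ` facet_edges n = {v. v extreme_point_of facet n}"
  proof (intro set_eqI iffI)
    fix v assume "v \<in> target n ` facet_edges n"
    then show "v \<in> {v. v extreme_point_of facet n}"
      using oriented_source_target [OF n] by (auto simp: oriented_def)
  next
    fix v assume "v \<in> {v. v extreme_point_of facet n}"
    then show "v \<in> target n ` facet_edges n"
      using source_and_target_exist [OF n] source_target_eq(2) [OF n] by (metis imageI mem_Collect_eq)
  qed
qed

text \<open>If both facets traversed \<open>E\<close> in the same direction, \<open>n' - n\<close>
  would be \<open>t *\<^sub>R cross3 a b\<close>. Evaluated on \<open>facet n\<close>, membership of
  \<open>n'\<close> in the polar gives \<open>0 \<le> t\<close>; evaluated on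
  \<open>facet n'\<close>, membership of \<open>n\<close> gives \<open>t \<le> 0\<close>.\<close>

lemma oriented_opposite:
  assumes n: "n \<in> facet_normals" "n' \<in> facet_normals" "n \<noteq> n'"
    and E: "E \<in> facet_edges n" "E \<in> facet_edges n'"
    and ab: "oriented n E a b" "oriented n' E a' b'"
  shows "a' = b \<and> b' = a"
proof (rule ccontr)
  assume *: "\<not> ?thesis"
  have "closed_segment a b = closed_segment a' b'" using ab by (simp add: oriented_def)
  then have "{a, b} = {a', b'}" by simp
  then have eq: "a' = a" "b' = b" using * by (metis doubleton_eq_iff)+
  have a: "a \<bullet> n = -1" "a \<bullet> n' = -1" "b \<bullet> n = -1" "b \<bullet> n' = -1" "a \<noteq> b"
    using ab unfolding eq by (auto simp: oriented_def facetD)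
  have "(n' - n) \<bullet> a = 0" "(n' - n) \<bullet> b = 0" using a by (simp_all add: inner_diff_right inner_commute [of "n' - n"])
  then obtain t where t: "n' - n = t *\<^sub>R cross3 a b"
    using orthogonal_to_two cross3_nonzero_of_height [OF a(1,3,5)] by blast
  have ct: "c \<bullet> n' - c \<bullet> n = t * det3 a b c" for c
    using arg_cong [OF t, of "\<lambda>x. c \<bullet> x"] det3_rotate [of c a b] by (simp add: inner_diff_right det3_def)
  obtain c where c: "c \<in> facet n" "c \<notin> E" using edge_ne_facet [OF n(1) E(1)] .
  obtain d where d: "d \<in> facet n'" "d \<notin> E" using edge_ne_facet [OF n(2) E(2)] .
  have "0 < det3 a b c" "0 < det3 a b d"
    using ab c d unfolding eq by (auto simp: oriented_def order_less_le)
  moreover have "0 \<le> t * det3 a b c"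
    using ct [of c] c polarD [OF normal_polar [OF n(2)], of c] facetD [of c n] by simp
  moreover have "t * det3 a b d \<le> 0"
    using ct [of d] d polarD [OF normal_polar [OF n(1)], of d] facetD [of d n'] by simp
  ultimately have "t = 0" by (simp add: zero_le_mult_iff mult_le_0_iff)
  then show False using t n(3) by simp
qed

text \<open>There are at least two facets because \<open>E\<close> is the intersection of the facets
  containing it. A third one would have to be opposite in orientation to two facets that are already
  opposite to each other.\<close>

lemma edge_two_facets:
  assumes E: "E edge_of Q"
  obtains n n' a b where "n \<noteq> n'" "{m \<in> facet_normals. E \<in> facet_edges m} = {n, n'}"
    "oriented n E a b" "oriented n' E b a"
proof -
  have Ef: "E face_of Q" "aff_dim E = 1" using E by (auto simp: edge_of_def)
  then have "E \<noteq> {}" "E \<noteq> Q" using aff_dim_Q by auto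
  then have eq: "E = \<Inter>{F. F facet_of Q \<and> E \<subseteq> F}"
    by (rule face_of_polyhedron [OF polyhedron_Q Ef(1)])
  have "\<exists>n n'. n \<in> facet_normals \<and> n' \<in> facet_normals \<and> E \<subseteq> facet n \<and> E \<subseteq> facet n' \<and> n \<noteq> n'"
  proof (rule ccontr)
    assume *: "\<not> ?thesis"
    have sub: "F = F'" if "F facet_of Q" "E \<subseteq> F" "F' facet_of Q" "E \<subseteq> F'" for F F'
      using * that obtain_normal by metis
    have "\<exists>F. F facet_of Q \<and> E \<subseteq> F"
    proof (rule ccontr)
      assume "\<nexists>F. F facet_of Q \<and> E \<subseteq> F"
      then have "{F. F facet_of Q \<and> E \<subseteq> F} = {}" by blast
      then have "E = UNIV" using eq by (metis Inf_empty)
      then show False using Ef(2) by simp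
    qed
    then obtain F where F: "F facet_of Q" "E \<subseteq> F" by blast
    then have "{F. F facet_of Q \<and> E \<subseteq> F} = {F}" using sub by blast
    then have "E = F" using eq by simp
    then show False using F(1) Ef(2) aff_dim_Q by (simp add: facet_of_def)
  qed
  then obtain n n' where n: "n \<in> facet_normals" "n' \<in> facet_normals" "n \<noteq> n'"
    and En: "E \<in> facet_edges n" "E \<in> facet_edges n'"
    using E by (auto simp: facet_edges_def)
  obtain a b where ab: "oriented n E a b" using oriented_exists [OF n(1) En(1)] by blast
  obtain a' b' where ab': "oriented n' E a' b'" using oriented_exists [OF n(2) En(2)] by blast
  have opp: "a' = b" "b' = a" using oriented_opposite [OF n En ab ab'] by auto
  have "m = n \<or> m = n'" if m: "m \<in> facet_normals" "E \<in> facet_edges m" for m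
  proof (rule ccontr)
    assume ne: "\<not> ?thesis"
    obtain c d where cd: "oriented m E c d" using oriented_exists [OF m] by blast
    have "c = b" using oriented_opposite [OF n(1) m(1) _ En(1) m(2) ab cd] ne by blast
    moreover have "c = b'" using oriented_opposite [OF n(2) m(1) _ En(2) m(2) ab' cd] ne by blast
    ultimately show False using opp ab by (auto simp: oriented_def)
  qed
  then have "{m \<in> facet_normals. E \<in> facet_edges m} = {n, n'}" using n En by blast
  then show ?thesis using that n(3) ab ab' opp by blast
qed

end

subsection \<open>Flags cover every generic direction once\<close>

context reflexive_polytope
begin

text \<open>All lattice points of \<open>Q\<close> are considered, not only vertices, since
  subdivisions introduce edges between arbitrary lattice points of a facet. Parallel pairs are
  exempt, as their determinant is always zero.\<close>

definition generic :: "real ^ 3 \<Rightarrow> bool" where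
  "generic y \<longleftrightarrow> (\<forall>a\<in>Q \<inter> int_lattice. \<forall>b\<in>Q \<inter> int_lattice. cross3 a b \<noteq> 0 \<longrightarrow> det3 a b y \<noteq> 0)"

definition base :: "real ^ 3 \<Rightarrow> real ^ 3" where
  "base n = (SOME v. v extreme_point_of facet n)"

text \<open>A flag stands for the triangle spanned by its edge and the vertex \<open>base n\<close>
  of its facet. Edges through \<open>base n\<close> give degenerate triangles with empty cones;
  keeping them lets sums run over all edges.\<close>

definition flags :: "((real ^ 3) \<times> (real ^ 3) set) set" where
  "flags = Sigma facet_normals facet_edges"

definition flag_cone :: "(real ^ 3) \<times> (real ^ 3) set \<Rightarrow> real ^ 3 \<Rightarrow> bool" where
  "flag_cone = (\<lambda>(n, E) y. in_cone (base n) (source n E) (target n E) y)"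

lemma finite_lattice_points: "finite (Q \<inter> int_lattice)"
  by (rule finite_bounded_int_lattice [OF bounded_Q])

lemma finite_flags: "finite flags"
  unfolding flags_def using finite_facet_normals finite_facet_edges by simp

lemma base_extreme:
  assumes n: "n \<in> facet_normals"
  shows "base n extreme_point_of facet n"
proof -
  have "facet n \<noteq> {}" using n by (auto simp: facet_normals_def)
  then have "\<exists>v. v extreme_point_of facet n"
    using extreme_point_exists_convex polytope_imp_compact polytope_imp_convex
      polytope_facet [OF normal_polar [OF n]] by metis
  then show ?thesis unfolding base_def by (rule someI_ex)
qed

lemma base_mem:
  assumes n: "n \<in> facet_normals"
  shows "base n \<in> facet n \<inter> int_lattice"
  using base_extreme [OF n] extreme_point_of_face [OF facet_face [OF normal_polar [OF n]]]
    extreme_lattice by blast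

lemma facet_lattice_cross3:
  assumes "x \<in> facet n" "y \<in> facet n" "x \<noteq> y"
  shows "cross3 x y \<noteq> 0"
  using assms facetD cross3_nonzero_of_height by blast

lemma generic_facet:
  assumes "generic y" "a \<in> facet n \<inter> int_lattice" "b \<in> facet n \<inter> int_lattice" "a \<noteq> b"
  shows "det3 a b y \<noteq> 0"
  using assms facet_lattice_cross3 [of a n b] facetD(1) unfolding generic_def by blast

lemma generic_scaleR: "generic y \<Longrightarrow> c \<noteq> 0 \<Longrightarrow> generic (c *\<^sub>R y)"
  by (simp add: generic_def det3_scaleR)

lemma generic_minus: "generic y \<Longrightarrow> generic (- y)"
  by (simp add: generic_def det3_minus)

lemma facet_normals_nonempty: "facet_normals \<noteq> {}"
proof -
  obtain d where "0 + d *\<^sub>R axis 1 1 \<in> frontier Q"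
    using ray_to_frontier [OF bounded_Q zero_interior, of "axis 1 1"] by (metis axis_eq_0_iff zero_neq_one)
  then show ?thesis using frontier_facet by blast
qed

lemma generic_nonzero:
  assumes "generic y"
  shows "y \<noteq> 0"
proof
  assume y: "y = 0"
  obtain n where n: "n \<in> facet_normals" using facet_normals_nonempty by blast
  obtain E b where E: "E \<in> facet_edges n" "oriented n E (base n) b"
    using source_and_target_exist [OF n base_extreme [OF n]] by blast
  then have "det3 (base n) b y \<noteq> 0"
    using generic_facet [OF assms] by (auto simp: oriented_def)
  then show False using y by simp
qed

lemma flag_triangle:
  assumes "n \<in> facet_normals" "E \<in> facet_edges n"
  shows "0 \<le> det3 (base n) (source n E) (target n E)"
    "source n E \<in> facet n \<inter> int_lattice" "target n E \<in> facet n \<inter> int_lattice"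
    "source n E \<noteq> target n E" "E = closed_segment (source n E) (target n E)"
  using oriented_source_target [OF assms] base_mem [OF assms(1)]
    det3_rotate [of "base n" "source n E" "target n E"]
  by (auto simp: oriented_def)

lemma det3_segment: "x \<in> closed_segment a b \<Longrightarrow> det3 a b x = 0"
  by (auto simp: in_segment det3_simps)

text \<open>Follow the ray of \<open>y\<close> to a point \<open>u\<close> of a facet, then the ray
  from \<open>base n\<close> through \<open>u\<close> to a point \<open>x\<close> on an edge.
  Genericity keeps \<open>u\<close> off the edges and \<open>x\<close> off the ends of its
  edge.\<close>

lemma flag_cone_exists:
  assumes y: "generic y"
  shows "\<exists>f\<in>flags. flag_cone f y"
proof -
  obtain d where d: "0 < d" "0 + d *\<^sub>R y \<in> frontier Q"
    using ray_to_frontier [OF bounded_Q zero_interior generic_nonzero [OF y]] by metis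
  define u where "u = d *\<^sub>R y"
  have gu: "generic u" using generic_scaleR [OF y] d by (simp add: u_def)
  obtain n where n: "n \<in> facet_normals" and un: "u \<in> facet n"
    using frontier_facet d(2) u_def by auto
  note np = normal_polar [OF n]
  have off: "u \<notin> E" if "E \<in> facet_edges n" for E
    using generic_facet [OF gu flag_triangle(2-4) [OF n that]] flag_triangle(5) [OF n that]
      det3_segment by metis
  have front: "rel_frontier (facet n) = \<Union> (facet_edges n)"
    using rel_frontier_of_polyhedron [OF polytope_imp_polyhedron [OF polytope_facet [OF np]]]
      facet_edges_iff [OF n] by auto
  have ui: "u \<in> rel_interior (facet n)"
    using off un closure_subset [of "facet n"] front unfolding rel_frontier_def by blast
  define p where "p = base n"
  have p: "p \<in> facet n \<inter> int_lattice" using base_mem [OF n] by (simp add: p_def)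
  have up: "u \<noteq> p"
  proof -
    obtain E b where "E \<in> facet_edges n" "oriented n E p b"
      using source_and_target_exist [OF n base_extreme [OF n]] p_def by blast
    then show ?thesis using off by (auto simp: oriented_def)
  qed
  have "u + (u - p) = 2 *\<^sub>R u + (1 - 2) *\<^sub>R p" by (simp add: scaleR_2)
  moreover have "2 *\<^sub>R u + (1 - 2) *\<^sub>R p \<in> affine hull facet n"
    using mem_affine [OF affine_affine_hull hull_inc [OF un] hull_inc, of p 2 "1 - 2"] p by simp
  ultimately have aff: "u + (u - p) \<in> affine hull facet n" by simp
  have bnd: "bounded (facet n)" using polytope_imp_bounded [OF polytope_facet [OF np]] .
  obtain e where e: "0 < e" "u + e *\<^sub>R (u - p) \<in> rel_frontier (facet n)"
    using ray_to_rel_frontier [OF bnd ui aff] up by auto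
  define x where "x = u + e *\<^sub>R (u - p)"
  obtain E where E: "E \<in> facet_edges n" "x \<in> E" using e front x_def by auto
  define a b where "a = source n E" and "b = target n E"
  have ab: "0 \<le> det3 p a b" "a \<in> facet n \<inter> int_lattice" "b \<in> facet n \<inter> int_lattice" "a \<noteq> b"
    "E = closed_segment a b"
    using flag_triangle [OF n E(1)] by (simp_all add: p_def a_def b_def)
  obtain s where s: "0 \<le> s" "s \<le> 1" "x = (1 - s) *\<^sub>R a + s *\<^sub>R b"
    using E(2) ab(5) by (auto simp: in_segment)
  have ux: "u = (e / (1 + e)) *\<^sub>R p + (1 / (1 + e)) *\<^sub>R x"
  proof -
    have "(1 + e) *\<^sub>R u = e *\<^sub>R p + x" by (simp add: x_def algebra_simps)
    then have "(1 / (1 + e)) *\<^sub>R ((1 + e) *\<^sub>R u) = (1 / (1 + e)) *\<^sub>R (e *\<^sub>R p + x)" by simp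
    then show ?thesis using e(1) by (simp add: scaleR_add_right)
  qed
  \<comment> \<open>Otherwise \<open>u\<close>, a convex combination of \<open>p\<close> and
    \<open>x\<close>, would lie on the edge. Hence the triangle is nondegenerate.\<close>
  have pE: "p \<notin> E"
  proof
    assume "p \<in> E"
    then have "(e / (1 + e)) *\<^sub>R p + (1 / (1 + e)) *\<^sub>R x \<in> E"
      using E(2) ab(5) e(1) by (intro convexD) (auto simp: add_divide_distrib [symmetric])
    then show False using ux off [OF E(1)] by simp
  qed
  then have pab: "p \<noteq> a" "p \<noteq> b" using ab(5) by auto
  have "det3 a b p \<noteq> 0"
    using oriented_source_target [OF n E(1)] p pE by (auto simp: oriented_def a_def b_def)
  then have N: "0 < det3 p a b" using ab(1) det3_rotate [of p a b] by linarith
  have rot: "det3 a b p = det3 p a b" "det3 b p a = det3 p a b" by (metis det3_rotate)+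
  have dets: "det3 p a u = s / (1 + e) * det3 p a b" "det3 a b u = e / (1 + e) * det3 p a b"
    "det3 b p u = (1 - s) / (1 + e) * det3 p a b"
    unfolding ux s(3) by (simp_all add: det3_simps rot)
  have "det3 p a u \<noteq> 0" "det3 b p u \<noteq> 0"
    using generic_facet [OF gu p ab(2) pab(1)] generic_facet [OF gu ab(3) p] pab(2) by auto
  then have "0 < s" "s < 1" using s dets by (auto simp: order_less_le)
  then have "in_cone p a b u" using N e(1) unfolding in_cone_def dets by simp
  then have "in_cone p a b y" using d(1) by (simp add: in_cone_def u_def det3_scaleR zero_less_mult_iff)
  then have "flag_cone (n, E) y" by (simp add: flag_cone_def p_def a_def b_def)
  then show ?thesis using n E(1) by (auto simp: flags_def)
qed

lemma flag_cone_coords: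
  assumes n: "n \<in> facet_normals" and E: "E \<in> facet_edges n" and y: "flag_cone (n, E) y"
  obtains \<alpha> \<beta> \<gamma> where "0 < \<alpha>" "0 < \<beta>" "0 < \<gamma>"
    "y = \<alpha> *\<^sub>R base n + \<beta> *\<^sub>R source n E + \<gamma> *\<^sub>R target n E"
    "0 < det3 (base n) (source n E) (target n E)"
proof -
  define p a b where "p = base n" and "a = source n E" and "b = target n E"
  have ic: "in_cone p a b y" using y by (simp add: flag_cone_def p_def a_def b_def)
  have "p \<bullet> n = -1" "a \<bullet> n = -1" "b \<bullet> n = -1"
    using base_mem [OF n] flag_triangle [OF n E] facetD by (auto simp: p_def a_def b_def)
  then have "det3 p a b \<noteq> 0" using ic in_cone_degenerate by blast
  moreover have "0 \<le> det3 p a b" using flag_triangle [OF n E] by (simp add: p_def a_def b_def)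
  ultimately have N: "0 < det3 p a b" by simp
  have "y = (1 / det3 p a b) *\<^sub>R (det3 p a b *\<^sub>R y)" using N by simp
  also have "\<dots> = (det3 a b y / det3 p a b) *\<^sub>R p + (det3 b p y / det3 p a b) *\<^sub>R a
      + (det3 p a y / det3 p a b) *\<^sub>R b"
    unfolding cramer3 [of p a b y]
    by (simp add: scaleR_add_right det3_rotate [of y a b] det3_rotate [of b p y])
  finally show ?thesis
    using that ic N unfolding in_cone_def p_def a_def b_def by (meson divide_pos_pos)
qed

text \<open>On the cone of a flag at \<open>n\<close>, this \<open>n\<close> is the unique minimiser
  of \<open>y \<bullet> m\<close> over the facet normals \<open>m\<close>: the vertices of the
  triangle have value -1 at \<open>n\<close> and at least -1 at \<open>m\<close>.\<close>

lemma flag_cone_same_normal: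
  assumes n: "n \<in> facet_normals" "n' \<in> facet_normals" and E: "E \<in> facet_edges n" "E' \<in> facet_edges n'"
    and y: "flag_cone (n, E) y" "flag_cone (n', E') y"
  shows "n = n'"
proof -
  have half: "y \<bullet> m \<ge> y \<bullet> n" "y \<bullet> m = y \<bullet> n \<Longrightarrow> m = n"
    if n: "n \<in> facet_normals" and E: "E \<in> facet_edges n" and y: "flag_cone (n, E) y" and m: "m \<in> facet_normals"
    for n m E
  proof -
    obtain \<alpha> \<beta> \<gamma> where pos: "0 < \<alpha>" "0 < \<beta>" "0 < \<gamma>"
      and yc: "y = \<alpha> *\<^sub>R base n + \<beta> *\<^sub>R source n E + \<gamma> *\<^sub>R target n E"
      and det: "0 < det3 (base n) (source n E) (target n E)"
      using flag_cone_coords [OF n E y] .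
    define p a b where "p = base n" and "a = source n E" and "b = target n E"
    have Q: "p \<in> facet n" "a \<in> facet n" "b \<in> facet n"
      using base_mem [OF n] flag_triangle [OF n E] by (auto simp: p_def a_def b_def)
    have h: "p \<bullet> n = -1" "a \<bullet> n = -1" "b \<bullet> n = -1" using Q facetD by auto
    have "p \<bullet> m \<ge> -1" "a \<bullet> m \<ge> -1" "b \<bullet> m \<ge> -1"
      using Q facetD(1) polarD [OF normal_polar [OF m]] by auto
    then have nn: "0 \<le> \<alpha> * (p \<bullet> m + 1)" "0 \<le> \<beta> * (a \<bullet> m + 1)" "0 \<le> \<gamma> * (b \<bullet> m + 1)"
      using pos by auto
    have d: "y \<bullet> m - y \<bullet> n = \<alpha> * (p \<bullet> m + 1) + \<beta> * (a \<bullet> m + 1) + \<gamma> * (b \<bullet> m + 1)"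
      unfolding yc p_def [symmetric] a_def [symmetric] b_def [symmetric]
      using h by (simp add: inner_add_left algebra_simps)
    then show "y \<bullet> m \<ge> y \<bullet> n" using nn by linarith
    assume "y \<bullet> m = y \<bullet> n"
    then have "\<alpha> * (p \<bullet> m + 1) = 0" "\<beta> * (a \<bullet> m + 1) = 0" "\<gamma> * (b \<bullet> m + 1) = 0"
      using d nn by linarith+
    then have 0: "p \<bullet> (m - n) = 0" "a \<bullet> (m - n) = 0" "b \<bullet> (m - n) = 0"
      using pos h by (simp_all add: inner_diff_right)
    \<comment> \<open>The vector \<open>m - n\<close> is a combination of \<open>p\<close>,
      \<open>a\<close>, \<open>b\<close>, to all of which it is orthogonal.\<close>
    have "det3 p a b * ((m - n) \<bullet> (m - n)) = (det3 p a b *\<^sub>R (m - n)) \<bullet> (m - n)" by simp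
    also have "\<dots> = 0" unfolding cramer3 [of p a b "m - n"] using 0 by (simp add: inner_add_left)
    finally show "m = n" using det by (simp add: p_def a_def b_def)
  qed
  have "y \<bullet> n' = y \<bullet> n"
    using half(1) [OF n(1) E(1) y(1) n(2)] half(1) [OF n(2) E(2) y(2) n(1)] by simp
  then show ?thesis using half(2) [OF n(1) E(1) y(1) n(2)] by simp
qed

text \<open>Project \<open>y\<close> from \<open>base n\<close> to an inner point of each edge; the
  height fixes the total weight. Distinct weights would put one projection strictly between
  \<open>base n\<close> and the other, forcing \<open>base n\<close> onto its edge. So the
  projections agree, and a face through an inner point of \<open>E\<close> contains
  \<open>E\<close>.\<close>

lemma flag_cone_same_edge:
  assumes n: "n \<in> facet_normals" and E: "E \<in> facet_edges n" "E' \<in> facet_edges n"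
    and y: "flag_cone (n, E) y" "flag_cone (n, E') y"
  shows "E \<subseteq> E'"
proof -
  have pt: "\<exists>\<alpha> \<tau> x. 0 < \<alpha> \<and> 0 < \<tau> \<and> y = \<alpha> *\<^sub>R base n + \<tau> *\<^sub>R x \<and>
      x \<in> open_segment (source n E) (target n E) \<and> base n \<notin> E \<and> x \<in> E"
    if E: "E \<in> facet_edges n" and y: "flag_cone (n, E) y" for E
  proof -
    obtain \<alpha> \<beta> \<gamma> where pos: "0 < \<alpha>" "0 < \<beta>" "0 < \<gamma>"
      and yc: "y = \<alpha> *\<^sub>R base n + \<beta> *\<^sub>R source n E + \<gamma> *\<^sub>R target n E"
      and det: "0 < det3 (base n) (source n E) (target n E)"
      using flag_cone_coords [OF n E y] .
    define x where "x = (1 - \<gamma> / (\<beta> + \<gamma>)) *\<^sub>R source n E + (\<gamma> / (\<beta> + \<gamma>)) *\<^sub>R target n E"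
    have "(\<beta> + \<gamma>) *\<^sub>R x = \<beta> *\<^sub>R source n E + \<gamma> *\<^sub>R target n E"
      using pos by (simp add: x_def scaleR_add_right right_diff_distrib)
    then have "y = \<alpha> *\<^sub>R base n + (\<beta> + \<gamma>) *\<^sub>R x" using yc by (simp add: add.assoc)
    moreover have seg: "x \<in> open_segment (source n E) (target n E)"
      using pos flag_triangle(4) [OF n E] unfolding in_segment
      by (intro conjI exI [of _ "\<gamma> / (\<beta> + \<gamma>)"]) (auto simp: x_def)
    moreover have "x \<in> E"
      using seg flag_triangle(5) [OF n E] open_closed_segment by blast
    moreover have "base n \<notin> E"
      using det det3_segment [of "base n" "source n E" "target n E"] flag_triangle(5) [OF n E]
        det3_rotate [of "base n" "source n E" "target n E"] by auto
    ultimately show ?thesis using pos by (metis add_pos_pos)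
  qed
  obtain \<alpha> \<tau> x where x: "0 < \<alpha>" "0 < \<tau>" "y = \<alpha> *\<^sub>R base n + \<tau> *\<^sub>R x"
    "x \<in> open_segment (source n E) (target n E)" "base n \<notin> E" "x \<in> E" using pt [OF E(1) y(1)] by blast
  obtain \<alpha>' \<tau>' x' where x': "0 < \<alpha>'" "0 < \<tau>'" "y = \<alpha>' *\<^sub>R base n + \<tau>' *\<^sub>R x'"
    "x' \<in> open_segment (source n E') (target n E')" "base n \<notin> E'" "x' \<in> E'" using pt [OF E(2) y(2)] by blast
  have faces: "E face_of facet n" "E' face_of facet n"
    using E facet_edges_iff [OF n] facet_of_imp_face_of by blast+
  have mem: "x \<in> facet n" "x' \<in> facet n" "base n \<in> facet n"
    using x x' E facet_edgesD(2) base_mem [OF n] by auto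
  then have "y \<bullet> n = - \<alpha> - \<tau>"
    unfolding x(3) using facetD(2) by (simp add: inner_add_left)
  moreover have "y \<bullet> n = - \<alpha>' - \<tau>'"
    using mem unfolding x'(3) using facetD(2) by (simp add: inner_add_left)
  ultimately have sum: "\<alpha>' - \<alpha> = \<tau> - \<tau>'" by simp
  have no: False
    if "\<tau>' < \<tau>" "0 < \<tau>'" "\<alpha>' - \<alpha> = \<tau> - \<tau>'" "\<alpha> *\<^sub>R base n + \<tau> *\<^sub>R x = \<alpha>' *\<^sub>R base n + \<tau>' *\<^sub>R x'"
      "E face_of facet n" "x \<in> E" "x' \<in> facet n" "base n \<notin> E" "x' \<noteq> base n" for \<alpha> \<alpha>' \<tau> \<tau>' x x' E
  proof -
    have "\<tau> *\<^sub>R x = (\<alpha>' - \<alpha>) *\<^sub>R base n + \<tau>' *\<^sub>R x'" using that(4) by (simp add: algebra_simps)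
    then have "(1 / \<tau>) *\<^sub>R (\<tau> *\<^sub>R x) = (1 / \<tau>) *\<^sub>R ((\<tau> - \<tau>') *\<^sub>R base n + \<tau>' *\<^sub>R x')"
      using that(3) by simp
    then have "x = (1 - \<tau>' / \<tau>) *\<^sub>R base n + (\<tau>' / \<tau>) *\<^sub>R x'"
      using that(1,2) by (simp add: scaleR_add_right diff_divide_distrib)
    then have "x \<in> open_segment (base n) x'"
      using that(1,2,9) unfolding in_segment by (intro conjI exI [of _ "\<tau>' / \<tau>"]) auto
    then have "base n \<in> E" using face_ofD [OF that(5)] that(6,7) mem(3) by blast
    then show False using that(8) by simp
  qed
  have "\<not> \<tau>' < \<tau>"
    using no [of \<tau>' \<tau> \<alpha>' \<alpha> x x' E] x x' faces mem sum by metis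
  moreover have "\<not> \<tau> < \<tau>'"
    using no [of \<tau> \<tau>' \<alpha> \<alpha>' x' x E'] x x' faces mem sum by (metis minus_diff_eq)
  ultimately have "\<tau> = \<tau>'" by simp
  then have "\<alpha> = \<alpha>'" using sum by simp
  then have "\<tau> *\<^sub>R x = \<tau> *\<^sub>R x'" using x(3) x'(3) \<open>\<tau> = \<tau>'\<close> by (metis add_left_cancel)
  then have "x = x'" using x(2) by simp
  then have "source n E \<in> E'" "target n E \<in> E'"
    using face_ofD [OF faces(2) x(4)] flag_triangle [OF n E(1)] x'(6) by auto
  then show ?thesis
    using flag_triangle(5) [OF n E(1)] closed_segment_subset face_of_imp_convex [OF faces(2)] by metis
qed

lemma flag_cone_unique:
  assumes "generic y"
  shows "(\<Sum>f\<in>flags. of_bool (flag_cone f y)) = (1 :: 'a :: semiring_1)"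
proof -
  obtain f where f: "f \<in> flags" "flag_cone f y" using flag_cone_exists [OF assms] by blast
  have "g = f" if g: "g \<in> flags" "flag_cone g y" for g
  proof -
    obtain n E where fe: "f = (n, E)" "n \<in> facet_normals" "E \<in> facet_edges n" using f by (auto simp: flags_def)
    obtain n' E' where ge: "g = (n', E')" "n' \<in> facet_normals" "E' \<in> facet_edges n'" using g by (auto simp: flags_def)
    have "n = n'" using flag_cone_same_normal f g fe ge by blast
    moreover from this have "E = E'" using flag_cone_same_edge f g fe ge by blast
    ultimately show ?thesis using fe ge by simp
  qed
  then have "{g \<in> flags. flag_cone g y} = {f}" using f by blast
  then show ?thesis using finite_flags by (simp add: sum.If_cases of_bool_def Int_def)
qed

end

subsection \<open>Normalized volume of lattice segments\<close>

text \<open>The volume is chosen by \<open>SOME\<close>, so every admissible frame is evaluated: its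
  vector is \<open>w\<close> or \<open>- w\<close>, and the parameters of the segment fill an
  interval of length \<open>c\<close>.\<close>

lemma normalized_volume_segment:
  fixes a w :: "'a :: euclidean_space"
  assumes a: "a \<in> int_lattice" and w: "primitive w" and c: "0 < (c :: nat)"
  shows "normalized_volume (closed_segment a (a + real c *\<^sub>R w)) = real c"
proof -
  define S where "S = closed_segment a (a + real c *\<^sub>R w)"
  have w0: "w \<noteq> 0" and wl: "w \<in> int_lattice"
    using w primitive_imp_nonzero primitive_imp_int_lattice by blast+
  have aff: "affine hull S = range (\<lambda>t. a + t *\<^sub>R w)"
  proof -
    have "affine hull S = affine hull {a, a + real c *\<^sub>R w}"
      by (simp add: S_def segment_convex_hull)
    also have "\<dots> = range (\<lambda>t. a + t *\<^sub>R w)"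
    proof (intro set_eqI iffI)
      fix x assume "x \<in> affine hull {a, a + real c *\<^sub>R w}"
      then obtain u v where uv: "u + v = 1" "x = u *\<^sub>R a + v *\<^sub>R (a + real c *\<^sub>R w)"
        by (auto simp: affine_hull_2)
      have "x = (u + v) *\<^sub>R a + (v * real c) *\<^sub>R w" unfolding uv(2) by (simp add: algebra_simps)
      then have "x = a + (v * real c) *\<^sub>R w" using uv(1) by simp
      then show "x \<in> range (\<lambda>t. a + t *\<^sub>R w)" by blast
    next
      fix x assume "x \<in> range (\<lambda>t. a + t *\<^sub>R w)"
      then obtain t where "x = a + t *\<^sub>R w" by blast
      then have "x = (1 - t / c) *\<^sub>R a + (t / c) *\<^sub>R (a + real c *\<^sub>R w)"
        using c by (simp add: algebra_simps)
      then show "x \<in> affine hull {a, a + real c *\<^sub>R w}"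
        unfolding affine_hull_2 by (intro CollectI exI [of _ "1 - t / c"] exI [of _ "t / c"]) simp
    qed
    finally show ?thesis .
  qed
  have dim: "nat (aff_dim S) = 1" using c w0 by (simp add: S_def segment_convex_hull aff_dim_convex_hull aff_dim_2)
  have one: "{..<1 :: nat} = {0}" by auto
  have lat: "int_lattice \<inter> affine hull S = range (\<lambda>m :: int. a + of_int m *\<^sub>R w)"
  proof (intro set_eqI iffI)
    fix x assume x: "x \<in> int_lattice \<inter> affine hull S"
    then obtain t where t: "x = a + t *\<^sub>R w" unfolding aff by auto
    then have "t *\<^sub>R w \<in> int_lattice" using int_lattice_diff [of x a] x a by simp
    then have "t \<in> \<int>" by (rule primitive_scaleR_int_lattice [OF w])
    then show "x \<in> range (\<lambda>m :: int. a + of_int m *\<^sub>R w)" using t by (auto elim!: Ints_cases)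
  next
    fix x assume "x \<in> range (\<lambda>m :: int. a + of_int m *\<^sub>R w)"
    then show "x \<in> int_lattice \<inter> affine hull S"
      using a wl by (auto simp: aff int_lattice_add int_lattice_scaleR)
  qed
  have coeffs: "{p + (\<Sum>i<Suc 0. real_of_int (k i) *\<^sub>R b i) | k. True} = range (\<lambda>m :: int. p + of_int m *\<^sub>R b 0)"
    for p :: 'a and b :: "nat \<Rightarrow> 'a"
  proof (intro set_eqI iffI)
    fix x assume "x \<in> range (\<lambda>m :: int. p + of_int m *\<^sub>R b 0)"
    then obtain m :: int where "x = p + of_int m *\<^sub>R b 0" by blast
    then show "x \<in> {p + (\<Sum>i<Suc 0. real_of_int (k i) *\<^sub>R b i) | k. True}"
      by (intro CollectI exI [of _ "\<lambda>_. m"]) simp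
  qed auto
  have frame: "affine_lattice_frame S p b \<longleftrightarrow> b 0 \<noteq> 0 \<and> p \<in> range (\<lambda>m :: int. a + of_int m *\<^sub>R w) \<and>
      range (\<lambda>m :: int. a + of_int m *\<^sub>R w) = range (\<lambda>m :: int. p + of_int m *\<^sub>R b 0)" for p b
    unfolding affine_lattice_frame_def dim lat one coeffs [symmetric] by (auto simp: one lessThan_Suc)
  have vol: "fact 1 * measure (Pi\<^sub>M {..<1 :: nat} (\<lambda>_. lborel))
      {t \<in> {..<1} \<rightarrow>\<^sub>E UNIV. p + (\<Sum>i<1. t i *\<^sub>R b i) \<in> S} = real c"
    if fr: "affine_lattice_frame S p b" for p b
  proof -
    obtain k :: int where k: "p = a + of_int k *\<^sub>R w" using fr frame by blast
    have eq: "range (\<lambda>m :: int. a + of_int m *\<^sub>R w) = range (\<lambda>m :: int. p + of_int m *\<^sub>R b 0)"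
      using fr frame by blast
    have "p + of_int 1 *\<^sub>R b 0 \<in> range (\<lambda>m :: int. a + of_int m *\<^sub>R w)" unfolding eq by blast
    then obtain m :: int where "p + b 0 = a + of_int m *\<^sub>R w" by auto
    then have b: "b 0 = of_int (m - k) *\<^sub>R w" using k by (simp add: algebra_simps)
    have "a + of_int (k + 1) *\<^sub>R w \<in> range (\<lambda>m :: int. p + of_int m *\<^sub>R b 0)" unfolding eq [symmetric] by blast
    then obtain l :: int where "a + of_int (k + 1) *\<^sub>R w = p + of_int l *\<^sub>R b 0" by blast
    then have "w = of_int (l * (m - k)) *\<^sub>R w" using k b by (simp add: algebra_simps)
    then have "(of_int (l * (m - k)) - 1) *\<^sub>R w = 0" by (simp add: algebra_simps)
    then have "of_int (l * (m - k)) = (1 :: real)" using w0 by simp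
    then have "l * (m - k) = 1" by linarith
    then have s: "m - k = 1 \<or> m - k = -1" using zmult_eq_1_iff by blast
    \<comment> \<open>The left end of that interval: the coordinate \<open>k + t\<close> or
      \<open>k - t\<close> along \<open>w\<close> has to run through 0 to \<open>c\<close>.\<close>
    define lo where "lo = (if m - k = 1 then - real_of_int k else real_of_int k - real c)"
    have mem: "p + t *\<^sub>R b 0 \<in> S \<longleftrightarrow> t \<in> {lo..lo + c}" for t
    proof -
      have "p + t *\<^sub>R b 0 = a + (of_int k + t * of_int (m - k)) *\<^sub>R w"
        unfolding k b by (simp add: algebra_simps)
      moreover have "a + u *\<^sub>R w \<in> S \<longleftrightarrow> 0 \<le> u \<and> u \<le> c" for u
      proof
        assume "a + u *\<^sub>R w \<in> S"
        then obtain v where v: "0 \<le> v" "v \<le> 1" "a + u *\<^sub>R w = (1 - v) *\<^sub>R a + v *\<^sub>R (a + real c *\<^sub>R w)"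
          by (auto simp: S_def in_segment)
        then have "(u - v * c) *\<^sub>R w = 0" by (simp add: algebra_simps)
        then have "u = v * c" using w0 by simp
        then show "0 \<le> u \<and> u \<le> c" using v by (simp add: mult_left_le_one_le)
      next
        assume "0 \<le> u \<and> u \<le> c"
        then show "a + u *\<^sub>R w \<in> S" unfolding S_def in_segment
          using c by (intro exI [of _ "u / c"]) (simp add: algebra_simps)
      qed
      ultimately have iff: "p + t *\<^sub>R b 0 \<in> S \<longleftrightarrow>
          0 \<le> of_int k + t * of_int (m - k) \<and> of_int k + t * of_int (m - k) \<le> c"
        by simp
      from s show ?thesis
      proof
        assume "m - k = 1"
        then show ?thesis unfolding iff lo_def by (simp add: \<open>m - k = 1\<close>) linarith
      next
        assume "m - k = -1"
        then show ?thesis unfolding iff lo_def by (simp add: \<open>m - k = -1\<close>) linarith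
      qed
    qed
    interpret product_sigma_finite "\<lambda>_ :: nat. lborel :: real measure" ..
    have "{t \<in> {..<1} \<rightarrow>\<^sub>E UNIV. p + (\<Sum>i<1. t i *\<^sub>R b i) \<in> S} = (\<Pi>\<^sub>E i\<in>{..<1}. {lo..lo + c})"
      unfolding set_eq_iff by (simp add: lessThan_Suc PiE_iff mem conj_commute del: atLeastAtMost_iff)
    then have "measure (Pi\<^sub>M {..<1 :: nat} (\<lambda>_. lborel)) {t \<in> {..<1} \<rightarrow>\<^sub>E UNIV. p + (\<Sum>i<1. t i *\<^sub>R b i) \<in> S}
        = measure (Pi\<^sub>M {..<1 :: nat} (\<lambda>_. lborel)) (\<Pi>\<^sub>E i\<in>{..<1}. {lo..lo + c})" by simp
    also have "\<dots> = real c" by (simp add: measure_def emeasure_PiM)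
    finally show ?thesis by simp
  qed
  have ex: "affine_lattice_frame S a (\<lambda>_. w)"
    unfolding frame using w0 by (auto intro: image_eqI [of _ _ 0])
  show ?thesis
    unfolding S_def [symmetric] normalized_volume_def dim
  proof (rule some_equality)
    show "\<exists>p b. affine_lattice_frame S p b \<and> real c = fact 1 * measure (Pi\<^sub>M {..<1 :: nat} (\<lambda>_. lborel))
        {t \<in> {..<1} \<rightarrow>\<^sub>E UNIV. p + (\<Sum>i<1. t i *\<^sub>R b i) \<in> S}"
      by (intro exI conjI) (rule ex, rule vol [OF ex, symmetric])
  next
    fix v
    assume "\<exists>p b. affine_lattice_frame S p b \<and> v = fact 1 * measure (Pi\<^sub>M {..<1 :: nat} (\<lambda>_. lborel))
        {t \<in> {..<1} \<rightarrow>\<^sub>E UNIV. p + (\<Sum>i<1. t i *\<^sub>R b i) \<in> S}"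
    then show "v = real c" by (elim exE conjE) (simp only: vol)
  qed
qed

subsection \<open>The sum over the edges of a reflexive polytope\<close>

context reflexive_polytope
begin

definition dual_edge :: "(real ^ 3) set \<Rightarrow> (real ^ 3) set" where
  "dual_edge E = {y \<in> polar. \<forall>x\<in>E. x \<bullet> y = -1}"

text \<open>Both normals have value -1 on the edge, so they differ by a multiple of
  \<open>cross3 a w\<close>. This vector is primitive, which makes the multiple an integer; the
  orientation at \<open>n\<close> makes it positive.\<close>

lemma edge_duality:
  assumes E: "E edge_of Q"
  obtains a n w c d m where "a \<in> int_lattice" "primitive w" "0 < c" "E = closed_segment a (a + real c *\<^sub>R w)"
    "n \<in> int_lattice" "primitive (cross3 a w)" "0 < d"
    "dual_edge E = closed_segment n (n + real d *\<^sub>R cross3 a w)"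
    "m = n + real d *\<^sub>R cross3 a w" "n \<noteq> m" "{k \<in> facet_normals. E \<in> facet_edges k} = {n, m}"
    "oriented n E a (a + real c *\<^sub>R w)" "oriented m E (a + real c *\<^sub>R w) a"
proof -
  obtain n m a b where nm: "n \<noteq> m" "{k \<in> facet_normals. E \<in> facet_edges k} = {n, m}"
    and ab: "oriented n E a b" "oriented m E b a" using edge_two_facets [OF E] .
  have n: "n \<in> facet_normals" "E \<in> facet_edges n" "m \<in> facet_normals" "E \<in> facet_edges m" using nm by blast+
  have seg: "E = closed_segment a b" "a \<noteq> b" "a \<in> int_lattice" "b \<in> int_lattice"
    using ab by (auto simp: oriented_def)
  have h: "a \<bullet> n = -1" "a \<bullet> m = -1" "b \<bullet> n = -1" "b \<bullet> m = -1"
    using ab facetD by (auto simp: oriented_def)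
  obtain w c where w: "primitive w" "0 < (c :: nat)" "b - a = real c *\<^sub>R w"
    using exists_primitive [of "b - a"] int_lattice_diff [OF seg(4,3)] seg(2) by auto
  have b: "b = a + real c *\<^sub>R w" using w(3) by (simp add: algebra_simps)
  have "real c * (w \<bullet> n) = 0" "real c * (w \<bullet> m) = 0"
    using h b by (simp_all add: inner_add_left)
  then have wn: "w \<bullet> n = 0" "w \<bullet> m = 0" using w(2) by simp_all
  have prim: "primitive (cross3 a w)"
    by (rule cross3_primitive [OF seg(3) normal_lattice [OF n(1)] h(1) w(1) wn(1)])
  then have ne: "cross3 a w \<noteq> 0" by (rule primitive_imp_nonzero)
  have line: "\<exists>t. y = n + t *\<^sub>R cross3 a w" if "a \<bullet> y = -1" "b \<bullet> y = -1" for y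
  proof -
    have "real c * (w \<bullet> y) = 0" using that b by (simp add: inner_add_left)
    then have "(y - n) \<bullet> a = 0" "(y - n) \<bullet> w = 0"
      using w(2) wn(1) that(1) h(1) by (simp_all add: inner_diff_right inner_commute [of "y - n"])
    then obtain t where "y - n = t *\<^sub>R cross3 a w" using orthogonal_to_two ne by blast
    then show ?thesis by (metis add.commute diff_add_cancel)
  qed
  obtain t where t: "m = n + t *\<^sub>R cross3 a w" using line h by blast
  have "t *\<^sub>R cross3 a w \<in> int_lattice"
    using t int_lattice_diff normal_lattice n by (metis add_diff_cancel_left')
  then have "t \<in> \<int>" by (rule primitive_scaleR_int_lattice [OF prim])
  then obtain i where i: "t = of_int i" by (rule Ints_cases)
  obtain x where x: "x \<in> facet n" "x \<notin> E" using edge_ne_facet [OF n(1,2)] .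
  have "0 < det3 a b x" using ab(1) x by (auto simp: oriented_def order_less_le)
  then have pos: "0 < det3 a w x" using w(2) unfolding b by (simp add: det3_simps zero_less_mult_iff)
  have "x \<bullet> m - x \<bullet> n = t * det3 a w x"
    unfolding t by (simp add: inner_add_right det3_inner_cross3 inner_commute)
  then have "0 \<le> t * det3 a w x"
    using polarD [OF normal_polar [OF n(3)], of x] facetD [OF x(1)] by simp
  then have "0 \<le> t" using pos by (simp add: zero_le_mult_iff)
  moreover have "t \<noteq> 0" using t nm(1) by auto
  ultimately have "0 < i" using i by simp
  define d where "d = nat i"
  have d: "0 < d" "t = real d" using \<open>0 < i\<close> i by (simp_all add: d_def)
  have md: "m = n + real d *\<^sub>R cross3 a w" using t d by simp
  have "dual_edge E = closed_segment n m"
  proof (intro subset_antisym subsetI)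
    fix y assume y: "y \<in> closed_segment n m"
    obtain u where u: "0 \<le> u" "u \<le> 1" "y = (1 - u) *\<^sub>R n + u *\<^sub>R m" using y by (auto simp: in_segment)
    have "convex polar" using obtain_polar_vertices convex_convex_hull by metis
    then have "y \<in> polar" using normal_polar n(1,3) y closed_segment_subset by blast
    moreover have "x \<bullet> y = -1" if "x \<in> E" for x
    proof -
      have "x \<bullet> n = -1" "x \<bullet> m = -1" using that facet_edgesD(2) n facetD(2) by blast+
      then show ?thesis unfolding u(3) by (simp add: inner_add_right)
    qed
    ultimately show "y \<in> dual_edge E" by (simp add: dual_edge_def)
  next
    fix y assume y: "y \<in> dual_edge E"
    then have "a \<bullet> y = -1" "b \<bullet> y = -1" using seg by (auto simp: dual_edge_def)
    then obtain s where s: "y = n + s *\<^sub>R cross3 a w" using line by blast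
    have yp: "y \<in> polar" using y by (simp add: dual_edge_def)
    \<comment> \<open>Three points of \<open>polar\<close> on one line, of which \<open>n\<close>
      and \<open>m\<close> are extreme in \<open>polar\<close> and so not strictly between the
      others.\<close>
    have "collinear {n, m, y}"
      unfolding collinear_alt by (intro exI [of _ n] exI [of _ "cross3 a w"]) (auto simp: s t intro: exI [of _ 0])
    then consider "n \<in> closed_segment m y" | "m \<in> closed_segment y n" | "y \<in> closed_segment n m"
      by (auto simp: collinear_between_cases between_mem_segment)
    then show "y \<in> closed_segment n m"
    proof cases
      case 1
      then have "n = y" using normal_extreme [OF n(1)] normal_polar [OF n(3)] yp nm(1)
        by (auto simp: extreme_point_of_def closed_segment_eq_open)
      then show ?thesis by simp
    next
      case 2
      then have "m = y" using normal_extreme [OF n(3)] normal_polar [OF n(1)] yp nm(1)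
        by (auto simp: extreme_point_of_def closed_segment_eq_open)
      then show ?thesis by simp
    qed
  qed
  then show ?thesis
    using that [of a w c n d m] seg w prim d md nm ab b normal_lattice [OF n(1)] by simp
qed

text \<open>The vector \<open>\<zeta>\<close> keeps the denominators of \<open>corner\<close>
  nonzero. It is chosen after \<open>\<eta>\<close>, off the planes orthogonal to the vectors
  \<open>cross3 x \<eta>\<close>, whose nonvanishing follows from the genericity of
  \<open>\<eta>\<close>.\<close>

lemma generic_exists:
  obtains \<eta> \<zeta> where "\<eta> \<in> int_lattice" "generic \<eta>"
    "\<And>x y. x \<in> Q \<inter> int_lattice \<Longrightarrow> y \<in> Q \<inter> int_lattice \<Longrightarrow> cross3 x y \<noteq> 0 \<Longrightarrow> det3 x \<eta> \<zeta> \<noteq> 0"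
proof -
  let ?Z = "Q \<inter> int_lattice"
  let ?S = "(\<lambda>(x, y). cross3 x y) ` (?Z \<times> ?Z) - {0}"
  have "finite ?S" using finite_lattice_points by simp
  then obtain \<eta> where \<eta>: "\<eta> \<in> int_lattice" "\<And>v. v \<in> ?S \<Longrightarrow> v \<bullet> \<eta> \<noteq> 0"
    using exists_lattice_vector_off_planes [of ?S] by blast
  have gen: "det3 x y \<eta> \<noteq> 0" if "x \<in> ?Z" "y \<in> ?Z" "cross3 x y \<noteq> 0" for x y
    using \<eta>(2) [of "cross3 x y"] that unfolding det3_inner_cross3 by auto
  let ?T = "(\<lambda>x. cross3 x \<eta>) ` ?Z - {0}"
  have "finite ?T" using finite_lattice_points by simp
  then obtain \<zeta> where \<zeta>: "\<And>v. v \<in> ?T \<Longrightarrow> v \<bullet> \<zeta> \<noteq> 0"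
    using exists_lattice_vector_off_planes [of ?T] by blast
  have "det3 x \<eta> \<zeta> \<noteq> 0" if xy: "x \<in> ?Z" "y \<in> ?Z" "cross3 x y \<noteq> 0" for x y
  proof -
    have "det3 x \<eta> y \<noteq> 0" using gen [OF xy] det3_swap_right [of x \<eta> y] by simp
    then have "cross3 x \<eta> \<noteq> 0" unfolding det3_inner_cross3 by auto
    then show ?thesis using \<zeta> [of "cross3 x \<eta>"] xy(1) unfolding det3_inner_cross3 by auto
  qed
  then show ?thesis using that \<eta>(1) gen unfolding generic_def by blast
qed

text \<open>Coning an edge from \<open>base n\<close> adds the terms that join its ends to
  \<open>base n\<close>: one function, taken at the target minus at the source. These cancel in the
  sum because source and target run through the same vertices.\<close>

lemma facet_edge_sum:
  assumes n: "n \<in> facet_normals" and \<eta>: "\<eta> \<in> int_lattice" "generic \<eta>"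
    and \<zeta>: "\<And>x y. x \<in> Q \<inter> int_lattice \<Longrightarrow> y \<in> Q \<inter> int_lattice \<Longrightarrow> cross3 x y \<noteq> 0 \<Longrightarrow> det3 x \<eta> \<zeta> \<noteq> 0"
  shows "(\<Sum>E\<in>facet_edges n. edge_term \<eta> \<zeta> n (source n E) (target n E)) =
    12 * (\<Sum>E\<in>facet_edges n. of_bool (flag_cone (n, E) \<eta>) + of_bool (flag_cone (n, E) (- \<eta>)))"
proof -
  let ?p = "base n" and ?g = "edge_term \<eta> \<zeta> n"
  have F: "convex (facet n)" "n \<in> int_lattice" "\<And>x. x \<in> facet n \<Longrightarrow> x \<bullet> n = -1"
    using convex_facet [OF normal_polar [OF n]] normal_lattice [OF n] facetD(2) by auto
  have p: "?p \<in> facet n \<inter> int_lattice" by (rule base_mem [OF n])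
  obtain E0 b0 where E0: "E0 \<in> facet_edges n" "oriented n E0 ?p b0"
    using source_and_target_exist [OF n base_extreme [OF n]] by blast
  then have b0: "b0 \<in> facet n \<inter> int_lattice" "b0 \<noteq> ?p" by (auto simp: oriented_def)
  have \<zeta>': "det3 x \<eta> \<zeta> \<noteq> 0" if x: "x \<in> facet n \<inter> int_lattice" for x
  proof -
    obtain y where "y \<in> facet n \<inter> int_lattice" "x \<noteq> y" using p b0 by metis
    then show ?thesis using \<zeta> [of x y] x facet_lattice_cross3 [of x n y] facetD(1) by blast
  qed
  have "?g (source n E) (target n E) + (?g (target n E) ?p - ?g (source n E) ?p) =
      12 * (of_bool (flag_cone (n, E) \<eta>) + of_bool (flag_cone (n, E) (- \<eta>)))"
    if E: "E \<in> facet_edges n" for E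
  proof -
    note tri = flag_triangle [OF n E]
    have "?g ?p (source n E) + ?g (source n E) (target n E) + ?g (target n E) ?p =
        12 * (of_bool (in_cone ?p (source n E) (target n E) \<eta>) + of_bool (in_cone ?p (source n E) (target n E) (- \<eta>)))"
      by (rule edge_term_cocycle [OF F \<eta>(1) generic_facet [OF \<eta>(2)] \<zeta>' p tri(2,3,1)])
    moreover have "?g ?p (source n E) + ?g (source n E) ?p + ?g ?p ?p = 0"
      by (rule edge_term_collinear) (use p tri F \<eta> in auto)
    moreover have "?g ?p ?p = 0" by (simp add: edge_term_def)
    ultimately show ?thesis by (simp add: flag_cone_def)
  qed
  then have "(\<Sum>E\<in>facet_edges n. ?g (source n E) (target n E) + (?g (target n E) ?p - ?g (source n E) ?p)) =
      (\<Sum>E\<in>facet_edges n. 12 * (of_bool (flag_cone (n, E) \<eta>) + of_bool (flag_cone (n, E) (- \<eta>))))"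
    by (rule sum.cong [OF refl])
  moreover have "(\<Sum>E\<in>facet_edges n. ?g (target n E) ?p) = (\<Sum>v | v extreme_point_of facet n. ?g v ?p)"
    by (rule sum.reindex_bij_betw [OF bij_betw_target [OF n]])
  moreover have "(\<Sum>E\<in>facet_edges n. ?g (source n E) ?p) = (\<Sum>v | v extreme_point_of facet n. ?g v ?p)"
    by (rule sum.reindex_bij_betw [OF bij_betw_source [OF n]])
  ultimately show ?thesis by (simp add: sum.distrib sum_subtractf sum_distrib_left)
qed

lemma edge_pair_sum:
  assumes E: "E edge_of Q" and \<eta>: "\<eta> \<in> int_lattice" "generic \<eta>"
  shows "(\<Sum>n | n \<in> facet_normals \<and> E \<in> facet_edges n. edge_term \<eta> \<zeta> n (source n E) (target n E)) =
    normalized_volume E * normalized_volume (dual_edge E)"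
proof -
  obtain a n w c d m where a: "a \<in> int_lattice" "primitive w" "0 < (c :: nat)" "E = closed_segment a (a + real c *\<^sub>R w)"
    and n: "n \<in> int_lattice" "primitive (cross3 a w)" "0 < (d :: nat)"
      "dual_edge E = closed_segment n (n + real d *\<^sub>R cross3 a w)"
    and m: "m = n + real d *\<^sub>R cross3 a w" "n \<noteq> m"
    and nm: "{k \<in> facet_normals. E \<in> facet_edges k} = {n, m}"
    and or: "oriented n E a (a + real c *\<^sub>R w)" "oriented m E (a + real c *\<^sub>R w) a"
    using edge_duality [OF E] .
  define b where "b = a + real c *\<^sub>R w"
  have nf: "n \<in> facet_normals" "E \<in> facet_edges n" "m \<in> facet_normals" "E \<in> facet_edges m" using nm by blast+
  have mem: "a \<in> facet n" "b \<in> facet n" "a \<in> facet m" "b \<in> facet m" "b \<in> int_lattice" "a \<noteq> b"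
    using or by (auto simp: oriented_def b_def)
  then have h: "a \<bullet> n = -1" "b \<bullet> n = -1" "a \<bullet> m = -1" "b \<bullet> m = -1" using facetD(2) by auto
  then have "real c * (w \<bullet> n) = 0" "real c * (w \<bullet> m) = 0" by (simp_all add: b_def inner_add_left)
  then have wn: "w \<bullet> n = 0" "w \<bullet> m = 0" using a(3) by simp_all
  have "det3 a b \<eta> \<noteq> 0" using generic_facet [OF \<eta>(2), of a n b] mem a(1) by blast
  then have A: "det3 a w \<eta> \<noteq> 0" by (auto simp: b_def det3_simps)
  have st: "source n E = a" "target n E = b" "source m E = b" "target m E = a"
    using source_target_eq [OF nf(1,2) or(1)] source_target_eq [OF nf(3,4) or(2)] by (simp_all add: b_def)
  have "edge_term \<eta> \<zeta> n a b = - (n \<bullet> \<eta>) * of_int (int c) / det3 a w \<eta> - (corner \<eta> \<zeta> b w - corner \<eta> \<zeta> a w)"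
    by (rule edge_term_eq [OF a(1) n(1) \<eta>(1) h(1) a(2) wn(1)]) (simp add: b_def)
  \<comment> \<open>The same \<open>w\<close> is used with length \<open>- c\<close>, so the two
    corner corrections are negatives of each other.\<close>
  moreover have "edge_term \<eta> \<zeta> m b a = - (m \<bullet> \<eta>) * of_int (- int c) / det3 b w \<eta> - (corner \<eta> \<zeta> a w - corner \<eta> \<zeta> b w)"
    by (rule edge_term_eq [OF mem(5) normal_lattice [OF nf(3)] \<eta>(1) h(4) a(2) wn(2)]) (simp add: b_def)
  moreover have "det3 b w \<eta> = det3 a w \<eta>" by (simp add: b_def det3_simps)
  moreover have "m \<bullet> \<eta> = n \<bullet> \<eta> + real d * det3 a w \<eta>"
    unfolding m(1) by (simp add: inner_add_left det3_inner_cross3)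
  ultimately have "edge_term \<eta> \<zeta> n a b + edge_term \<eta> \<zeta> m b a =
      (n \<bullet> \<eta> + real d * det3 a w \<eta>) * c / det3 a w \<eta> - (n \<bullet> \<eta>) * c / det3 a w \<eta>"
    by (simp add: algebra_simps add_divide_distrib)
  also have "\<dots> = real c * real d" using A by (simp add: field_simps)
  finally have "edge_term \<eta> \<zeta> n a b + edge_term \<eta> \<zeta> m b a = real c * real d" .
  moreover have "normalized_volume E = real c" unfolding a(4) by (rule normalized_volume_segment [OF a(1-3)])
  moreover have "normalized_volume (dual_edge E) = real d" unfolding n(4) by (rule normalized_volume_segment [OF n(1-3)])
  ultimately show ?thesis unfolding nm using m(2) by (simp add: st)
qed

lemma sum_flags: "(\<Sum>n\<in>facet_normals. \<Sum>E\<in>facet_edges n. h (n, E)) = sum h flags"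
  unfolding flags_def
  using sum.Sigma [OF finite_facet_normals, of facet_edges "\<lambda>n E. h (n, E)"] finite_facet_edges
  by (simp add: split_def)

theorem sum_edges_dual_edges:
  "(\<Sum>E | E edge_of Q. normalized_volume E * normalized_volume (dual_edge E)) = 24"
proof -
  obtain \<eta> \<zeta> where \<eta>: "\<eta> \<in> int_lattice" "generic \<eta>"
    and \<zeta>: "\<And>x y. x \<in> Q \<inter> int_lattice \<Longrightarrow> y \<in> Q \<inter> int_lattice \<Longrightarrow> cross3 x y \<noteq> 0 \<Longrightarrow> det3 x \<eta> \<zeta> \<noteq> 0"
    using generic_exists by metis
  let ?g = "\<lambda>n E. edge_term \<eta> \<zeta> n (source n E) (target n E)"
  have "(\<Sum>E | E edge_of Q. normalized_volume E * normalized_volume (dual_edge E)) =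
      (\<Sum>E | E edge_of Q. \<Sum>n | n \<in> facet_normals \<and> E \<in> facet_edges n. ?g n E)"
    using edge_pair_sum [OF _ \<eta>] by (intro sum.cong) auto
  also have "\<dots> = (\<Sum>n\<in>facet_normals. \<Sum>E | E \<in> {E. E edge_of Q} \<and> E \<in> facet_edges n. ?g n E)"
    using sum.swap_restrict [OF finite_edges finite_facet_normals, of "\<lambda>E n. ?g n E" "\<lambda>E n. E \<in> facet_edges n"]
    by simp
  also have "\<dots> = (\<Sum>n\<in>facet_normals. \<Sum>E\<in>facet_edges n. ?g n E)"
    by (intro sum.cong) (auto simp: facet_edges_def)
  also have "\<dots> = (\<Sum>n\<in>facet_normals. 12 * (\<Sum>E\<in>facet_edges n. of_bool (flag_cone (n, E) \<eta>) + of_bool (flag_cone (n, E) (- \<eta>))))"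
    using facet_edge_sum [OF _ \<eta> \<zeta>] by (intro sum.cong) auto
  also have "\<dots> = 12 * ((\<Sum>f\<in>flags. of_bool (flag_cone f \<eta>)) + (\<Sum>f\<in>flags. of_bool (flag_cone f (- \<eta>))))"
    by (simp only: sum_distrib_left [symmetric] sum.distrib
        sum_flags [of "\<lambda>f. of_bool (flag_cone f \<eta>)"] sum_flags [of "\<lambda>f. of_bool (flag_cone f (- \<eta>))"])
  also have "\<dots> = 24" by (simp add: flag_cone_unique \<eta>(2) generic_minus)
  finally show ?thesis .
qed

end

subsection \<open>The Ehrhart polynomial of a reflexive polytope\<close>

context reflexive_polytope
begin

definition flag_half_open :: "real ^ 3 \<Rightarrow> (real ^ 3) \<times> (real ^ 3) set \<Rightarrow> real ^ 3 \<Rightarrow> bool" where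
  "flag_half_open \<eta> = (\<lambda>(n, E) z. half_open \<eta> (base n) (source n E) (target n E) z)"

definition flag_points :: "real ^ 3 \<Rightarrow> nat \<Rightarrow> (real ^ 3) \<times> (real ^ 3) set \<Rightarrow> (real ^ 3) set" where
  "flag_points \<eta> m = (\<lambda>(n, E). cone_points \<eta> n m (base n) (source n E) (target n E))"

lemma flag_heights:
  assumes "n \<in> facet_normals" "E \<in> facet_edges n"
  shows "base n \<bullet> n = -1" "source n E \<bullet> n = -1" "target n E \<bullet> n = -1"
  using base_mem [OF assms(1)] flag_triangle [OF assms] facetD(2) by auto

lemma flag_half_open_degenerate:
  assumes \<eta>: "generic \<eta>" and n: "n \<in> facet_normals" and E: "E \<in> facet_edges n"
    and z: "half_open \<eta> (base n) (source n E) (target n E) z"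
  shows "0 < det3 (base n) (source n E) (target n E)"
proof -
  have "det3 (base n) (source n E) (target n E) \<noteq> 0"
  proof
    assume "det3 (base n) (source n E) (target n E) = 0"
    then have "\<not> half_open \<eta> (base n) (source n E) (target n E) z"
      by (rule half_open_degenerate [OF flag_heights [OF n E]])
        (use generic_facet [OF \<eta>] base_mem [OF n] flag_triangle [OF n E] in auto)
    then show False using z by simp
  qed
  then show ?thesis using flag_triangle(1) [OF n E] by simp
qed

lemma eventually_flag_half_open:
  assumes \<eta>: "generic \<eta>" and f: "f \<in> flags"
  shows "\<forall>\<^sub>F \<epsilon> in at_right 0. flag_cone f (z + \<epsilon> *\<^sub>R \<eta>) = flag_half_open \<eta> f z"
proof -
  obtain n E where fe: "f = (n, E)" "n \<in> facet_normals" "E \<in> facet_edges n" using f by (auto simp: flags_def)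
  note tri = flag_triangle [OF fe(2,3)] and p = base_mem [OF fe(2)]
  show ?thesis
  proof (cases "det3 (base n) (source n E) (target n E) = 0")
    case True
    then have "\<not> flag_half_open \<eta> f z"
      using flag_half_open_degenerate [OF \<eta> fe(2,3)] by (auto simp: fe flag_half_open_def)
    moreover have "\<not> flag_cone f y" for y
      using in_cone_degenerate [OF flag_heights [OF fe(2,3)] True] by (simp add: fe flag_cone_def)
    ultimately show ?thesis by simp
  next
    case False
    then have "base n \<noteq> source n E" "source n E \<noteq> target n E" "target n E \<noteq> base n" by auto
    then show ?thesis
      unfolding fe flag_cone_def flag_half_open_def prod.case
      by (intro eventually_half_open generic_facet [OF \<eta>, of _ n] tri p)
  qed
qed

lemma eventually_generic:
  assumes \<eta>: "generic \<eta>"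
  shows "\<forall>\<^sub>F \<epsilon> in at_right 0. generic (z + \<epsilon> *\<^sub>R \<eta>)"
proof -
  have "\<forall>\<^sub>F \<epsilon> in at_right 0. cross3 a b \<noteq> 0 \<longrightarrow> det3 a b (z + \<epsilon> *\<^sub>R \<eta>) \<noteq> 0"
    if "a \<in> Q \<inter> int_lattice" "b \<in> Q \<inter> int_lattice" for a b
  proof (cases "cross3 a b = 0")
    case False
    then have "det3 a b \<eta> \<noteq> 0" using \<eta> that by (simp add: generic_def)
    then show ?thesis
      using eventually_lex_pos [OF \<open>det3 a b \<eta> \<noteq> 0\<close>, of "det3 a b z"]
      by eventually_elim (simp add: det3_simps)
  qed simp
  then show ?thesis
    unfolding generic_def using finite_lattice_points by (simp add: eventually_ball_finite)
qed

text \<open>Points on walls and the origin are included: for small \<open>\<epsilon>\<close> the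
  shifted point is generic and lies in exactly one open cone.\<close>

lemma flag_half_open_unique:
  assumes \<eta>: "generic \<eta>"
  shows "(\<Sum>f\<in>flags. of_bool (flag_half_open \<eta> f z)) = (1 :: nat)"
proof -
  have "\<forall>\<^sub>F \<epsilon> in at_right 0. \<forall>f\<in>flags. flag_cone f (z + \<epsilon> *\<^sub>R \<eta>) = flag_half_open \<eta> f z"
    using finite_flags eventually_flag_half_open [OF \<eta>] by (simp add: eventually_ball_finite)
  with eventually_generic [OF \<eta>, of z]
  have "\<forall>\<^sub>F \<epsilon> in at_right (0 :: real). ?thesis"
  proof eventually_elim
    case (elim \<epsilon>)
    have "(\<Sum>f\<in>flags. of_bool (flag_cone f (z + \<epsilon> *\<^sub>R \<eta>))) = (1 :: nat)" by (rule flag_cone_unique [OF elim(1)])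
    then show ?case using elim(2) by simp
  qed
  then show ?thesis using eventually_happens' [OF trivial_limit_at_right_real] by blast
qed

lemma mem_dilate:
  assumes "0 < m"
  shows "z \<in> dilate m Q \<longleftrightarrow> (1 / real m) *\<^sub>R z \<in> Q"
proof
  assume "z \<in> dilate m Q" then show "(1 / real m) *\<^sub>R z \<in> Q" using assms by (auto simp: dilate_def)
next
  assume "(1 / real m) *\<^sub>R z \<in> Q"
  then have "real m *\<^sub>R ((1 / real m) *\<^sub>R z) \<in> dilate m Q" unfolding dilate_def by (rule imageI)
  then show "z \<in> dilate m Q" using assms by simp
qed

text \<open>Within the cone of a flag, the inequality of its own facet cuts out the dilate: for
  positive \<open>m\<close>, a point of height at most \<open>m\<close> there is \<open>m\<close>
  times a convex combination of the three vertices and the origin.\<close>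

lemma flag_points_eq:
  assumes \<eta>: "generic \<eta>" and f: "f \<in> flags"
  shows "flag_points \<eta> m f = {z \<in> dilate m Q \<inter> int_lattice. flag_half_open \<eta> f z}"
proof -
  obtain n E where fe: "f = (n, E)" "n \<in> facet_normals" "E \<in> facet_edges n" using f by (auto simp: flags_def)
  define p a b where "p = base n" and "a = source n E" and "b = target n E"
  have Q: "p \<in> Q" "a \<in> Q" "b \<in> Q"
    using flag_triangle [OF fe(2,3)] base_mem [OF fe(2)] facetD(1) by (auto simp: p_def a_def b_def)
  have h: "p \<bullet> n = -1" "a \<bullet> n = -1" "b \<bullet> n = -1"
    using flag_heights [OF fe(2,3)] by (auto simp: p_def a_def b_def)
  have "z \<in> dilate m Q \<longleftrightarrow> - (z \<bullet> n) \<le> real m" if z: "half_open \<eta> p a b z" for z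
  proof
    assume "z \<in> dilate m Q"
    then obtain x where x: "x \<in> Q" "z = real m *\<^sub>R x" by (auto simp: dilate_def)
    have "real m * (- (x \<bullet> n)) \<le> real m * 1"
      using polarD [OF normal_polar [OF fe(2)] x(1)] by (intro mult_left_mono) auto
    then show "- (z \<bullet> n) \<le> real m" using x(2) by simp
  next
    assume zm: "- (z \<bullet> n) \<le> real m"
    have N: "0 < det3 p a b"
      using flag_half_open_degenerate [OF \<eta> fe(2,3), of z] z by (simp add: p_def a_def b_def)
    define \<alpha> \<beta> \<gamma> where "\<alpha> = det3 a b z / det3 p a b" and "\<beta> = det3 b p z / det3 p a b"
      and "\<gamma> = det3 p a z / det3 p a b"
    have nn: "0 \<le> \<alpha>" "0 \<le> \<beta>" "0 \<le> \<gamma>"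
      using z N by (auto simp: half_open_def lex_pos_def \<alpha>_def \<beta>_def \<gamma>_def)
    have "z = (1 / det3 p a b) *\<^sub>R (det3 p a b *\<^sub>R z)" using N by simp
    also have "\<dots> = \<alpha> *\<^sub>R p + \<beta> *\<^sub>R a + \<gamma> *\<^sub>R b"
      unfolding cramer3 [of p a b z]
      by (simp add: scaleR_add_right det3_rotate [of z a b] det3_rotate [of b p z] \<alpha>_def \<beta>_def \<gamma>_def)
    finally have zc: "z = \<alpha> *\<^sub>R p + \<beta> *\<^sub>R a + \<gamma> *\<^sub>R b" .
    then have sum: "\<alpha> + \<beta> + \<gamma> \<le> real m" using zm h by (simp add: inner_add_left)
    show "z \<in> dilate m Q"
    proof (cases "m = 0")
      case True
      then have "\<alpha> = 0" "\<beta> = 0" "\<gamma> = 0" using sum nn by auto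
      then have "z = 0" using zc by simp
      then show ?thesis using zero_mem by (auto simp: dilate_def True)
    next
      case False
      have "(\<Sum>i\<in>{0..<4 :: nat}. ([\<alpha> / m, \<beta> / m, \<gamma> / m, 1 - (\<alpha> + \<beta> + \<gamma>) / m] ! i) *\<^sub>R ([p, a, b, 0] ! i)) \<in> Q"
      proof (rule convex_sum [OF _ convex_Q])
        show "(\<Sum>i = 0..<4. [\<alpha> / m, \<beta> / m, \<gamma> / m, 1 - (\<alpha> + \<beta> + \<gamma>) / m] ! i) = 1"
          using False by (simp add: numeral_eq_Suc add_divide_distrib)
        fix i :: nat assume "i \<in> {0..<4}"
        then have "i = 0 \<or> i = 1 \<or> i = 2 \<or> i = 3" by auto
        then show "0 \<le> [\<alpha> / m, \<beta> / m, \<gamma> / m, 1 - (\<alpha> + \<beta> + \<gamma>) / m] ! i" "[p, a, b, 0] ! i \<in> Q"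
          using nn sum False Q zero_mem by (auto simp: numeral_eq_Suc field_simps)
      qed simp
      also have "(\<Sum>i\<in>{0..<4 :: nat}. ([\<alpha> / m, \<beta> / m, \<gamma> / m, 1 - (\<alpha> + \<beta> + \<gamma>) / m] ! i) *\<^sub>R ([p, a, b, 0] ! i))
          = (1 / real m) *\<^sub>R z"
        by (simp add: numeral_eq_Suc zc scaleR_add_right)
      finally show ?thesis using mem_dilate False by simp
    qed
  qed
  then show ?thesis
    by (auto simp: fe flag_points_def flag_half_open_def cone_points_def p_def a_def b_def)
qed

lemma finite_dilate_lattice: "finite (dilate m Q \<inter> int_lattice)"
  using finite_bounded_int_lattice [OF bounded_scaling [OF bounded_Q, of "real m"]] by (simp add: dilate_def)

lemma card_dilate:
  assumes \<eta>: "generic \<eta>"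
  shows "card (dilate m Q \<inter> int_lattice) = (\<Sum>f\<in>flags. card (flag_points \<eta> m f))"
proof -
  let ?K = "dilate m Q \<inter> int_lattice"
  have "card ?K = (\<Sum>z\<in>?K. \<Sum>f\<in>flags. of_bool (flag_half_open \<eta> f z))"
    by (simp only: flag_half_open_unique [OF \<eta>] sum_constant) simp
  also have "\<dots> = (\<Sum>f\<in>flags. \<Sum>z\<in>?K. of_bool (flag_half_open \<eta> f z))" by (rule sum.swap)
  also have "\<dots> = (\<Sum>f\<in>flags. card (flag_points \<eta> m f))"
  proof (rule sum.cong [OF refl])
    fix f assume "f \<in> flags"
    then have "card (flag_points \<eta> m f) = card {z \<in> ?K. flag_half_open \<eta> f z}"
      by (simp only: flag_points_eq [OF \<eta>])
    then show "(\<Sum>z\<in>?K. of_bool (flag_half_open \<eta> f z)) = card (flag_points \<eta> m f)"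
      using finite_dilate_lattice by (simp add: of_bool_def sum.If_cases Int_def)
  qed
  finally show ?thesis .
qed

text \<open>The outer coefficients count the flags whose cone contains \<open>\<eta>\<close> or
  \<open>- \<eta>\<close>, one each.\<close>

theorem card_dilate_polynomial:
  obtains s where "\<And>m. card (dilate m Q \<inter> int_lattice) =
    ((m + 3) choose 3) + s * ((m + 2) choose 3) + s * ((m + 1) choose 3) + (m choose 3)"
proof -
  obtain \<eta> where \<eta>: "generic \<eta>" using generic_exists by metis
  let ?c = "\<lambda>f. of_bool (flag_cone f \<eta>) :: nat" and ?d = "\<lambda>f. of_bool (flag_cone f (- \<eta>)) :: nat"
  have "\<exists>u v. \<forall>m. card (flag_points \<eta> m f) =
        ?c f * ((m + 3) choose 3) + u * ((m + 2) choose 3) + v * ((m + 1) choose 3) + ?d f * (m choose 3)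
      \<and> card (flag_points (- \<eta>) m f) =
        ?d f * ((m + 3) choose 3) + v * ((m + 2) choose 3) + u * ((m + 1) choose 3) + ?c f * (m choose 3)"
    if f: "f \<in> flags" for f
  proof -
    obtain n E where fe: "f = (n, E)" "n \<in> facet_normals" "E \<in> facet_edges n" using f by (auto simp: flags_def)
    have "convex (facet n)" "n \<in> int_lattice" "\<And>x. x \<in> facet n \<Longrightarrow> x \<bullet> n = -1"
      using convex_facet [OF normal_polar [OF fe(2)]] normal_lattice [OF fe(2)] facetD(2) by auto
    from cone_count_exists [OF this generic_facet [OF \<eta>, of _ n] base_mem [OF fe(2)]
        flag_triangle(2,3,1) [OF fe(2,3)]]
    obtain u v where "cone_count \<eta> n (base n) (source n E) (target n E) u v"
      "cone_count (- \<eta>) n (base n) (source n E) (target n E) v u" by blast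
    then show ?thesis unfolding fe flag_points_def flag_cone_def cone_count_def prod.case minus_minus by blast
  qed
  then obtain u v where uv: "card (flag_points \<eta> m f) =
        ?c f * ((m + 3) choose 3) + u f * ((m + 2) choose 3) + v f * ((m + 1) choose 3) + ?d f * (m choose 3)"
      "card (flag_points (- \<eta>) m f) =
        ?d f * ((m + 3) choose 3) + v f * ((m + 2) choose 3) + u f * ((m + 1) choose 3) + ?c f * (m choose 3)"
    if "f \<in> flags" for f m by metis
  have c: "sum ?c flags = 1" and d: "sum ?d flags = 1"
    by (simp_all add: flag_cone_unique \<eta> generic_minus)
  have 1: "card (dilate m Q \<inter> int_lattice) =
    ((m + 3) choose 3) + sum u flags * ((m + 2) choose 3) + sum v flags * ((m + 1) choose 3) + (m choose 3)" for m
  proof -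
    have "card (dilate m Q \<inter> int_lattice) = (\<Sum>f\<in>flags. card (flag_points \<eta> m f))" by (rule card_dilate [OF \<eta>])
    also have "\<dots> = sum ?c flags * ((m + 3) choose 3) + sum u flags * ((m + 2) choose 3)
        + sum v flags * ((m + 1) choose 3) + sum ?d flags * (m choose 3)"
      by (simp only: uv(1) sum.distrib sum_distrib_right cong: sum.cong)
    finally show ?thesis unfolding c d by simp
  qed
  have 2: "card (dilate m Q \<inter> int_lattice) =
    ((m + 3) choose 3) + sum v flags * ((m + 2) choose 3) + sum u flags * ((m + 1) choose 3) + (m choose 3)" for m
  proof -
    have "card (dilate m Q \<inter> int_lattice) = (\<Sum>f\<in>flags. card (flag_points (- \<eta>) m f))"
      by (rule card_dilate [OF generic_minus [OF \<eta>]])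
    also have "\<dots> = sum ?d flags * ((m + 3) choose 3) + sum v flags * ((m + 2) choose 3)
        + sum u flags * ((m + 1) choose 3) + sum ?c flags * (m choose 3)"
      by (simp only: uv(2) sum.distrib sum_distrib_right cong: sum.cong)
    finally show ?thesis unfolding c d by simp
  qed
  \<comment> \<open>At \<open>m = 1\<close> the two middle binomials are 1 and 0.\<close>
  have "sum u flags = sum v flags" using 1 [of 1] 2 [of 1] by (simp add: numeral_eq_Suc)
  then show ?thesis using that 1 by simp
qed

end

subsection \<open>The index of a Gorenstein polytope of degree two\<close>

lemma six_choose_three: "6 * int (n choose 3) = int n * (int n - 1) * (int n - 2)"
proof (induction n)
  case (Suc n)
  have "2 * int (n choose 2) = int n * (int n - 1)"
    by (induction n) (simp_all add: numeral_2_eq_2 algebra_simps)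
  moreover have "Suc n choose 3 = (n choose 2) + (n choose 3)" by (simp add: numeral_eq_Suc)
  ultimately show ?case using Suc by (simp add: algebra_simps)
qed simp

lemma fps_one_minus_X_power:
  "(1 - fps_X) ^ 4 * Abs_fps (\<lambda>k. int ((k + 3) choose 3)) = 1"
proof -
  have step: "(1 - fps_X) * Abs_fps (\<lambda>k. int ((k + Suc a) choose Suc a)) = Abs_fps (\<lambda>k. int ((k + a) choose a))" for a
  proof (rule fps_ext)
    fix k
    show "fps_nth ((1 - fps_X) * Abs_fps (\<lambda>k. int ((k + Suc a) choose Suc a))) k =
        fps_nth (Abs_fps (\<lambda>k. int ((k + a) choose a))) k"
      by (cases k) (simp_all add: left_diff_distrib)
  qed
  have base: "(1 - fps_X) * Abs_fps (\<lambda>k. 1 :: int) = 1"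
  proof (rule fps_ext)
    fix k show "fps_nth ((1 - fps_X) * Abs_fps (\<lambda>k. 1 :: int)) k = fps_nth 1 k"
      by (cases k) (simp_all add: left_diff_distrib)
  qed
  have "(1 - fps_X) ^ 4 * Abs_fps (\<lambda>k. int ((k + 3) choose 3)) =
      (1 - fps_X) * ((1 - fps_X) * ((1 - fps_X) * ((1 - fps_X) * Abs_fps (\<lambda>k. int ((k + 3) choose 3)))))"
    by (simp add: numeral_eq_Suc mult.assoc)
  also have "\<dots> = 1"
    using step [of 0] step [of 1] step [of 2] base by (simp add: numeral_eq_Suc)
  finally show ?thesis .
qed

lemma h_star_degree_two:
  fixes P :: "(real ^ 3) set"
  assumes "has_lattice_degree P 2"
  obtains h0 h1 h2 where "h2 \<noteq> 0" "\<And>k. int (card (dilate k P \<inter> int_lattice)) =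
    h0 * int ((k + 3) choose 3) + h1 * int ((k + 2) choose 3) + h2 * int ((k + 1) choose 3)"
proof -
  let ?L = "Abs_fps (\<lambda>k. int (card (dilate k P \<inter> int_lattice)))"
  let ?G = "Abs_fps (\<lambda>k. int ((k + 3) choose 3))"
  obtain p where p: "h_star P = fps_of_poly p" "degree p = 2"
    using assms unfolding has_lattice_degree_def by blast
  have "(1 - fps_X) ^ 4 * ?L = fps_of_poly p" using p(1) by (simp add: h_star_def)
  then have "fps_of_poly p * ?G = ((1 - fps_X) ^ 4 * ?L) * ?G" by simp
  also have "\<dots> = ((1 - fps_X) ^ 4 * ?G) * ?L" by (simp only: ac_simps)
  finally have L: "?L = fps_of_poly p * ?G" by (simp add: fps_one_minus_X_power)
  have "fps_of_poly p = fps_const (coeff p 0) + fps_const (coeff p 1) * fps_X + fps_const (coeff p 2) * fps_X ^ 2"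
  proof (rule fps_ext)
    fix n :: nat
    consider "n = 0" | "n = 1" | "n = 2" | "2 < n" by linarith
    then show "fps_nth (fps_of_poly p) n =
        fps_nth (fps_const (coeff p 0) + fps_const (coeff p 1) * fps_X + fps_const (coeff p 2) * fps_X ^ 2) n"
      by cases (simp_all add: coeff_eq_0 p(2) fps_X_power_nth)
  qed
  then have L': "?L = fps_const (coeff p 0) * ?G + fps_const (coeff p 1) * (fps_X * ?G) + fps_const (coeff p 2) * (fps_X ^ 2 * ?G)"
    unfolding L by (simp only: distrib_right mult.assoc)
  have "int (card (dilate k P \<inter> int_lattice)) =
    coeff p 0 * int ((k + 3) choose 3) + coeff p 1 * int ((k + 2) choose 3) + coeff p 2 * int ((k + 1) choose 3)" for k
  proof -
    have "fps_nth ?L k = coeff p 0 * int ((k + 3) choose 3) + coeff p 1 * fps_nth (fps_X * ?G) k + coeff p 2 * fps_nth (fps_X ^ 2 * ?G) k"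
      unfolding L' by simp
    \<comment> \<open>At \<open>k = 0\<close> the shifted series has coefficient zero, and so does
      \<open>2 choose 3\<close>.\<close>
    moreover have "fps_nth (fps_X * ?G) k = int ((k + 2) choose 3)"
      by (cases k) (simp_all add: eval_nat_numeral)
    moreover have "fps_nth (fps_X ^ 2 * ?G) k = int ((k + 1) choose 3)"
    proof (cases "k < 2")
      case True
      then have "k = 0 \<or> k = 1" by auto
      then show ?thesis by (auto simp: fps_X_power_mult_nth eval_nat_numeral)
    next
      case False
      then have "k - 2 + 3 = k + 1" by simp
      then show ?thesis using False by (simp add: fps_X_power_mult_nth)
    qed
    ultimately show ?thesis by simp
  qed
  moreover have "coeff p 2 \<noteq> 0" using p(2) by (metis degree_0 leading_coeff_0_iff zero_neq_numeral)
  ultimately show ?thesis using that by blast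
qed

lemma dilate_reflexive:
  fixes P :: "(real ^ 3) set"
  shows "dilate k ((\<lambda>x. x - m) ` dilate r P) = (\<lambda>z. z - real k *\<^sub>R m) ` dilate (k * r) P"
  by (simp add: dilate_def image_image scaleR_diff_right)

lemma card_lattice_translate:
  fixes S :: "(real ^ 3) set"
  assumes "v \<in> int_lattice"
  shows "card ((\<lambda>z. z - v) ` S \<inter> int_lattice) = card (S \<inter> int_lattice)"
proof -
  have "(\<lambda>z. z - v) ` S \<inter> int_lattice = (\<lambda>z. z - v) ` (S \<inter> int_lattice)"
    using int_lattice_add [OF _ assms] int_lattice_diff [OF _ assms] by force
  then show ?thesis by (simp add: card_image)
qed

text \<open>Two cubics in \<open>k\<close> count the lattice points of the same dilates, one from
  the h*-vector \<open>(h0, h1, h2)\<close> of \<open>P\<close>, the other from the palindromic one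
  of \<open>?Q\<close>. Elimination leaves \<open>(R - 2) * (12 - R * (R - 1) * t) = 0\<close>, and
  the second factor allows only \<open>R = 2\<close> or \<open>h2 = 0\<close>.\<close>

lemma index_two:
  fixes P :: "(real ^ 3) set"
  assumes r: "1 \<le> r" and m: "m \<in> int_lattice" and refl: "reflexive ((\<lambda>x. x - m) ` dilate r P)"
    and deg: "has_lattice_degree P 2"
  shows "r = 2"
proof -
  let ?Q = "(\<lambda>x. x - m) ` dilate r P"
  interpret reflexive_polytope ?Q by standard (rule refl)
  obtain s where s: "\<And>k. card (dilate k ?Q \<inter> int_lattice) =
      ((k + 3) choose 3) + s * ((k + 2) choose 3) + s * ((k + 1) choose 3) + (k choose 3)"
    using card_dilate_polynomial by metis
  obtain h0 h1 h2 where h2: "h2 \<noteq> 0" and h: "\<And>k. int (card (dilate k P \<inter> int_lattice)) =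
      h0 * int ((k + 3) choose 3) + h1 * int ((k + 2) choose 3) + h2 * int ((k + 1) choose 3)"
    using h_star_degree_two [OF deg] by metis
  have LQ: "card (dilate k ?Q \<inter> int_lattice) = card (dilate (k * r) P \<inter> int_lattice)" for k
    unfolding dilate_reflexive by (rule card_lattice_translate) (simp add: m int_lattice_scaleR)
  define R S where "R = int r" and "S = int s"
  have eq: "h0 * ((R * k + 3) * (R * k + 2) * (R * k + 1)) + h1 * ((R * k + 2) * (R * k + 1) * (R * k))
      + h2 * ((R * k + 1) * (R * k) * (R * k - 1)) =
      (k + 3) * (k + 2) * (k + 1) + S * ((k + 2) * (k + 1) * k) + S * ((k + 1) * k * (k - 1))
      + k * (k - 1) * (k - 2)" if "k = int j" for k j
  proof -
    have a: "6 * int ((i + 3) choose 3) = (int i + 3) * (int i + 2) * (int i + 1)"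
      "6 * int ((i + 2) choose 3) = (int i + 2) * (int i + 1) * int i"
      "6 * int ((i + 1) choose 3) = (int i + 1) * int i * (int i - 1)" for i
      unfolding six_choose_three by (simp_all add: algebra_simps)
    have "6 * int (card (dilate j ?Q \<inter> int_lattice)) = h0 * (6 * int ((j * r + 3) choose 3))
        + h1 * (6 * int ((j * r + 2) choose 3)) + h2 * (6 * int ((j * r + 1) choose 3))"
      unfolding LQ h by (simp add: algebra_simps)
    moreover have "6 * int (card (dilate j ?Q \<inter> int_lattice)) = 6 * int ((j + 3) choose 3)
        + S * (6 * int ((j + 2) choose 3)) + S * (6 * int ((j + 1) choose 3)) + 6 * int (j choose 3)"
      unfolding s S_def by (simp add: algebra_simps)
    ultimately show ?thesis
      unfolding a six_choose_three [of j] that R_def of_nat_mult by (simp only: mult.commute [of "int j" "int r"])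
  qed
  have h0: "h0 = 1" using eq [of 0 0] by simp
  define t u where "t = 1 + h1 + h2" and "u = 1 + S"
  have cubic: "t * R ^ 3 * k ^ 3 + (6 + 3 * h1) * R ^ 2 * k ^ 2 + (11 + 2 * h1 - h2) * R * k
      = 2 * u * k ^ 3 + 3 * u * k ^ 2 + (u + 12) * k" if "k = int j" for k j
    using eq [OF that] unfolding h0 t_def u_def by (simp add: algebra_simps power2_eq_square power3_eq_cube)
  define A B C where "A = t * R ^ 3" and "B = (6 + 3 * h1) * R ^ 2" and "C = (11 + 2 * h1 - h2) * R"
  have "A + B + C = 6 * u + 12" "8 * A + 4 * B + 2 * C = 30 * u + 24" "27 * A + 9 * B + 3 * C = 84 * u + 36"
    using cubic [of 1 1] cubic [of 2 2] cubic [of 3 3] unfolding A_def B_def C_def by simp_all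
  then have ABC: "A = 2 * u" "B = 3 * u" "C = u + 12" by linarith+
  have R: "R \<ge> 1" and u: "u \<ge> 1" using r by (simp_all add: R_def u_def S_def)
  have "R ^ 2 * (2 * (2 + h1)) = R ^ 2 * (R * t)"
    using ABC(1,2) unfolding A_def B_def by (simp add: algebra_simps power2_eq_square power3_eq_cube)
  then have h1: "2 * (2 + h1) = R * t" using R by simp
  have "0 < t * R ^ 3" using ABC(1) u A_def by simp
  then have t: "t \<ge> 1" using R by (simp add: zero_less_mult_iff)
  have "(R - 2) * (12 - R * (R - 1) * t) = 0"
  proof -
    have "2 * C = A + 24" using ABC by simp
    then have "2 * (11 + 2 * h1 - (t - 1 - h1)) * R = t * R ^ 3 + 24" 
      unfolding A_def C_def t_def by (simp add: algebra_simps)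
    then have "(24 + 3 * (2 * (2 + h1)) - 12 - 2 * t) * R = t * R ^ 3 + 24" by (simp add: algebra_simps)
    then have "(12 + 3 * (R * t) - 2 * t) * R = t * R ^ 3 + 24" unfolding h1 by simp
    then show ?thesis by (simp add: algebra_simps power3_eq_cube)
  qed
  then consider "R = 2" | "R * (R - 1) * t = 12" by auto
  then show ?thesis
  proof cases
    case 1
    then show ?thesis by (simp add: R_def)
  next
    case 2
    have "R \<le> 4"
    proof (rule ccontr)
      assume "\<not> R \<le> 4"
      then have "5 * 4 \<le> R * (R - 1)" by (intro mult_mono) auto
      then have "20 * 1 \<le> R * (R - 1) * t" using t by (intro mult_mono) auto
      then show False using 2 by simp
    qed
    then have "R = 1 \<or> R = 2 \<or> R = 3 \<or> R = 4" using R by auto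
    \<comment> \<open>The values of \<open>t\<close> and \<open>h1\<close> are 2 and 1, or 1 and 0;
      the h*-polynomial would have degree 1 or 0.\<close>
    moreover have "R = 3 \<Longrightarrow> h2 = 0" "R = 4 \<Longrightarrow> h2 = 0" using 2 h1 unfolding t_def by auto
    ultimately show ?thesis using 2 h2 by (auto simp: R_def)
  qed
qed

subsection \<open>The dual of a Gorenstein polytope of index two\<close>

lemma int_lattice_Pair:
  fixes y :: "'a :: euclidean_space" and t :: real
  shows "(y, t) \<in> int_lattice \<longleftrightarrow> y \<in> int_lattice \<and> t \<in> \<int>"
  by (auto simp: int_lattice_def Basis_prod_def)

lemma image_closed_segment:
  assumes "\<And>u a b. f ((1 - u) *\<^sub>R a + u *\<^sub>R b) = (1 - u) *\<^sub>R f a + u *\<^sub>R f b"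
  shows "f ` closed_segment a b = closed_segment (f a) (f b)"
  unfolding closed_segment_def setcompr_eq_image image_image assms ..

locale gorenstein_index_two =
  fixes P :: "(real ^ 3) set" and m :: "real ^ 3"
  assumes lattice_P: "lattice_polytope P" and lattice_m: "m \<in> int_lattice"
    and reflexive_double: "reflexive ((\<lambda>x. x - m) ` dilate 2 P)"

sublocale gorenstein_index_two \<subseteq> reflexive_polytope "(\<lambda>x. x - m) ` dilate 2 P"
  by standard (rule reflexive_double)

context gorenstein_index_two
begin

abbreviation "Q \<equiv> (\<lambda>x. x - m) ` dilate 2 P"

definition double :: "real ^ 3 \<Rightarrow> real ^ 3" where
  "double x = 2 *\<^sub>R x - m"

text \<open>A section of the hyperplane \<open>apex \<bullet> v = 1\<close>. Because of the halving
  its value at a lattice point need not be integral.\<close>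

definition lift :: "real ^ 3 \<Rightarrow> (real ^ 3) \<times> real" where
  "lift y = (y, (1 - m \<bullet> y) / 2)"

text \<open>The interior point \<open>m\<close> of \<open>2 P\<close>, placed at height two in the
  cone over \<open>P\<close>; it turns out to be \<open>gorenstein_point P\<close>.\<close>

definition apex :: "(real ^ 3) \<times> real" where
  "apex = (m, 2)"

abbreviation "C \<equiv> dual_cone (cone_over P)"

lemma Q_double: "Q = double ` P"
  by (simp add: dilate_def image_image double_def)

lemma double_lattice: "x \<in> int_lattice \<Longrightarrow> double x \<in> int_lattice"
  using int_lattice_diff [OF int_lattice_scaleR [of 2 x] lattice_m] by (simp add: double_def)

lemma inj_double: "inj double"
  by (rule injI) (simp add: double_def)

lemma apex_inner: "apex \<bullet> (y, t) = m \<bullet> y + 2 * t"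
  by (simp add: apex_def)

lemma apex_lift [simp]: "apex \<bullet> lift y = 1"
  by (simp add: apex_def lift_def field_simps)

lemma mem_C: "(y, t) \<in> C \<longleftrightarrow> (\<forall>x\<in>P. 0 \<le> x \<bullet> y + t)"
proof
  assume C: "(y, t) \<in> C"
  show "\<forall>x\<in>P. 0 \<le> x \<bullet> y + t"
  proof
    fix x assume "x \<in> P"
    then have "(1 *\<^sub>R x, 1) \<in> cone_over P" unfolding cone_over_def by force
    then show "0 \<le> x \<bullet> y + t" using C by (force simp: dual_cone_def)
  qed
next
  assume *: "\<forall>x\<in>P. 0 \<le> x \<bullet> y + t"
  have "0 \<le> (l *\<^sub>R x) \<bullet> y + l * t" if "0 \<le> l" "x \<in> P" for l x
  proof -
    have "0 \<le> l * (x \<bullet> y + t)" using * that by simp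
    then show ?thesis by (simp add: algebra_simps)
  qed
  then show "(y, t) \<in> C" by (auto simp: dual_cone_def cone_over_def)
qed

lemma lift_mem_iff: "lift y \<in> C \<longleftrightarrow> y \<in> polar"
proof -
  have "2 * (x \<bullet> y + (1 - m \<bullet> y) / 2) = double x \<bullet> y + 1" for x
    by (simp add: double_def inner_diff_left field_simps)
  then have "0 \<le> x \<bullet> y + (1 - m \<bullet> y) / 2 \<longleftrightarrow> -1 \<le> double x \<bullet> y" for x
    by (smt (verit))
  then have "lift y \<in> C \<longleftrightarrow> (\<forall>x\<in>P. -1 \<le> double x \<bullet> y)" unfolding lift_def mem_C by simp
  also have "\<dots> \<longleftrightarrow> (\<forall>z\<in>Q. -1 \<le> z \<bullet> y)" unfolding Q_double by simp
  finally show ?thesis by (simp add: polar_def)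
qed

lemma C_scaleR: "v \<in> C \<Longrightarrow> 0 \<le> c \<Longrightarrow> c *\<^sub>R v \<in> C"
  by (simp add: dual_cone_def)

text \<open>Exhibits \<open>C\<close> as the cone over the lifted polar, with \<open>apex\<close>
  measuring the height. The height is nonnegative because \<open>Q\<close> contains 0, and vanishes
  only at the origin because 0 is interior.\<close>

lemma C_apex_inner:
  assumes v: "v \<in> C"
  shows "0 \<le> apex \<bullet> v" "apex \<bullet> v = 0 \<Longrightarrow> v = 0"
    "0 < apex \<bullet> v \<Longrightarrow> v = (apex \<bullet> v) *\<^sub>R lift (fst v /\<^sub>R (apex \<bullet> v)) \<and> fst v /\<^sub>R (apex \<bullet> v) \<in> polar"
proof -
  obtain y t where yt: "v = (y, t)" by (cases v)
  define c where "c = apex \<bullet> v"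
  have c: "c = m \<bullet> y + 2 * t" by (simp add: c_def yt apex_inner)
  have low: "- c \<le> z \<bullet> y" if z: "z \<in> Q" for z
  proof -
    obtain x where "x \<in> P" "z = double x" using z unfolding Q_double by blast
    moreover from this have "0 \<le> x \<bullet> y + t" using v yt mem_C by blast
    ultimately show ?thesis by (simp add: c double_def inner_diff_left)
  qed
  have "0 \<le> c" using low [OF zero_mem] by simp
  then show "0 \<le> apex \<bullet> v" by (simp add: c_def)
  show "v = 0" if "apex \<bullet> v = 0"
  proof -
    have c0: "c = 0" using that by (simp add: c_def)
    obtain e where e: "0 < e" "ball 0 e \<subseteq> Q" using zero_interior mem_interior by blast
    have "y = 0"
    proof (rule ccontr)
      assume y: "y \<noteq> 0"
      \<comment> \<open>A point of the ball opposite to \<open>y\<close>, where the inner product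
        with \<open>y\<close> is negative.\<close>
      define z where "z = (- (e / (2 * norm y))) *\<^sub>R y"
      have "z \<in> Q" using e y by (intro subsetD [OF e(2)]) (simp add: z_def)
      then have "0 \<le> z \<bullet> y" using low c0 by fastforce
      moreover have "z \<bullet> y < 0" using e y by (simp add: z_def)
      ultimately show False by simp
    qed
    then show ?thesis using c c0 yt by (simp add: zero_prod_def)
  qed
  show "v = (apex \<bullet> v) *\<^sub>R lift (fst v /\<^sub>R (apex \<bullet> v)) \<and> fst v /\<^sub>R (apex \<bullet> v) \<in> polar" if "0 < apex \<bullet> v"
  proof -
    have cp: "0 < c" using that by (simp add: c_def)
    have "v = c *\<^sub>R lift (y /\<^sub>R c)" using cp by (simp add: yt lift_def c field_simps)
    moreover have "y /\<^sub>R c \<in> polar"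
      unfolding polar_def mem_Collect_eq
    proof
      fix z assume "z \<in> Q"
      then have "- c \<le> z \<bullet> y" by (rule low)
      then have "- 1 \<le> (z \<bullet> y) / c" using cp by (simp add: field_simps)
      then show "- 1 \<le> z \<bullet> (y /\<^sub>R c)" by (simp add: divide_inverse_commute)
    qed
    ultimately have "v = c *\<^sub>R lift (y /\<^sub>R c) \<and> y /\<^sub>R c \<in> polar" by blast
    moreover have "fst v = y" by (simp add: yt)
    ultimately show ?thesis unfolding c_def [symmetric] by simp
  qed
qed

lemma polar_of_vertices:
  assumes "P = convex hull V" "\<And>x. x \<in> V \<Longrightarrow> -1 \<le> double x \<bullet> y"
  shows "y \<in> polar"
proof -
  have "double = (\<lambda>x. - m + 2 *\<^sub>R x)" by (auto simp: double_def)
  then have "double ` P = convex hull (double ` V)"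
    unfolding assms(1) by (simp only: convex_hull_affinity)
  then have "Q = convex hull (double ` V)" by (simp only: Q_double)
  moreover have "convex hull (double ` V) \<subseteq> {z. y \<bullet> z \<ge> -1}"
    using assms(2) by (intro hull_minimal convex_halfspace_ge) (auto simp: inner_commute)
  ultimately have "Q \<subseteq> {z. y \<bullet> z \<ge> -1}" by (simp only:)
  then show ?thesis unfolding polar_def by (auto simp: inner_commute)
qed

text \<open>If all generators of \<open>P\<close> were slack at \<open>n\<close>, finitely many
  strict inequalities would give a neighbourhood of \<open>n\<close> inside \<open>polar\<close>. A
  tight lattice point \<open>x\<close> makes \<open>lift n\<close> integral: it yields
  \<open>m \<bullet> n = 2 * (x \<bullet> n) + 1\<close>, which is odd for a lattice point
  \<open>n\<close>.\<close>

lemma extreme_polar_tight: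
  assumes n: "n extreme_point_of polar"
  obtains x where "x \<in> P \<inter> int_lattice" "double x \<bullet> n = -1"
proof -
  obtain V where V: "finite V" "V \<subseteq> int_lattice" "P = convex hull V"
    using lattice_P unfolding lattice_polytope_def by blast
  have VP: "V \<subseteq> P" using V(3) hull_subset by metis
  have "\<exists>x\<in>V. double x \<bullet> n = -1"
  proof (rule ccontr)
    assume *: "\<not> ?thesis"
    let ?U = "\<Inter>x\<in>V. {y. double x \<bullet> y > -1}"
    have "open ?U" using V(1) by (intro open_INT ballI open_halfspace_gt)
    moreover have "?U \<subseteq> polar" using polar_of_vertices [OF V(3)] by force
    moreover have "n \<in> ?U"
    proof (rule INT_I, rule CollectI)
      fix x assume x: "x \<in> V"
      then have "double x \<in> Q" using VP unfolding Q_double by blast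
      then have "-1 \<le> double x \<bullet> n" using n polarD by (auto simp: extreme_point_of_def)
      then show "-1 < double x \<bullet> n" using * x by (auto simp: order_less_le)
    qed
    ultimately have "n \<in> interior polar" by (meson interiorI)
    then show False using extreme_point_not_in_interior [OF n] by simp
  qed
  then show ?thesis using that V(2) VP by blast
qed

lemma lift_tight:
  assumes "double x \<bullet> n = -1"
  shows "lift n = (n, - (x \<bullet> n))"
  using assms by (simp add: lift_def double_def inner_diff_left)

lemma lift_lattice:
  assumes "n \<in> int_lattice" "x \<in> int_lattice" "double x \<bullet> n = -1"
  shows "lift n \<in> int_lattice"
  unfolding lift_tight [OF assms(3)] int_lattice_Pair using assms int_lattice_inner by auto

lemma lift_convex_comb: "lift ((1 - u) *\<^sub>R a + u *\<^sub>R b) = (1 - u) *\<^sub>R lift a + u *\<^sub>R lift b"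
proof -
  have "m \<bullet> ((1 - u) *\<^sub>R a + u *\<^sub>R b) = (1 - u) * (m \<bullet> a) + u * (m \<bullet> b)" by (simp add: inner_add_right)
  then show ?thesis unfolding lift_def by simp (simp add: field_simps)
qed

lemma double_convex_comb: "double ((1 - u) *\<^sub>R a + u *\<^sub>R b) = (1 - u) *\<^sub>R double a + u *\<^sub>R double b"
  by (simp add: double_def algebra_simps)

lemma apex_lattice: "apex \<in> int_lattice"
  using lattice_m by (simp add: apex_def int_lattice_Pair)

text \<open>Primitivity follows from \<open>apex \<bullet> lift n = 1\<close>. That the ray is a
  face is the extremality of \<open>n\<close>, carried over from height one to the cone.\<close>

lemma lift_ray_generator:
  assumes n: "n extreme_point_of polar"
  shows "lift n \<in> primitive_ray_generators C"
proof -
  obtain x where x: "x \<in> P \<inter> int_lattice" "double x \<bullet> n = -1" by (rule extreme_polar_tight [OF n])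
  have np: "n \<in> polar" using n by (simp add: extreme_point_of_def)
  have "lift n \<in> int_lattice" using lift_lattice polar_extreme_lattice [OF n] x by blast
  then have "primitive (lift n)"
    by (rule primitive_of_inner [OF _ apex_lattice]) (simp add: inner_commute)
  moreover have "{t *\<^sub>R lift n | t. 0 \<le> t} face_of C"
    unfolding face_of_def
  proof (intro conjI ballI impI)
    show "{t *\<^sub>R lift n | t. 0 \<le> t} \<subseteq> C" using lift_mem_iff np C_scaleR by blast
    show "convex {t *\<^sub>R lift n | t. 0 \<le> t}"
    proof (rule convexI)
      fix a b u v :: real and p q
      assume "p \<in> {t *\<^sub>R lift n | t. 0 \<le> t}" "q \<in> {t *\<^sub>R lift n | t. 0 \<le> t}" "0 \<le> u" "0 \<le> v"
      then obtain s t where "p = s *\<^sub>R lift n" "q = t *\<^sub>R lift n" "0 \<le> s" "0 \<le> t" by blast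
      then have "u *\<^sub>R p + v *\<^sub>R q = (u * s + v * t) *\<^sub>R lift n" "0 \<le> u * s + v * t"
        using \<open>0 \<le> u\<close> \<open>0 \<le> v\<close> by (simp_all add: algebra_simps)
      then show "u *\<^sub>R p + v *\<^sub>R q \<in> {t *\<^sub>R lift n | t. 0 \<le> t}" by blast
    qed
    \<comment> \<open>The other end follows by symmetry. If an end has height zero it vanishes;
      otherwise both ends are rescaled to height one, where extremality of \<open>n\<close>
      applies.\<close>
    have half: "\<exists>s\<ge>0. a = s *\<^sub>R lift n"
      if ab: "a \<in> C" "b \<in> C" and seg: "t *\<^sub>R lift n \<in> open_segment a b" and t: "0 \<le> t" for a b t
    proof -
      obtain u where u: "0 < u" "u < 1" "t *\<^sub>R lift n = (1 - u) *\<^sub>R a + u *\<^sub>R b" using seg by (auto simp: in_segment)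
      define \<alpha> \<beta> where "\<alpha> = apex \<bullet> a" and "\<beta> = apex \<bullet> b"
      have sum: "t = (1 - u) * \<alpha> + u * \<beta>"
        using arg_cong [OF u(3), of "\<lambda>x. apex \<bullet> x"] by (simp add: inner_add_right \<alpha>_def \<beta>_def)
      have nn: "0 \<le> \<alpha>" "0 \<le> \<beta>" using C_apex_inner(1) ab by (simp_all add: \<alpha>_def \<beta>_def)
      consider "\<alpha> = 0" | "\<beta> = 0" | "0 < \<alpha>" "0 < \<beta>" using nn by linarith
      then show ?thesis
      proof cases
        case 1
        then show ?thesis using C_apex_inner(2) [OF ab(1)] by (intro exI [of _ 0]) (simp add: \<alpha>_def)
      next
        case 2
        then have "b = 0" using C_apex_inner(2) [OF ab(2)] by (simp add: \<beta>_def)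
        then have "(1 / (1 - u)) *\<^sub>R (t *\<^sub>R lift n) = a" unfolding u(3) using u(2) by simp
        then show ?thesis using t u(2) by (intro exI [of _ "t / (1 - u)"]) auto
      next
        case 3
        obtain ya where ya: "a = \<alpha> *\<^sub>R lift ya" "ya \<in> polar"
          using C_apex_inner(3) [OF ab(1)] 3(1) unfolding \<alpha>_def by blast
        obtain yb where yb: "b = \<beta> *\<^sub>R lift yb" "yb \<in> polar"
          using C_apex_inner(3) [OF ab(2)] 3(2) unfolding \<beta>_def by blast
        have t0: "0 < t" unfolding sum using 3 u by (intro add_pos_pos mult_pos_pos) auto
        \<comment> \<open>The weight of \<open>yb\<close> after the combination is divided by its
          total height \<open>t\<close>.\<close>
        define w where "w = u * \<beta> / t"
        have w: "0 < w" "w < 1" "1 - w = (1 - u) * \<alpha> / t"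
        proof -
          show "0 < w" using u 3 t0 by (simp add: w_def)
          show "1 - w = (1 - u) * \<alpha> / t" using t0 sum by (simp add: w_def field_simps)
          then show "w < 1" using u 3 t0 by (metis diff_gt_0_iff_gt divide_pos_pos mult_pos_pos)
        qed
        have "t *\<^sub>R n = ((1 - u) * \<alpha>) *\<^sub>R ya + (u * \<beta>) *\<^sub>R yb"
          using arg_cong [OF u(3), of fst] ya(1) yb(1) by (simp add: lift_def)
        then have "(1 / t) *\<^sub>R (t *\<^sub>R n) = (1 / t) *\<^sub>R (((1 - u) * \<alpha>) *\<^sub>R ya + (u * \<beta>) *\<^sub>R yb)" by simp
        then have nw: "n = (1 - w) *\<^sub>R ya + w *\<^sub>R yb"
          using t0 unfolding w(3) by (simp add: scaleR_add_right w_def)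
        have "ya = yb"
        proof (rule ccontr)
          assume "ya \<noteq> yb"
          then have "n \<in> open_segment ya yb" using nw w unfolding in_segment by blast
          then show False using n ya yb by (auto simp: extreme_point_of_def)
        qed
        then have "ya = n" using nw by (simp flip: scaleR_add_left)
        then show ?thesis using ya nn by blast
      qed
    qed
    fix a b z assume "a \<in> C" "b \<in> C" "z \<in> {t *\<^sub>R lift n | t. 0 \<le> t}" "z \<in> open_segment a b"
    then show "a \<in> {t *\<^sub>R lift n | t. 0 \<le> t}" "b \<in> {t *\<^sub>R lift n | t. 0 \<le> t}"
      using half [of a b] half [of b a] unfolding open_segment_commute [of b a] by blast+
  qed
  ultimately show ?thesis by (simp add: primitive_ray_generators_def)
qed

text \<open>Rescaled to height one, the generator comes from an extreme point \<open>v\<close> of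
  \<open>polar\<close>. So \<open>lift v\<close> is a lattice point and \<open>y\<close> is its
  multiple by the integer \<open>apex \<bullet> y\<close>, which primitivity makes 1.\<close>

lemma ray_generator_apex:
  assumes "y \<in> primitive_ray_generators C"
  shows "apex \<bullet> y = 1"
proof -
  let ?R = "{t *\<^sub>R y | t. 0 \<le> t}"
  have prim: "primitive y" and face: "?R face_of C" using assms by (auto simp: primitive_ray_generators_def)
  have "1 *\<^sub>R y \<in> ?R" by (intro CollectI exI [of _ 1]) simp
  then have yR: "y \<in> ?R" by simp
  then have yC: "y \<in> C" using face_of_imp_subset [OF face] by blast
  have y0: "y \<noteq> 0" by (rule primitive_imp_nonzero [OF prim])
  define c where "c = apex \<bullet> y"
  have c: "0 < c" using C_apex_inner(1,2) [OF yC] y0 by (auto simp: c_def order_less_le)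
  obtain v where v: "y = c *\<^sub>R lift v" "v \<in> polar" using C_apex_inner(3) [OF yC] c unfolding c_def by blast
  have "v extreme_point_of polar"
    unfolding extreme_point_of_def
  proof (intro conjI ballI notI)
    show "v \<in> polar" by (rule v(2))
    fix a b assume ab: "a \<in> polar" "b \<in> polar" and seg: "v \<in> open_segment a b"
    then obtain u where u: "a \<noteq> b" "0 < u" "u < 1" "v = (1 - u) *\<^sub>R a + u *\<^sub>R b" by (auto simp: in_segment)
    have "y = (1 - u) *\<^sub>R (c *\<^sub>R lift a) + u *\<^sub>R (c *\<^sub>R lift b)"
      unfolding v(1) u(4) lift_convex_comb by (simp add: algebra_simps)
    moreover have "c *\<^sub>R lift a \<noteq> c *\<^sub>R lift b" using c u(1) by (simp add: lift_def)
    ultimately have "y \<in> open_segment (c *\<^sub>R lift a) (c *\<^sub>R lift b)" using u unfolding in_segment by blast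
    moreover have "c *\<^sub>R lift a \<in> C" "c *\<^sub>R lift b \<in> C" using ab lift_mem_iff C_scaleR c by auto
    ultimately have "c *\<^sub>R lift a \<in> ?R" "c *\<^sub>R lift b \<in> ?R" using face_ofD [OF face] yR by blast+
    then obtain s t where st: "c *\<^sub>R lift a = s *\<^sub>R y" "c *\<^sub>R lift b = t *\<^sub>R y" by blast
    have "c = s * c" "c = t * c"
      using arg_cong [OF st(1), of "\<lambda>x. apex \<bullet> x"] arg_cong [OF st(2), of "\<lambda>x. apex \<bullet> x"] by (simp_all add: c_def)
    then have "s = 1" "t = 1" using c by auto
    then have "c *\<^sub>R lift a = c *\<^sub>R lift b" using st by simp
    then show False using \<open>c *\<^sub>R lift a \<noteq> c *\<^sub>R lift b\<close> by simp
  qed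
  then have "lift v \<in> int_lattice"
    using lift_ray_generator primitive_imp_int_lattice by (auto simp: primitive_ray_generators_def)
  moreover have "c \<in> \<int>"
    using int_lattice_inner [OF apex_lattice primitive_imp_int_lattice [OF prim]] by (simp add: c_def)
  then obtain i where i: "c = of_int i" by (rule Ints_cases)
  then have "y = real (nat i) *\<^sub>R lift v" using v(1) c by simp
  ultimately have "nat i = 1" using prim unfolding primitive_def by blast
  then show ?thesis using i c_def by simp
qed

text \<open>\<open>Q\<close> is bounded, so \<open>polar\<close> contains a small positive multiple
  of \<open>e\<close> itself.\<close>

lemma polar_spans:
  assumes "\<And>y. y \<in> polar \<Longrightarrow> e \<bullet> y = 0"
  shows "e = 0"
proof -
  obtain B where B: "0 < B" "\<And>x. x \<in> Q \<Longrightarrow> norm x \<le> B" using bounded_Q bounded_pos by metis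
  define s where "s = 1 / (B * (norm e + 1))"
  have s: "0 < s" using B(1) by (simp add: s_def add_nonneg_pos)
  have "s *\<^sub>R e \<in> polar"
    unfolding polar_def mem_Collect_eq
  proof
    fix x assume "x \<in> Q"
    have "\<bar>x \<bullet> (s *\<^sub>R e)\<bar> \<le> norm x * norm (s *\<^sub>R e)" by (rule Cauchy_Schwarz_ineq2)
    also have "\<dots> \<le> B * (s * norm e)" using B(1) B(2) [OF \<open>x \<in> Q\<close>] s by (intro mult_mono) auto
    also have "\<dots> \<le> B * (s * (norm e + 1))" using B(1) s by (intro mult_left_mono) auto
    also have "\<dots> = 1"
    proof -
      have "B * (norm e + 1) \<noteq> 0" using B(1) by (smt (verit) mult_pos_pos norm_ge_zero)
      then show ?thesis unfolding s_def by (simp add: field_simps)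
    qed
    finally show "-1 \<le> x \<bullet> (s *\<^sub>R e)" by linarith
  qed
  then have "s * (e \<bullet> e) = 0" using assms by fastforce
  then show ?thesis using s by simp
qed

lemma zero_mem_polar: "0 \<in> polar"
  by (simp add: polar_def)

text \<open>For uniqueness, the difference of a competitor and \<open>apex\<close> vanishes on the
  lifted vertices of \<open>polar\<close>, hence on all of the lifted polar. The point 0 of
  \<open>polar\<close> kills the constant part, and \<open>polar_spans\<close> the linear
  part.\<close>

lemma gorenstein_point_eq: "gorenstein_point P = apex"
  unfolding gorenstein_point_def
proof (rule the_equality)
  show "apex \<in> int_lattice \<and> (\<forall>y\<in>primitive_ray_generators C. apex \<bullet> y = 1)"
    using apex_lattice ray_generator_apex by blast
  fix m' assume m': "m' \<in> int_lattice \<and> (\<forall>y\<in>primitive_ray_generators C. m' \<bullet> y = 1)"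
  obtain d1 d2 where d: "m' - apex = (d1, d2)" by (cases "m' - apex")
  \<comment> \<open>The coefficient vector of twice the functional \<open>m' - apex\<close> composed
    with \<open>lift\<close>; the constant part is \<open>d2\<close>.\<close>
  define e where "e = 2 *\<^sub>R d1 - d2 *\<^sub>R m"
  have lift_e: "(m' - apex) \<bullet> lift y = 0 \<longleftrightarrow> e \<bullet> y = - d2" for y
  proof -
    have "2 * ((m' - apex) \<bullet> lift y) = e \<bullet> y + d2"
      unfolding d lift_def e_def by (simp add: inner_diff_left field_simps)
    then show ?thesis by linarith
  qed
  have "e \<bullet> n = - d2" if "n extreme_point_of polar" for n
    using m' lift_ray_generator [OF that] lift_e [of n] by (simp add: inner_diff_left)
  then have "{n. n extreme_point_of polar} \<subseteq> {y. e \<bullet> y = - d2}" by blast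
  moreover have "polar = convex hull {n. n extreme_point_of polar}"
    using obtain_polar_vertices Krein_Milman_polytope by metis
  ultimately have "polar \<subseteq> {y. e \<bullet> y = - d2}"
    by (metis convex_hyperplane hull_minimal)
  then have all: "e \<bullet> y = - d2" if "y \<in> polar" for y using that by blast
  then have "d2 = 0" using zero_mem_polar by fastforce
  then have "e = 0" using polar_spans all by simp
  then have "d1 = 0" using \<open>d2 = 0\<close> by (simp add: e_def)
  then show "m' = apex" using d \<open>d2 = 0\<close> by (metis eq_iff_diff_eq_0 zero_prod_def)
qed

lemma dual_gorenstein_eq: "dual_gorenstein P = lift ` polar"
proof (intro set_eqI iffI)
  fix v assume "v \<in> dual_gorenstein P"
  then have v: "v \<in> C" "apex \<bullet> v = 1" by (auto simp: dual_gorenstein_def gorenstein_point_eq)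
  then have "v = lift (fst v) \<and> fst v \<in> polar" using C_apex_inner(3) [OF v(1)] by simp
  then show "v \<in> lift ` polar" by blast
qed (auto simp: dual_gorenstein_def gorenstein_point_eq lift_mem_iff)

lemma dual_face_eq: "dual_face P E = lift ` dual_edge (double ` E)"
proof -
  have "(x, 1) \<bullet> lift y = 0 \<longleftrightarrow> double x \<bullet> y = -1" for x y
  proof -
    have "2 * ((x, 1) \<bullet> lift y) = double x \<bullet> y + 1"
      by (simp add: lift_def double_def inner_diff_left field_simps)
    then show ?thesis by linarith
  qed
  then show ?thesis by (auto simp: dual_face_def dual_gorenstein_eq dual_edge_def)
qed

lemma double_edge_iff: "double ` E edge_of Q \<longleftrightarrow> E edge_of P"
proof -
  let ?s = "\<lambda>x :: real ^ 3. 2 *\<^sub>R x"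
  have img: "double ` S = (+) (- m) ` ?s ` S" for S
    by (simp add: image_image double_def)
  have lin: "linear ?s" "inj ?s" by (auto simp: inj_on_def)
  have "double ` E face_of double ` P \<longleftrightarrow> E face_of P"
    unfolding img face_of_translation_eq face_of_linear_image [OF lin] ..
  moreover have "aff_dim (double ` E) = aff_dim E"
    unfolding img aff_dim_translation_eq by (rule aff_dim_injective_linear_image [OF lin])
  ultimately show ?thesis by (simp add: edge_of_def Q_double)
qed

lemma edges_Q: "{E. E edge_of Q} = (`) double ` {E. E edge_of P}"
proof (intro set_eqI iffI)
  fix E assume E: "E \<in> {E. E edge_of Q}"
  then have "E \<subseteq> double ` P" using edge_of_imp_subset Q_double by auto
  then obtain F where "E = double ` F" by (meson subset_imageE)
  then show "E \<in> (`) double ` {E. E edge_of P}" using E double_edge_iff by blast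
qed (auto simp: double_edge_iff)

lemma edge_volumes:
  assumes E: "E edge_of P"
  shows "normalized_volume (double ` E) = 2 * normalized_volume E"
    "normalized_volume (dual_face P E) = normalized_volume (dual_edge (double ` E))"
proof -
  obtain a b where ab: "E = closed_segment a b" "a \<noteq> b" "a \<in> P \<inter> int_lattice" "b \<in> P \<inter> int_lattice"
    using lattice_polytope_edge [OF lattice_P E] by metis
  have img: "double ` E = closed_segment (double a) (double b)"
    unfolding ab(1) by (rule image_closed_segment) (rule double_convex_comb)
  obtain w c where w: "primitive w" "0 < (c :: nat)" "b - a = real c *\<^sub>R w"
    using exists_primitive [of "b - a"] int_lattice_diff [of b a] ab by auto
  have b: "b = a + real c *\<^sub>R w" using w(3) by (simp add: algebra_simps)
  have "double b = double a + real (2 * c) *\<^sub>R w" by (simp add: b double_def scaleR_add_right)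
  then have "normalized_volume (double ` E) = real (2 * c)"
    unfolding img using ab w double_lattice by (simp only:) (intro normalized_volume_segment; simp)
  moreover have "normalized_volume E = real c"
    unfolding ab(1) b using ab(3) w by (intro normalized_volume_segment) auto
  ultimately show "normalized_volume (double ` E) = 2 * normalized_volume E" by simp
  have EQ: "double ` E edge_of Q" using E double_edge_iff by simp
  obtain a' n v c' d where a': "a' \<in> int_lattice" "primitive v" "0 < (c' :: nat)"
      "double ` E = closed_segment a' (a' + real c' *\<^sub>R v)"
    and n: "n \<in> int_lattice" "primitive (cross3 a' v)" "0 < (d :: nat)"
      "dual_edge (double ` E) = closed_segment n (n + real d *\<^sub>R cross3 a' v)"
    by (rule edge_duality [OF EQ]) (rule that; assumption)
  \<comment> \<open>A segment determines its pair of ends, so \<open>a'\<close>, which came from the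
    edge of \<open>Q\<close>, is the double of a lattice point.\<close>
  have "{a', a' + real c' *\<^sub>R v} = {double a, double b}" using img a'(4) by simp
  then obtain x where x: "x \<in> int_lattice" "a' = double x" using ab(3,4) by (metis IntD2 doubleton_eq_iff)
  have "a' \<in> double ` E" "n \<in> dual_edge (double ` E)" using a'(4) n(4) by auto
  then have an: "double x \<bullet> n = -1" using x(2) by (auto simp: dual_edge_def)
  define u where "u = cross3 a' v"
  have "double x \<bullet> u = 0" by (simp add: u_def x(2) flip: det3_def)
  then have mu: "m \<bullet> u = 2 * (x \<bullet> u)" by (simp add: double_def inner_diff_left)
  have ul: "u \<in> int_lattice" using primitive_imp_int_lattice [OF n(2)] by (simp add: u_def)
  \<comment> \<open>The image direction of \<open>u\<close> under \<open>lift\<close>. As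
    \<open>double x\<close> is orthogonal to \<open>u\<close>, the last coordinate
    \<open>- (m \<bullet> u) / 2\<close> is the integer \<open>- (x \<bullet> u)\<close>.\<close>
  define u' where "u' = (u, - (x \<bullet> u))"
  have u'l: "u' \<in> int_lattice" using ul x(1) int_lattice_inner by (auto simp: u'_def int_lattice_Pair)
  have "primitive u'"
    unfolding primitive_def
  proof (intro conjI ballI allI impI)
    show "u' \<noteq> 0" using primitive_imp_nonzero [OF n(2)] by (simp add: u'_def u_def zero_prod_def)
    fix l :: nat and z assume z: "z \<in> int_lattice" "u' = real l *\<^sub>R z"
    obtain z1 z2 where zz: "z = (z1, z2)" by (cases z)
    have "z1 \<in> int_lattice" "u = real l *\<^sub>R z1" using z zz by (simp_all add: int_lattice_Pair u'_def)
    then show "l = 1" using n(2) unfolding primitive_def u_def [symmetric] by blast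
  qed (rule u'l)
  have lift_add: "lift (n + t *\<^sub>R u) = lift n + t *\<^sub>R u'" for t
    by (simp add: lift_def u'_def inner_add_right mu diff_divide_distrib add_divide_distrib)
  have "lift ` closed_segment n (n + real d *\<^sub>R u) = closed_segment (lift n) (lift n + real d *\<^sub>R u')"
  proof -
    have "lift ` closed_segment n k = closed_segment (lift n) (lift k)" for k
      by (rule image_closed_segment) (rule lift_convex_comb)
    then show ?thesis by (simp add: lift_add)
  qed
  then have "dual_face P E = closed_segment (lift n) (lift n + real d *\<^sub>R u')"
    unfolding dual_face_eq n(4) u_def [symmetric] by simp
  moreover have "lift n \<in> int_lattice" by (rule lift_lattice [OF n(1) x(1) an])
  ultimately have "normalized_volume (dual_face P E) = real d"
    using normalized_volume_segment \<open>primitive u'\<close> n(3) by metis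
  moreover have "normalized_volume (dual_edge (double ` E)) = real d"
    unfolding n(4) by (rule normalized_volume_segment [OF n(1-3)])
  ultimately show "normalized_volume (dual_face P E) = normalized_volume (dual_edge (double ` E))" by simp
qed

theorem sum_edges_dual_faces:
  "(\<Sum>E | E edge_of P. normalized_volume E * normalized_volume (dual_face P E)) = 12"
proof -
  have inj: "inj_on ((`) double) {E. E edge_of P}"
    using inj_image_eq_iff [OF inj_double] by (auto simp: inj_on_def)
  have "(\<Sum>E | E edge_of Q. normalized_volume E * normalized_volume (dual_edge E)) =
      (\<Sum>E | E edge_of P. normalized_volume (double ` E) * normalized_volume (dual_edge (double ` E)))"
    unfolding edges_Q by (simp add: sum.reindex [OF inj])
  also have "\<dots> = (\<Sum>E | E edge_of P. 2 * (normalized_volume E * normalized_volume (dual_face P E)))"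
    by (rule sum.cong) (simp_all add: edge_volumes)
  finally show ?thesis using sum_edges_dual_edges by (simp flip: sum_distrib_left)
qed

end

theorem proposition3p4:
  fixes P :: "(real ^ 3) set"
  assumes "gorenstein P"
    and "has_lattice_degree P 2"
  shows "(\<Sum>E | E edge_of P. normalized_volume E * normalized_volume (dual_face P E)) = 12"
proof -
  obtain r m where r: "lattice_polytope P" "1 \<le> r" "m \<in> int_lattice"
    "reflexive ((\<lambda>x. x - m) ` dilate r P)"
    using assms(1) unfolding gorenstein_def gorenstein_of_index_def by blast
  have "r = 2" by (rule index_two [OF r(2-4) assms(2)])
  then interpret gorenstein_index_two P m
    using r by unfold_locales simp_all
  show ?thesis by (rule sum_edges_dual_faces)
qed

end
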